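(* If $0\le m,n\le p-1$ and $q\ge0$, then $$\operatorname{Ext}^q(S_m,S_n)=\begin{cases}k&\text{if }(n=m\text{ and }q=0)\text{ or }(n>m\text{ and }(q=n-m-1\text{ or }q=n-m)),\\0&\text{otherwise.}\end{cases}$$
   Context: $k$ is a field of characteristic $p>0$; $\mathcal{P}_e$ is the abelian category of homogeneous strict polynomial functors of degree $e$ over $k$ (Friedlander–Suslin; functors from finite-dimensional $k$-vector spaces to finite-dimensional $k$-vector spaces). For a partition (Young diagram) $\lambda=(\lambda_1,\dots,\lambda_n)$ of $e$ with conjugate $\widetilde\lambda$, put $\Lambda^\lambda=\Lambda^{\lambda_1}\otimes\dots\otimes\Lambda^{\lambda_n}$, $S^\lambda=S^{\lambda_1}\otimes\dots\otimes S^{\lambda_n}$ (tensor products of exterior, resp. symmetric, powers). The Schur functor $S_\lambda$ is the image of the composite $\Lambda^\lambda\hookrightarrow I^{\otimes e}\to I^{\otimes e}\twoheadrightarrow S^{\widetilde\lambda}$ of the natural monomorphism, the permutation of tensor factors that passes from the row reading to the column reading of the boxes of $\lambda$, and the natural epimorphism. For $0\le i\le p-1$ put $S_i=S_{(i+1,1^{p-i-1})}$ in $\mathcal{P}_p$. $\operatorname{Ext}$-groups are computed in $\mathcal{P}_p$ (equivalently in its block $\mathcal{P}_p^\varnothing$ corresponding to hooks). *)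

theory Defs
  imports
    Complex_Main
    "HOL-Library.Function_Algebras"
    "HOL-Library.Set_Algebras"
    "HOL-Library.Product_Plus"
    "HOL-Library.Poly_Mapping"
    "HOL-Library.Multiset"
begin

section \<open>Linear algebra in spaces of coordinate functions\<close>

text \<open>
  All vector spaces that occur as values of functors are subspaces of a space \<^typ>\<open>'l \<Rightarrow> 'k\<close> of
  functions on a set of labels. If \<^typ>\<open>'l\<close> is infinite, every finite-dimensional space over
  \<^typ>\<open>'k\<close> has an isomorphic copy among the finite-dimensional subspaces of \<^typ>\<open>'l \<Rightarrow> 'k\<close>.
\<close>

definition vscale :: "'k::field \<Rightarrow> ('l \<Rightarrow> 'k) \<Rightarrow> ('l \<Rightarrow> 'k)" where
  "vscale c v = (\<lambda>x. c * v x)"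

global_interpretation fun_vs: vector_space "vscale :: 'k::field \<Rightarrow> ('l \<Rightarrow> 'k) \<Rightarrow> ('l \<Rightarrow> 'k)"
  by unfold_locales (auto simp: vscale_def fun_eq_iff algebra_simps)

definition fin_dim_subspace :: "('l \<Rightarrow> 'k::field) set \<Rightarrow> bool" where
  "fin_dim_subspace V \<longleftrightarrow> (\<exists>B. finite B \<and> V = fun_vs.span B)"

definition linear_between ::
  "('l \<Rightarrow> 'k::field) set \<Rightarrow> ('m \<Rightarrow> 'k) set \<Rightarrow> (('l \<Rightarrow> 'k) \<Rightarrow> ('m \<Rightarrow> 'k)) \<Rightarrow> bool" where
  "linear_between V W f \<longleftrightarrow>
     f ` V \<subseteq> W \<and>
     (\<forall>x\<in>V. \<forall>y\<in>V. f (x + y) = f x + f y) \<and>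
     (\<forall>c. \<forall>x\<in>V. f (vscale c x) = vscale c (f x))"

definition unit_vec :: "'l \<Rightarrow> ('l \<Rightarrow> 'k::field)" where
  "unit_vec x = (\<lambda>y. if y = x then 1 else 0)"

definition coord_space :: "'l set \<Rightarrow> ('l \<Rightarrow> 'k::field) set" where
  "coord_space A = {v. \<forall>x. x \<notin> A \<longrightarrow> v x = 0}"

definition lin_ext :: "'l set \<Rightarrow> ('l \<Rightarrow> ('m \<Rightarrow> 'k::field)) \<Rightarrow> ('l \<Rightarrow> 'k) \<Rightarrow> ('m \<Rightarrow> 'k)" where
  "lin_ext A f v = (\<Sum>x\<in>A. vscale (v x) (f x))"


section \<open>Homogeneous strict polynomial functors\<close>

text \<open>
  The source category of finite-dimensional spaces is replaced by its skeleton of the spaces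
  $k^n$ for natural numbers $n$. The space of homogeneous polynomial maps
  $S^e(\mathrm{Hom}(k^n,k^m)^*) \otimes \mathrm{Hom}(F(k^n),F(k^m))$ is described in the monomial
  basis of its left factor: if $x_{ij}$ ($i < m$, $j < n$) are the coordinate functions of an
  $m \times n$ matrix, then \<open>coef F m n \<alpha>\<close> is the linear map $F(k^n) \to F(k^m)$ that accompanies
  the monomial with exponents \<open>\<alpha>\<close>. Values of \<open>coef\<close> at other exponents carry no meaning.
\<close>

type_synonym expo = "nat \<times> nat \<Rightarrow>\<^sub>0 nat"

definition expos :: "nat \<Rightarrow> nat \<Rightarrow> nat \<Rightarrow> expo set" where
  "expos m n e =
     {\<alpha>. Poly_Mapping.keys \<alpha> \<subseteq> {..<m} \<times> {..<n} \<and>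
         (\<Sum>u\<in>Poly_Mapping.keys \<alpha>. Poly_Mapping.lookup \<alpha> u) = e}"

definition mono_eval :: "expo \<Rightarrow> (nat \<times> nat \<Rightarrow> 'r::comm_semiring_1) \<Rightarrow> 'r" where
  "mono_eval \<alpha> A = (\<Prod>u\<in>Poly_Mapping.keys \<alpha>. A u ^ Poly_Mapping.lookup \<alpha> u)"

definition id_matrix :: "nat \<times> nat \<Rightarrow> 'k::field" where
  "id_matrix = (\<lambda>(i, j). if i = j then 1 else 0)"

text \<open>
  Polynomials in two families of variables $x_{ij}$, $y_{ij}$: the monomial $x^\alpha y^\beta$ is
  the pair \<open>(\<alpha>, \<beta>)\<close>.
\<close>

type_synonym 'k poly2 = "expo \<times> expo \<Rightarrow>\<^sub>0 'k"

definition var_x :: "nat \<times> nat \<Rightarrow> 'k::field poly2" where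
  "var_x u = Poly_Mapping.single (Poly_Mapping.single u 1, 0) 1"

definition var_y :: "nat \<times> nat \<Rightarrow> 'k::field poly2" where
  "var_y u = Poly_Mapping.single (0, Poly_Mapping.single u 1) 1"

definition generic_product :: "nat \<Rightarrow> nat \<times> nat \<Rightarrow> 'k::field poly2" where
  "generic_product m = (\<lambda>(i, k). \<Sum>j<m. var_x (i, j) * var_y (j, k))"

record ('l, 'k) spf =
  obj :: "nat \<Rightarrow> ('l \<Rightarrow> 'k) set"
  coef :: "nat \<Rightarrow> nat \<Rightarrow> expo \<Rightarrow> ('l \<Rightarrow> 'k) \<Rightarrow> ('l \<Rightarrow> 'k)"

text \<open>
  The last conjunct is the identity $F(X) \circ F(Y) = F(XY)$ of polynomial maps for matrices $X$,
  $Y$ of independent variables, compared at each monomial $x^\alpha y^\beta$. Both sides are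
  homogeneous of degree $e$ in $x$ and in $y$, so no other monomials occur.
\<close>

definition strict_poly_functor :: "nat \<Rightarrow> ('l, 'k::field) spf \<Rightarrow> bool" where
  "strict_poly_functor e F \<longleftrightarrow>
     (\<forall>n. fin_dim_subspace (obj F n)) \<and>
     (\<forall>m n. \<forall>\<alpha>\<in>expos m n e. linear_between (obj F n) (obj F m) (coef F m n \<alpha>)) \<and>
     (\<forall>n. \<forall>v\<in>obj F n.
        (\<Sum>\<alpha>\<in>expos n n e. vscale (mono_eval \<alpha> id_matrix) (coef F n n \<alpha> v)) = v) \<and>
     (\<forall>l m n. \<forall>\<alpha>\<in>expos l m e. \<forall>\<beta>\<in>expos m n e. \<forall>v\<in>obj F n.
        coef F l m \<alpha> (coef F m n \<beta> v) =
        (\<Sum>\<gamma>\<in>expos l n e.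
           vscale (Poly_Mapping.lookup (mono_eval \<gamma> (generic_product m)) (\<alpha>, \<beta>))
             (coef F l n \<gamma> v)))"


section \<open>Morphisms and injective objects\<close>

type_synonym ('l, 'm, 'k) family = "nat \<Rightarrow> ('l \<Rightarrow> 'k) \<Rightarrow> ('m \<Rightarrow> 'k)"

text \<open>
  The components are required to vanish outside the source, so that a morphism is determined by its
  restrictions to the spaces \<open>obj F n\<close> and the morphisms form a subspace of the function space.
\<close>

definition Hom :: "nat \<Rightarrow> ('l, 'k::field) spf \<Rightarrow> ('m, 'k) spf \<Rightarrow> ('l, 'm, 'k) family set" where
  "Hom e F G =
     {f. (\<forall>n. linear_between (obj F n) (obj G n) (f n)) \<and>
         (\<forall>n v. v \<notin> obj F n \<longrightarrow> f n v = 0) \<and>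
         (\<forall>m n. \<forall>\<alpha>\<in>expos m n e. \<forall>v\<in>obj F n.
            f m (coef F m n \<alpha> v) = coef G m n \<alpha> (f n v))}"

definition comp_family ::
  "('l, 'm, 'k) family \<Rightarrow> ('h, 'l, 'k) family \<Rightarrow> ('h, 'm, 'k) family" where
  "comp_family g f = (\<lambda>n v. g n (f n v))"

definition family_scale ::
  "'k::field \<Rightarrow> ('l, 'm, 'k) family \<Rightarrow> ('l, 'm, 'k) family" where
  "family_scale c f = (\<lambda>n v. vscale c (f n v))"

text \<open>Kernels and images of strict polynomial functors are formed pointwise.\<close>

definition monic :: "('l, 'k::field) spf \<Rightarrow> ('l, 'm, 'k) family \<Rightarrow> bool" where
  "monic F f \<longleftrightarrow> (\<forall>n. inj_on (f n) (obj F n))"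

definition exact_at ::
  "('l, 'k::field) spf \<Rightarrow> ('l, 'm, 'k) family \<Rightarrow> ('m, 'k) spf \<Rightarrow> ('m, 'h, 'k) family \<Rightarrow> bool" where
  "exact_at F f G g \<longleftrightarrow> (\<forall>n. f n ` obj F n = {v \<in> obj G n. g n v = 0})"

definition injective_spf :: "nat \<Rightarrow> ('l, 'k::field) spf \<Rightarrow> bool" where
  "injective_spf e J \<longleftrightarrow>
     strict_poly_functor e J \<and>
     (\<forall>(F :: ('l, 'k) spf) (G :: ('l, 'k) spf) i f.
        strict_poly_functor e F \<and> strict_poly_functor e G \<and>
        i \<in> Hom e F G \<and> monic F i \<and> f \<in> Hom e F J \<longrightarrow>
        (\<exists>g\<in>Hom e G J. comp_family g i = f))"


section \<open>Ext groups\<close>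

record ('k, 'v) kspace =
  car :: "'v set"
  vadd :: "'v \<Rightarrow> 'v \<Rightarrow> 'v"
  smul :: "'k \<Rightarrow> 'v \<Rightarrow> 'v"

definition quotient_space ::
  "('k \<Rightarrow> 'v \<Rightarrow> 'v) \<Rightarrow> 'v::ab_group_add set \<Rightarrow> 'v set \<Rightarrow> ('k, 'v set) kspace" where
  "quotient_space s Z B =
     \<lparr> car = (\<lambda>z. z +o B) ` Z, vadd = (\<lambda>X Y. X + Y), smul = (\<lambda>c X. s c ` X + B) \<rparr>"

definition line_space :: "('k::field, 'k) kspace" where
  "line_space = \<lparr> car = UNIV, vadd = (+), smul = (*) \<rparr>"

definition zero_space :: "('k::field, 'k) kspace" where
  "zero_space = \<lparr> car = {0}, vadd = (+), smul = (*) \<rparr>"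

definition kspace_iso :: "('k, 'v) kspace \<Rightarrow> ('k, 'w) kspace \<Rightarrow> bool" (infix "\<cong>\<^sub>k" 50) where
  "V \<cong>\<^sub>k W \<longleftrightarrow>
     (\<exists>\<phi>. bij_betw \<phi> (car V) (car W) \<and>
          (\<forall>x\<in>car V. \<forall>y\<in>car V. \<phi> (vadd V x y) = vadd W (\<phi> x) (\<phi> y)) \<and>
          (\<forall>c. \<forall>x\<in>car V. \<phi> (smul V c x) = smul W c (\<phi> x)))"

type_synonym ('l, 'k) resolution =
  "(nat \<Rightarrow> ('l, 'k) spf) \<times> ('l, 'l, 'k) family \<times> (nat \<Rightarrow> ('l, 'l, 'k) family)"

fun injective_resolution ::
  "nat \<Rightarrow> ('l, 'k::field) spf \<Rightarrow> ('l, 'k) resolution \<Rightarrow> bool" where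
  "injective_resolution e G (J, \<epsilon>, d) \<longleftrightarrow>
     (\<forall>q. injective_spf e (J q)) \<and>
     \<epsilon> \<in> Hom e G (J 0) \<and>
     (\<forall>q. d q \<in> Hom e (J q) (J (Suc q))) \<and>
     monic G \<epsilon> \<and>
     exact_at G \<epsilon> (J 0) (d 0) \<and>
     (\<forall>q. exact_at (J q) (d q) (J (Suc q)) (d (Suc q)))"

fun cocycles ::
  "nat \<Rightarrow> ('l, 'k::field) spf \<Rightarrow> ('l, 'k) resolution \<Rightarrow> nat \<Rightarrow> ('l, 'l, 'k) family set" where
  "cocycles e F (J, \<epsilon>, d) q = {f \<in> Hom e F (J q). comp_family (d q) f = 0}"

fun coboundaries ::
  "nat \<Rightarrow> ('l, 'k::field) spf \<Rightarrow> ('l, 'k) resolution \<Rightarrow> nat \<Rightarrow> ('l, 'l, 'k) family set" where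
  "coboundaries e F (J, \<epsilon>, d) 0 = {0}" |
  "coboundaries e F (J, \<epsilon>, d) (Suc q) = comp_family (d q) ` Hom e F (J q)"

text \<open>
  The $q$-th right derived functor of $\mathrm{Hom}(F,-)$, evaluated at $G$ by means of an injective
  resolution of $G$ among the functors of degree $e$ with labels in \<^typ>\<open>'l\<close>. For this to be the
  Ext group of the full category the type \<^typ>\<open>'l\<close> has to be infinite.
\<close>

definition Ext ::
  "nat \<Rightarrow> nat \<Rightarrow> ('l, 'k::field) spf \<Rightarrow> ('l, 'k) spf \<Rightarrow> ('k, ('l, 'l, 'k) family set) kspace" where
  "Ext e q F G =
     (let R = (SOME R. injective_resolution e G R)
      in quotient_space family_scale (cocycles e F R q) (coboundaries e F R q))"


section \<open>Tensor, symmetric and exterior powers\<close>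

text \<open>
  The word \<open>I = [i\<^sub>1, \<dots>, i\<^sub>e]\<close> labels the basis vector $e_{i_1} \otimes \dots \otimes e_{i_e}$ of
  $(k^n)^{\otimes e}$. A matrix $A$ maps the vector of \<open>I\<close> to the sum over all words \<open>J\<close> of the
  vector of \<open>J\<close> times $\prod_t A_{J_t I_t}$, a monomial with exponents \<open>word_expo J I\<close>.
\<close>

definition words :: "nat \<Rightarrow> nat \<Rightarrow> nat list set" where
  "words e n = {I. length I = e \<and> set I \<subseteq> {..<n}}"

definition word_expo :: "nat list \<Rightarrow> nat list \<Rightarrow> expo" where
  "word_expo J I = (\<Sum>t<length I. Poly_Mapping.single (J ! t, I ! t) 1)"

definition tensor_power :: "nat \<Rightarrow> (nat list, 'k::field) spf" where
  "tensor_power e =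
     \<lparr> obj = (\<lambda>n. coord_space (words e n)),
       coef = (\<lambda>m n \<alpha>. lin_ext (words e n)
                 (\<lambda>I. \<Sum>J\<in>{J \<in> words e m. word_expo J I = \<alpha>}. unit_vec J)) \<rparr>"

fun blocks :: "nat list \<Rightarrow> 'a list \<Rightarrow> 'a list list" where
  "blocks [] I = []" |
  "blocks (r # \<mu>) I = take r I # blocks \<mu> (drop r I)"

text \<open>
  $S^\mu(k^n)$ has the basis of tensor products of monomials, given as multisets of indices; its
  functor structure is induced from the tensor power along the natural epimorphism.
\<close>

definition sym_basis :: "nat list \<Rightarrow> nat \<Rightarrow> nat multiset list set" where
  "sym_basis \<mu> n = {Ms. map size Ms = \<mu> \<and> (\<forall>M\<in>set Ms. set_mset M \<subseteq> {..<n})}"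

definition sym_epi :: "nat list \<Rightarrow> (nat list, nat multiset list, 'k::field) family" where
  "sym_epi \<mu> n = lin_ext (words (sum_list \<mu>) n) (\<lambda>I. unit_vec (map mset (blocks \<mu> I)))"

definition sym_power :: "nat list \<Rightarrow> (nat multiset list, 'k::field) spf" where
  "sym_power \<mu> =
     \<lparr> obj = (\<lambda>n. coord_space (sym_basis \<mu> n)),
       coef = (\<lambda>m n \<alpha>. lin_ext (sym_basis \<mu> n)
                 (\<lambda>Ms. sym_epi \<mu> m (coef (tensor_power (sum_list \<mu>)) m n \<alpha>
                    (unit_vec (concat (map sorted_list_of_multiset Ms)))))) \<rparr>"

text \<open>
  $\Lambda^\lambda(k^n)$ has the basis of tensor products of vectors
  $e_{a_1} \wedge \dots \wedge e_{a_d}$ with $a_1 < \dots < a_d$, given as sets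
  $\{a_1, \dots, a_d\}$. The epimorphism \<open>wedge_epi\<close> from the tensor power is used only for the
  functor structure; \<open>wedge_mono\<close> sends $e_{a_1} \wedge \dots \wedge e_{a_d}$ to
  $\sum_\sigma \mathrm{sgn}(\sigma)\, e_{a_{\sigma(1)}} \otimes \dots \otimes e_{a_{\sigma(d)}}$
  in each tensor factor.
\<close>

definition wedge_basis :: "nat list \<Rightarrow> nat \<Rightarrow> nat set list set" where
  "wedge_basis \<mu> n = {As. map card As = \<mu> \<and> (\<forall>A\<in>set As. A \<subseteq> {..<n})}"

definition word_sign :: "nat list \<Rightarrow> 'k::field" where
  "word_sign w = (- 1) ^ card {(s, t). s < t \<and> t < length w \<and> w ! s > w ! t}"

definition block_sign :: "nat list \<Rightarrow> nat list \<Rightarrow> 'k::field" where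
  "block_sign \<mu> I = prod_list (map word_sign (blocks \<mu> I))"

definition wedge_epi :: "nat list \<Rightarrow> (nat list, nat set list, 'k::field) family" where
  "wedge_epi \<mu> n = lin_ext (words (sum_list \<mu>) n)
     (\<lambda>I. if \<forall>w\<in>set (blocks \<mu> I). distinct w
          then vscale (block_sign \<mu> I) (unit_vec (map set (blocks \<mu> I))) else 0)"

definition wedge_power :: "nat list \<Rightarrow> (nat set list, 'k::field) spf" where
  "wedge_power \<mu> =
     \<lparr> obj = (\<lambda>n. coord_space (wedge_basis \<mu> n)),
       coef = (\<lambda>m n \<alpha>. lin_ext (wedge_basis \<mu> n)
                 (\<lambda>As. wedge_epi \<mu> m (coef (tensor_power (sum_list \<mu>)) m n \<alpha>
                    (unit_vec (concat (map sorted_list_of_set As)))))) \<rparr>"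

definition wedge_mono :: "nat list \<Rightarrow> (nat set list, nat list, 'k::field) family" where
  "wedge_mono \<mu> n = lin_ext (wedge_basis \<mu> n)
     (\<lambda>As. \<Sum>I\<in>{I \<in> words (sum_list \<mu>) n. map set (blocks \<mu> I) = As}.
        vscale (block_sign \<mu> I) (unit_vec I))"


section \<open>Schur functors\<close>

text \<open>Partitions are weakly decreasing lists of positive row lengths.\<close>

definition conjugate :: "nat list \<Rightarrow> nat list" where
  "conjugate \<mu> = map (\<lambda>j. length (filter (\<lambda>r. j < r) \<mu>)) [0..<foldr max \<mu> 0]"

text \<open>
  \<open>blocks \<mu> I\<close> is the filling of the diagram of \<open>\<mu>\<close> whose row reading is \<open>I\<close>; its columns, from
  left to right, are the members of \<open>transpose (blocks \<mu> I)\<close>.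
\<close>

definition row_to_column :: "nat list \<Rightarrow> (nat list, nat list, 'k::field) family" where
  "row_to_column \<mu> n = lin_ext (words (sum_list \<mu>) n)
     (\<lambda>I. unit_vec (concat (transpose (blocks \<mu> I))))"

definition image_functor ::
  "('l, 'k) spf \<Rightarrow> ('m, 'k) spf \<Rightarrow> ('l, 'm, 'k) family \<Rightarrow> ('m, 'k) spf" where
  "image_functor F G f = \<lparr> obj = (\<lambda>n. f n ` obj F n), coef = coef G \<rparr>"

definition schur_functor :: "nat list \<Rightarrow> (nat multiset list, 'k::field) spf" where
  "schur_functor \<mu> =
     image_functor (wedge_power \<mu>) (sym_power (conjugate \<mu>))
       (comp_family (sym_epi (conjugate \<mu>)) (comp_family (row_to_column \<mu>) (wedge_mono \<mu>)))"

definition hook_schur :: "nat \<Rightarrow> nat \<Rightarrow> (nat multiset list, 'k::field) spf" where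
  "hook_schur p i = schur_functor ((i + 1) # replicate (p - i - 1) 1)"

end

theory Submission
  imports Defs "HOL-Combinatorics.Permutations"
begin

text \<open>
  The hook functor $S_n$ is the kernel of the Koszul differential on $S^{p-n} \otimes \Lambda^n$. By a
  Yoneda argument, $\mathrm{Hom}(F, S^c \otimes I^{\otimes b})$ is the dual of a weight space of $F$;
  so $S^c \otimes I^{\otimes b}$ is injective, and for $a < p$ so is its direct summand
  $S^{p-a} \otimes \Lambda^a$. Hence the Koszul complex of degree $p$, which is exact, contains the
  injective resolution $0 \to S_n \to S^{p-n} \otimes \Lambda^n \to S^{p-n+1} \otimes \Lambda^{n-1}
  \to \dots \to S^p \to 0$. The space $\mathrm{Hom}(S_m, S^{p-a} \otimes \Lambda^a)$ is a line for
  $a = m$, spanned by the inclusion, and for $a = m + 1$, spanned by the restriction of the de Rham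
  differential; otherwise it is zero. The Koszul differential annihilates both generators, since its
  anticommutator with the de Rham differential is the degree $p = 0$. So the Hom complex has zero
  differentials.
\<close>

section \<open>Linear maps between spaces of functions\<close>

text \<open>The bound on Hom(S_m, S^b \<otimes> \<Lambda>^a) comes from weights. Such a morphism is
  determined by a functional on the vectors of S_m of content 0^b 1 ... a, and this functional
  changes sign under transpositions of the letters 1, ..., a. By the Koszul contraction, it suffices
  to know it on the Koszul images of basis vectors whose exterior factor contains the letter 0. Such
  a vector is given by the set D of the a - m nonzero letters in its symmetric factor. If D has two
  elements, exchanging them fixes the vector but negates its value, so the value is 0, as 2 is
  invertible for 2 \<le> a < p. If D is empty, there is one vector; if D is a singleton, all vectors
  are related by transpositions. So one coefficient determines a morphism for a = m and a = m + 1.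
  The same bound reduces the vanishing of a composite to a single coefficient, where the degree p
  appears as a factor. The term of the resolution at place q has a = n - q, which yields the degrees
  q = n - m and q = n - m - 1. As \<open>Ext\<close> is formed from an unspecified resolution, the
  comparison theorem is needed to pass to the Koszul resolution.\<close>

global_interpretation fun_vsp: vector_space_pair
  "vscale :: 'k::field \<Rightarrow> ('l \<Rightarrow> 'k) \<Rightarrow> ('l \<Rightarrow> 'k)" "vscale :: 'k \<Rightarrow> ('m \<Rightarrow> 'k) \<Rightarrow> ('m \<Rightarrow> 'k)"
  by unfold_locales

global_interpretation fun_vsf: vector_space_pair
  "vscale :: 'k::field \<Rightarrow> ('l \<Rightarrow> 'k) \<Rightarrow> ('l \<Rightarrow> 'k)" "(*) :: 'k \<Rightarrow> 'k \<Rightarrow> 'k"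
  by unfold_locales (auto simp: algebra_simps)

text \<open>Over the field itself, this rule reads \<open>a * (b * x) = a * b * x\<close>.\<close>
declare fun_vsf.vs2.scale_scale [simp del]

abbreviation lin :: "(('l \<Rightarrow> 'k::field) \<Rightarrow> ('m \<Rightarrow> 'k)) \<Rightarrow> bool" where
  "lin \<equiv> Vector_Spaces.linear vscale vscale"

abbreviation linf :: "(('l \<Rightarrow> 'k::field) \<Rightarrow> 'k) \<Rightarrow> bool" where
  "linf \<equiv> Vector_Spaces.linear vscale (*)"

lemma lin_iff: "lin f \<longleftrightarrow> (\<forall>x y. f (x + y) = f x + f y) \<and> (\<forall>c x. f (vscale c x) = vscale c (f x))"
  unfolding Vector_Spaces.linear_iff by (simp add: fun_vs.vector_space_axioms)

lemma linf_iff: "linf f \<longleftrightarrow> (\<forall>x y. f (x + y) = f x + f y) \<and> (\<forall>c x. f (vscale c x) = c * f x)"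
  unfolding Vector_Spaces.linear_iff
  by (simp add: fun_vs.vector_space_axioms fun_vsf.vs2.vector_space_axioms)

lemma vscale_apply: "vscale c v x = c * v x"
  by (simp add: vscale_def)

lemma unit_vec_apply: "unit_vec x y = (if y = x then 1 else 0)"
  by (simp add: unit_vec_def)

lemma fun_sum_apply: "(\<Sum>i\<in>A. f i) x = (\<Sum>i\<in>A. f i x)"
  by (induction A rule: infinite_finite_induct) auto

lemma lin_lin_ext: "lin (lin_ext A f)"
  unfolding lin_iff lin_ext_def
  by (simp add: fun_vs.scale_left_distrib sum.distrib fun_vs.scale_sum_right vscale_apply)

lemma lin_ext_unit:
  assumes "finite A" "x \<in> A"
  shows "lin_ext A f (unit_vec x) = f x"
proof -
  have "lin_ext A f (unit_vec x) = (\<Sum>y\<in>A. if y = x then f y else 0)"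
    unfolding lin_ext_def by (rule sum.cong) (auto simp: unit_vec_def)
  also have "\<dots> = f x" using assms by simp
  finally show ?thesis .
qed

lemma subspace_coord_space: "fun_vs.subspace (coord_space A)"
  unfolding fun_vs.subspace_def coord_space_def by (auto simp: vscale_apply)

lemma unit_vec_in_coord_space [simp]: "unit_vec x \<in> coord_space A \<longleftrightarrow> x \<in> A"
  by (auto simp: coord_space_def unit_vec_def)

lemma coord_space_decomp:
  assumes "finite A" "v \<in> coord_space A"
  shows "v = (\<Sum>x\<in>A. vscale (v x) (unit_vec x))"
proof
  fix y
  have "(\<Sum>x\<in>A. vscale (v x) (unit_vec x)) y = (\<Sum>x\<in>A. if x = y then v x else 0)"
    unfolding fun_sum_apply by (rule sum.cong) (auto simp: unit_vec_def vscale_apply)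
  also have "\<dots> = v y" using assms by (auto simp: coord_space_def)
  finally show "v y = (\<Sum>x\<in>A. vscale (v x) (unit_vec x)) y" by simp
qed

lemma coord_space_eq_span:
  assumes "finite A"
  shows "coord_space A = fun_vs.span (unit_vec ` A)"
proof (intro equalityI subsetI)
  fix v :: "'a \<Rightarrow> 'b" assume "v \<in> coord_space A"
  then have "v = (\<Sum>x\<in>A. vscale (v x) (unit_vec x))" using coord_space_decomp assms by blast
  also have "\<dots> \<in> fun_vs.span (unit_vec ` A)"
    by (intro fun_vs.span_sum fun_vs.span_scale fun_vs.span_base imageI)
  finally show "v \<in> fun_vs.span (unit_vec ` A)" .
next
  fix v :: "'a \<Rightarrow> 'b" assume "v \<in> fun_vs.span (unit_vec ` A)"
  moreover have "fun_vs.span (unit_vec ` A) \<subseteq> coord_space A"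
    by (rule fun_vs.span_minimal) (auto simp: subspace_coord_space)
  ultimately show "v \<in> coord_space A" by blast
qed

lemma fin_dim_subspace_coord_space: "finite A \<Longrightarrow> fin_dim_subspace (coord_space A)"
  unfolding fin_dim_subspace_def using coord_space_eq_span by blast

lemma fin_dim_subspace_imp_subspace: "fin_dim_subspace V \<Longrightarrow> fun_vs.subspace V"
  unfolding fin_dim_subspace_def by auto

lemma fin_dim_subspace_mono:
  assumes "fin_dim_subspace V" "fun_vs.subspace U" "U \<subseteq> V"
  shows "fin_dim_subspace U"
proof -
  obtain B where B: "finite B" "V = fun_vs.span B" using assms unfolding fin_dim_subspace_def by blast
  obtain C where C: "C \<subseteq> U" "fun_vs.independent C" "fun_vs.span C = U"
    using fun_vs.basis_exists[of U] assms(2) fun_vs.span_subspace by metis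
  have "finite C" using fun_vs.independent_span_bound[OF B(1) C(2)] C(1) B(2) assms(3) by blast
  then show ?thesis unfolding fin_dim_subspace_def using C by blast
qed

lemma lin_eq_on_coord_space:
  assumes "lin f" "lin g" "finite A" "\<And>x. x \<in> A \<Longrightarrow> f (unit_vec x) = g (unit_vec x)"
    and "v \<in> coord_space A"
  shows "f v = g v"
  using assms fun_vsp.linear_eq_on[of f g v "unit_vec ` A"] coord_space_eq_span[of A] by auto

lemma linear_betweenI:
  "lin f \<Longrightarrow> (\<And>v. v \<in> V \<Longrightarrow> f v \<in> W) \<Longrightarrow> linear_between V W f"
  unfolding linear_between_def lin_iff by auto

lemma linear_between_zero:
  assumes "linear_between V W f" "fun_vs.subspace V"
  shows "f 0 = 0"
proof -
  have "0 \<in> V" using assms(2) fun_vs.subspace_0 by blast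
  then have "f (0 + 0) = f 0 + f 0" using assms(1) unfolding linear_between_def by blast
  then show ?thesis by simp
qed

text \<open>The components of a morphism are controlled only on \<open>V\<close>, while spans,
  images and left inverses are handled through maps that are linear everywhere. The values on a
  basis of \<open>V\<close> provide such a map.\<close>

lemma linear_between_extend:
  assumes "linear_between V W f" "fun_vs.subspace V"
  obtains g where "lin g" "\<And>v. v \<in> V \<Longrightarrow> g v = f v"
proof -
  obtain B where B: "B \<subseteq> V" "fun_vs.independent B" "fun_vs.span B = V"
    using fun_vs.basis_exists[of V] assms(2) fun_vs.span_subspace by metis
  obtain g where g: "lin g" "\<forall>x\<in>B. g x = f x"
    using fun_vsp.linear_independent_extend[OF B(2)] by blast
  have "v \<in> V \<and> g v = f v" if "v \<in> fun_vs.span B" for v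
    using that
  proof (induction rule: fun_vs.span_induct_alt)
    case base
    then show ?case
      using g linear_between_zero[OF assms] fun_vsp.linear_0 assms(2) fun_vs.subspace_0 by metis
  next
    case (step c x y)
    have xy: "x \<in> V" "y \<in> V" using step B by auto
    then have "vscale c x \<in> V" using assms(2) fun_vs.subspace_scale by blast
    with xy have "f (vscale c x + y) = vscale c (f x) + f y" "vscale c x + y \<in> V"
      using assms fun_vs.subspace_add unfolding linear_between_def by metis+
    then show ?case using g step unfolding lin_iff by metis
  qed
  then show thesis using that g B by blast
qed

text \<open>An injective linear map has a linear left inverse, and \<open>phi\<close> can be
  composed with it. Through the Yoneda lemma this becomes the injectivity of S^c \<otimes>
  I^b.\<close>

lemma functional_extend:
  fixes phi :: "('l \<Rightarrow> 'k::field) \<Rightarrow> 'k" and i :: "('l \<Rightarrow> 'k) \<Rightarrow> ('m \<Rightarrow> 'k)"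
  assumes i: "linear_between V W i" "inj_on i V" and V: "fun_vs.subspace V"
    and phi: "\<And>x y. x \<in> V \<Longrightarrow> y \<in> V \<Longrightarrow> phi (x + y) = phi x + phi y"
      "\<And>c x. x \<in> V \<Longrightarrow> phi (vscale c x) = c * phi x"
  obtains psi where "linf psi" "\<And>v. v \<in> V \<Longrightarrow> psi (i v) = phi v"
proof -
  obtain i' where i': "lin i'" "\<And>v. v \<in> V \<Longrightarrow> i' v = i v"
    using linear_between_extend[OF i(1) V] by blast
  have "inj_on i' V" using i(2) i'(2) by (simp add: inj_on_def)
  then obtain g where g: "range g \<subseteq> V" "lin g" "\<forall>v\<in>V. g (i' v) = v"
    using fun_vsp.linear_exists_left_inverse_on[OF i'(1) V] by blast
  have "phi (g (x + y)) = phi (g x) + phi (g y)" for x y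
    using g phi unfolding lin_iff by (metis rangeI subsetD)
  moreover have "phi (g (vscale c x)) = c * phi (g x)" for c x
    using g phi unfolding lin_iff by (metis rangeI subsetD)
  ultimately have "linf (\<lambda>v. phi (g v))" unfolding linf_iff by auto
  then show thesis using that[of "\<lambda>v. phi (g v)"] g i' by auto
qed

section \<open>Words and exponents\<close>

lemma finite_words [simp]: "finite (words e n)"
proof -
  have "words e n \<subseteq> {I. set I \<subseteq> {..<n} \<and> length I = e}" by (auto simp: words_def)
  then show ?thesis using finite_lists_length_eq[of "{..<n}" e] finite_subset by auto
qed

lemma length_words: "I \<in> words e n \<Longrightarrow> length I = e"
  by (simp add: words_def)

lemma words_0: "words 0 n = {[]}"
  by (auto simp: words_def)

lemma words_Suc: "words (Suc e) n = (\<lambda>(j, J). j # J) ` ({..<n} \<times> words e n)"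
proof (intro equalityI subsetI)
  fix I assume "I \<in> words (Suc e) n"
  then obtain j J where "I = j # J" "j < n" "J \<in> words e n"
    by (cases I) (auto simp: words_def)
  then show "I \<in> (\<lambda>(j, J). j # J) ` ({..<n} \<times> words e n)" by force
qed (auto simp: words_def)

lemma word_expo_Nil [simp]: "word_expo J [] = 0"
  by (simp add: word_expo_def)

lemma word_expo_Cons [simp]:
  "word_expo (j # J) (i # I) = Poly_Mapping.single (j, i) 1 + word_expo J I"
  unfolding word_expo_def by (simp del: sum.lessThan_Suc add: sum.lessThan_Suc_shift)

lemma word_expo_append:
  "length J = length I \<Longrightarrow> word_expo (J @ J') (I @ I') = word_expo J I + word_expo J' I'"
  by (induction J I rule: list_induct2) (auto simp: ac_simps)

lemma lookup_word_expo:
  "length J = length I \<Longrightarrow> Poly_Mapping.lookup (word_expo J I) u = count (mset (zip J I)) u"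
  by (induction J I rule: list_induct2) (auto simp: lookup_add lookup_single when_def)

lemma word_expo_eq_iff:
  assumes "length J = length I" "length J' = length I'"
  shows "word_expo J I = word_expo J' I' \<longleftrightarrow> mset (zip J I) = mset (zip J' I')"
  using assms by (auto simp: poly_mapping_eq_iff fun_eq_iff lookup_word_expo multiset_eq_iff)

lemma keys_word_expo:
  assumes "length J = length I"
  shows "Poly_Mapping.keys (word_expo J I) = set (zip J I)"
  using assms by (auto simp: in_keys_iff lookup_word_expo count_eq_zero_iff simp flip: set_mset_mset)

lemma word_expo_in_expos:
  assumes "J \<in> words e m" "I \<in> words e n"
  shows "word_expo J I \<in> expos m n e"
proof -
  have l: "length J = length I" using assms by (simp add: words_def)
  have "(\<Sum>u\<in>set (zip J I). count (mset (zip J I)) u) = size (mset (zip J I))"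
    by (simp add: size_multiset_overloaded_eq)
  moreover have "set (zip J I) \<subseteq> {..<m} \<times> {..<n}"
    using assms by (auto simp: words_def dest: set_zip_leftD set_zip_rightD)
  ultimately show ?thesis
    using assms unfolding expos_def by (simp add: length_words keys_word_expo[OF l] lookup_word_expo[OF l])
qed

text \<open>An exponent of degree \<open>e\<close> is a multiset of \<open>e\<close> matrix
  positions; the rows and the columns of any listing of it are the two words.\<close>

lemma expos_obtain:
  assumes "\<alpha> \<in> expos m n e"
  obtains J I where "J \<in> words e m" "I \<in> words e n" "\<alpha> = word_expo J I"
proof -
  define M where "M = (\<Sum>u\<in>Poly_Mapping.keys \<alpha>. replicate_mset (Poly_Mapping.lookup \<alpha> u) u)"
  have c: "count M u = Poly_Mapping.lookup \<alpha> u" for u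
  proof -
    have "count M u = (\<Sum>x\<in>Poly_Mapping.keys \<alpha>. if x = u then Poly_Mapping.lookup \<alpha> x else 0)"
      unfolding M_def count_sum by (intro sum.cong) auto
    then show ?thesis by (simp add: in_keys_iff)
  qed
  have s: "set_mset M = Poly_Mapping.keys \<alpha>"
    by (auto simp: in_keys_iff c simp flip: count_greater_zero_iff)
  obtain xs where xs: "mset xs = M" using ex_mset by blast
  have "length xs = size M" using xs by (metis size_mset)
  also have "\<dots> = e" using assms by (simp add: size_multiset_overloaded_eq s c expos_def)
  finally have len: "length xs = e" .
  have "set xs \<subseteq> {..<m} \<times> {..<n}" using assms xs s unfolding expos_def by (metis (no_types, lifting) mem_Collect_eq set_mset_mset)
  then have "map fst xs \<in> words e m" "map snd xs \<in> words e n" using len by (auto simp: words_def)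
  moreover have "\<alpha> = word_expo (map fst xs) (map snd xs)"
    by (auto simp: poly_mapping_eq_iff fun_eq_iff lookup_word_expo zip_map_fst_snd xs c)
  ultimately show thesis using that by blast
qed

lemma expos_eq: "expos m n e = (\<lambda>(J, I). word_expo J I) ` (words e m \<times> words e n)"
proof (intro equalityI subsetI)
  fix \<alpha> assume "\<alpha> \<in> expos m n e"
  then obtain J I where "J \<in> words e m" "I \<in> words e n" "\<alpha> = word_expo J I" using expos_obtain by blast
  then show "\<alpha> \<in> (\<lambda>(J, I). word_expo J I) ` (words e m \<times> words e n)" by force
qed (auto simp: word_expo_in_expos)

lemma finite_expos [simp]: "finite (expos m n e)"
  unfolding expos_eq by simp

lemma mono_eval_superset:
  assumes "finite S" "Poly_Mapping.keys \<alpha> \<subseteq> S"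
  shows "mono_eval \<alpha> A = (\<Prod>u\<in>S. A u ^ Poly_Mapping.lookup \<alpha> u)"
  unfolding mono_eval_def
  by (rule prod.mono_neutral_left) (use assms in \<open>auto simp: in_keys_iff\<close>)

lemma mono_eval_add: "mono_eval (\<alpha> + \<beta>) A = mono_eval \<alpha> A * mono_eval \<beta> A"
proof -
  let ?S = "Poly_Mapping.keys \<alpha> \<union> Poly_Mapping.keys \<beta>"
  have "mono_eval (\<alpha> + \<beta>) A = (\<Prod>u\<in>?S. A u ^ Poly_Mapping.lookup (\<alpha> + \<beta>) u)"
    by (rule mono_eval_superset) (use Poly_Mapping.keys_add[of \<alpha> \<beta>] in auto)
  also have "\<dots> = (\<Prod>u\<in>?S. A u ^ Poly_Mapping.lookup \<alpha> u) * (\<Prod>u\<in>?S. A u ^ Poly_Mapping.lookup \<beta> u)"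
    by (simp add: lookup_add power_add prod.distrib)
  finally show ?thesis by (simp add: mono_eval_superset[of ?S])
qed

lemma mono_eval_0 [simp]: "mono_eval 0 A = 1"
  by (simp add: mono_eval_def)

lemma mono_eval_single [simp]: "mono_eval (Poly_Mapping.single u (Suc 0)) A = A u"
  by (simp add: mono_eval_def)

lemma mono_eval_id_word:
  assumes "length J = length I"
  shows "mono_eval (word_expo J I) id_matrix = (if J = I then 1 else 0 :: 'k::field)"
  using assms by (induction J I rule: list_induct2) (auto simp: mono_eval_add id_matrix_def)

text \<open>Each letter contributes a sum over one middle index; multiplying out gives one term for
  each word of middle indices.\<close>

lemma generic_product_word:
  assumes "length K = length I"
  shows "mono_eval (word_expo K I) (generic_product m :: _ \<Rightarrow> 'k::field poly2) =
    (\<Sum>J\<in>words (length I) m. Poly_Mapping.single (word_expo K J, word_expo J I) 1)"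
  using assms
proof (induction K I rule: list_induct2)
  case Nil
  then show ?case by (simp add: words_0 flip: zero_prod_def)
next
  case (Cons k K i I)
  have inj: "inj_on (\<lambda>(j, J). j # J) ({..<m} \<times> words (length I) m)" by (auto simp: inj_on_def)
  have "mono_eval (word_expo (k # K) (i # I)) (generic_product m :: _ \<Rightarrow> 'k poly2)
     = (\<Sum>j<m. var_x (k, j) * var_y (j, i)) *
       (\<Sum>J\<in>words (length I) m. Poly_Mapping.single (word_expo K J, word_expo J I) 1)"
    using Cons by (simp add: mono_eval_add generic_product_def)
  also have "\<dots> = (\<Sum>j<m. \<Sum>J\<in>words (length I) m.
        Poly_Mapping.single (word_expo (k # K) (j # J), word_expo (j # J) (i # I)) 1)"
    by (simp add: sum_product var_x_def var_y_def mult_single)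
  also have "\<dots> = (\<Sum>J\<in>words (length (i # I)) m.
        Poly_Mapping.single (word_expo (k # K) J, word_expo J (i # I)) 1)"
    unfolding list.size(4) add_Suc_right add_0_right words_Suc sum.reindex[OF inj] sum.cartesian_product
    by (simp add: case_prod_unfold)
  finally show ?case .
qed

text \<open>These numbers of middle words are the structure constants of the Schur algebra, in the
  form of Schur's product rule.\<close>

lemma lookup_generic_product:
  assumes "length K = length I"
  shows "Poly_Mapping.lookup (mono_eval (word_expo K I) (generic_product m :: _ \<Rightarrow> 'k::field poly2)) (\<alpha>, \<beta>)
    = of_nat (card {J \<in> words (length I) m. word_expo K J = \<alpha> \<and> word_expo J I = \<beta>})"
proof -
  have "Poly_Mapping.lookup (mono_eval (word_expo K I) (generic_product m :: _ \<Rightarrow> 'k poly2)) (\<alpha>, \<beta>)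
     = (\<Sum>J\<in>words (length I) m. if word_expo K J = \<alpha> \<and> word_expo J I = \<beta> then 1 else 0)"
    unfolding generic_product_word[OF assms] lookup_sum
    by (intro sum.cong) (auto simp: lookup_single when_def)
  also have "\<dots> = of_nat (card {J \<in> words (length I) m. word_expo K J = \<alpha> \<and> word_expo J I = \<beta>})"
    by (simp add: sum.If_cases Int_def)
  finally show ?thesis .
qed

section \<open>The functors $S^c \otimes I^{\otimes b}$\<close>

text \<open>
  The basis vector of $S^c \otimes I^{\otimes b}$ with symmetric factor \<open>M\<close> and tensor factor \<open>w\<close> has
  the label \<open>label M w\<close>. It is the image of the word that consists of the letters of \<open>M\<close>, in any
  order, and of \<open>w\<close>.
\<close>

definition label :: "nat multiset \<Rightarrow> nat list \<Rightarrow> nat multiset list" where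
  "label M w = M # map (\<lambda>x. {#x#}) w"

definition wlabel :: "nat \<Rightarrow> nat list \<Rightarrow> nat multiset list" where
  "wlabel c I = label (mset (take c I)) (drop c I)"

text \<open>Sorting the symmetric factor gives the representative from which
  \<open>sym_power\<close> computes its coefficients.\<close>

definition lword :: "nat multiset list \<Rightarrow> nat list" where
  "lword L = concat (map sorted_list_of_multiset L)"

definition labels :: "nat \<Rightarrow> nat \<Rightarrow> nat \<Rightarrow> nat multiset list set" where
  "labels c b n = sym_basis (c # replicate b 1) n"

definition SI :: "nat \<Rightarrow> nat \<Rightarrow> (nat multiset list, 'k::field) spf" where
  "SI c b = sym_power (c # replicate b 1)"

lemma label_inject [simp]: "label M w = label N u \<longleftrightarrow> M = N \<and> w = u"
proof -
  have "inj (map (\<lambda>x::nat. {#x#}))" by (intro inj_mapI) (auto simp: inj_def)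
  then show ?thesis unfolding label_def by (auto dest: injD)
qed

lemma map_size_replicate:
  assumes "map size T = replicate b 1"
  obtains w where "length w = b" "T = map (\<lambda>x. {#x#}) w"
proof
  have "\<exists>x. M = {#x#}" if "M \<in> set T" for M
  proof -
    have "size M \<in> set (map size T)" using that by simp
    then have "size M = 1" unfolding assms by simp
    then show ?thesis using size_1_singleton_mset by blast
  qed
  then have "{#the_elem (set_mset M)#} = M" if "M \<in> set T" for M
    using that by force
  then show "T = map (\<lambda>x. {#x#}) (map (\<lambda>M. the_elem (set_mset M)) T)"
    by (simp add: map_idI comp_def)
  show "length (map (\<lambda>M. the_elem (set_mset M)) T) = b"
    using arg_cong[OF assms, of length] by simp
qed

lemma labels_iff: "L \<in> labels c b n \<longleftrightarrow>
  (\<exists>M w. L = label M w \<and> size M = c \<and> length w = b \<and> set_mset M \<subseteq> {..<n} \<and> set w \<subseteq> {..<n})"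
proof
  assume "L \<in> labels c b n"
  then have L: "map size L = c # replicate b 1" "\<forall>M\<in>set L. set_mset M \<subseteq> {..<n}"
    unfolding labels_def sym_basis_def by auto
  then obtain M T where T: "L = M # T" "size M = c" "map size T = replicate b 1" by (cases L) auto
  then obtain w where w: "length w = b" "T = map (\<lambda>x. {#x#}) w" using map_size_replicate[OF T(3)] by blast
  then show "\<exists>M w. L = label M w \<and> size M = c \<and> length w = b \<and> set_mset M \<subseteq> {..<n} \<and> set w \<subseteq> {..<n}"
  proof (intro exI[of _ M] exI[of _ w] conjI)
    have "\<forall>N\<in>set (M # map (\<lambda>x. {#x#}) w). set_mset N \<subseteq> {..<n}" using L(2) T w by simp
    then show "set_mset M \<subseteq> {..<n}" "set w \<subseteq> {..<n}" by auto
  qed (use T w in \<open>auto simp: label_def\<close>)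
next
  assume "\<exists>M w. L = label M w \<and> size M = c \<and> length w = b \<and> set_mset M \<subseteq> {..<n} \<and> set w \<subseteq> {..<n}"
  then show "L \<in> labels c b n"
    unfolding labels_def sym_basis_def by (fastforce simp: label_def comp_def map_replicate_const)
qed

lemma label_in_labels [simp]:
  "label M w \<in> labels c b n \<longleftrightarrow> size M = c \<and> length w = b \<and> set_mset M \<subseteq> {..<n} \<and> set w \<subseteq> {..<n}"
  by (auto simp: labels_iff)

lemma lword_label: "lword (label M w) = sorted_list_of_multiset M @ w"
  by (induction w) (auto simp: lword_def label_def)

lemma lword_in_words:
  assumes "L \<in> labels c b n"
  shows "lword L \<in> words (c + b) n"
proof -
  obtain M w where "L = label M w" "size M = c" "length w = b" "set_mset M \<subseteq> {..<n}" "set w \<subseteq> {..<n}"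
    using assms labels_iff by auto
  moreover have "length (sorted_list_of_multiset M) = size M" by (metis mset_sorted_list_of_multiset size_mset)
  ultimately show ?thesis by (auto simp: words_def lword_label)
qed

lemma wlabel_append: "length x = c \<Longrightarrow> wlabel c (x @ w) = label (mset x) w"
  by (simp add: wlabel_def)

lemma wlabel_lword:
  assumes "L \<in> labels c b n"
  shows "wlabel c (lword L) = L"
proof -
  obtain M w where "L = label M w" "size M = c" using assms labels_iff by auto
  moreover have "length (sorted_list_of_multiset M) = size M" by (metis mset_sorted_list_of_multiset size_mset)
  ultimately show ?thesis by (simp add: lword_label wlabel_append)
qed

lemma word_split:
  assumes "I \<in> words (c + b) n"
  obtains x w where "I = x @ w" "x \<in> words c n" "w \<in> words b n"
proof
  show "I = take c I @ drop c I" by simp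
  show "take c I \<in> words c n" "drop c I \<in> words b n"
    using assms by (auto simp: words_def dest: in_set_takeD in_set_dropD)
qed

lemma wlabel_in_labels:
  assumes "I \<in> words (c + b) n"
  shows "wlabel c I \<in> labels c b n"
proof -
  obtain x w where "I = x @ w" "x \<in> words c n" "w \<in> words b n" using assms word_split by blast
  then show ?thesis by (auto simp: words_def wlabel_append)
qed

lemma labels_eq: "labels c b n = wlabel c ` words (c + b) n"
  using wlabel_in_labels wlabel_lword lword_in_words by (auto simp: image_iff) metis

lemma finite_labels [simp]: "finite (labels c b n)"
  unfolding labels_eq by simp

lemma obj_SI: "obj (SI c b) n = coord_space (labels c b n)"
  by (simp add: SI_def sym_power_def labels_def)

lemma blocks_replicate_1: "length w = b \<Longrightarrow> blocks (replicate b 1) w = map (\<lambda>x. [x]) w"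
proof (induction w arbitrary: b)
  case (Cons x w)
  then show ?case by (cases b) auto
qed auto

lemma map_mset_blocks:
  assumes "length I = c + b"
  shows "map mset (blocks (c # replicate b 1) I) = wlabel c I"
  using assms blocks_replicate_1[of "drop c I" b] by (simp add: wlabel_def label_def)

lemma sym_epi_unit:
  assumes "I \<in> words (c + b) n"
  shows "sym_epi (c # replicate b 1) n (unit_vec I) = unit_vec (wlabel c I)"
proof -
  have "sum_list (c # replicate b 1) = c + b" by (simp add: sum_list_replicate)
  then show ?thesis unfolding sym_epi_def
    using assms by (simp only: lin_ext_unit finite_words map_mset_blocks length_words)
qed

lemma lin_sum: "lin f \<Longrightarrow> f (\<Sum>i\<in>A. g i) = (\<Sum>i\<in>A. f (g i))"
  by (rule fun_vsp.linear_sum)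

lemma lin_scale: "lin f \<Longrightarrow> f (vscale c v) = vscale c (f v)"
  by (simp add: lin_iff)

lemma tensor_coef_unit:
  "I \<in> words e n \<Longrightarrow> coef (tensor_power e) m n \<alpha> (unit_vec I)
    = (\<Sum>J\<in>{J \<in> words e m. word_expo J I = \<alpha>}. unit_vec J)"
  by (simp add: tensor_power_def lin_ext_unit)

lemma SI_coef_lword:
  assumes "L \<in> labels c b n"
  shows "coef (SI c b) m n \<alpha> (unit_vec L)
    = (\<Sum>J\<in>{J \<in> words (c + b) m. word_expo J (lword L) = \<alpha>}. unit_vec (wlabel c J) :: _ \<Rightarrow> 'k::field)"
proof -
  have s: "sum_list (c # replicate b 1) = c + b" by (simp add: sum_list_replicate)
  have "coef (SI c b) m n \<alpha> (unit_vec L :: _ \<Rightarrow> 'k) = sym_epi (c # replicate b 1) m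
      (coef (tensor_power (c + b)) m n \<alpha> (unit_vec (lword L)))"
    unfolding SI_def sym_power_def spf.simps s
    by (subst lin_ext_unit) (use assms finite_labels in \<open>auto simp: labels_def lword_def\<close>)
  also have "\<dots> = sym_epi (c # replicate b 1) m
      (\<Sum>J\<in>{J \<in> words (c + b) m. word_expo J (lword L) = \<alpha>}. unit_vec J)"
    using lword_in_words[OF assms] by (simp only: tensor_coef_unit)
  also have "\<dots> = (\<Sum>J\<in>{J \<in> words (c + b) m. word_expo J (lword L) = \<alpha>}.
      sym_epi (c # replicate b 1) m (unit_vec J))"
    by (rule lin_sum) (simp add: sym_epi_def lin_lin_ext)
  also have "\<dots> = (\<Sum>J\<in>{J \<in> words (c + b) m. word_expo J (lword L) = \<alpha>}. unit_vec (wlabel c J))"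
    by (intro sum.cong refl sym_epi_unit) simp
  finally show ?thesis .
qed

text \<open>
  Place permutations preserve \<open>word_expo\<close>, so the maps that they induce are natural.
\<close>

definition place_perm :: "nat \<Rightarrow> (nat list \<Rightarrow> nat list) \<Rightarrow> bool" where
  "place_perm e \<rho> \<longleftrightarrow> (\<forall>m. bij_betw \<rho> (words e m) (words e m)) \<and>
     (\<forall>m n. \<forall>J\<in>words e m. \<forall>I\<in>words e n. word_expo (\<rho> J) (\<rho> I) = word_expo J I)"

lemma word_expo_permute:
  assumes "\<sigma> permutes {..<length I}" "length J = length I"
  shows "word_expo (permute_list \<sigma> J) (permute_list \<sigma> I) = word_expo J I"
proof -
  have "zip (permute_list \<sigma> J) (permute_list \<sigma> I) = permute_list \<sigma> (zip J I)"
    using assms by (simp add: permute_list_zip)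
  then show ?thesis using assms by (simp add: word_expo_eq_iff)
qed

lemma permute_list_in_words: "\<sigma> permutes {..<e} \<Longrightarrow> I \<in> words e m \<Longrightarrow> permute_list \<sigma> I \<in> words e m"
  by (auto simp: words_def)

lemma permute_list_inv:
  assumes "\<sigma> permutes {..<e}" "length I = e"
  shows "permute_list (inv \<sigma>) (permute_list \<sigma> I) = I" "permute_list \<sigma> (permute_list (inv \<sigma>) I) = I"
proof -
  note a = assms(1)[folded assms(2)]
  note i = permutes_inv[OF a]
  show "permute_list (inv \<sigma>) (permute_list \<sigma> I) = I"
    using permute_list_compose[OF i, of \<sigma>] permutes_inv_o[OF a] by simp
  show "permute_list \<sigma> (permute_list (inv \<sigma>) I) = I"
    using permute_list_compose[OF a, of "inv \<sigma>"] permutes_inv_o[OF a] by simp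
qed

lemma place_perm_permute_list:
  assumes "\<sigma> permutes {..<e}"
  shows "place_perm e (permute_list \<sigma>)"
  unfolding place_perm_def
proof (intro conjI allI ballI)
  fix m
  show "bij_betw (permute_list \<sigma>) (words e m) (words e m)"
  proof (rule bij_betw_byWitness[where f' = "permute_list (inv \<sigma>)"])
    show "\<forall>a\<in>words e m. permute_list (inv \<sigma>) (permute_list \<sigma> a) = a"
      "\<forall>a\<in>words e m. permute_list \<sigma> (permute_list (inv \<sigma>) a) = a"
      using permute_list_inv[OF assms] by (auto dest: length_words)
    show "permute_list \<sigma> ` words e m \<subseteq> words e m" "permute_list (inv \<sigma>) ` words e m \<subseteq> words e m"
      using permute_list_in_words[OF assms] permute_list_in_words[OF permutes_inv[OF assms]] by auto
  qed
next
  fix m n J I assume "J \<in> words e m" "I \<in> words e n"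
  then show "word_expo (permute_list \<sigma> J) (permute_list \<sigma> I) = word_expo J I"
    using assms by (intro word_expo_permute) (auto simp: length_words)
qed

lemma sum_place_perm:
  assumes "place_perm e \<rho>" "I \<in> words e n"
  shows "(\<Sum>J\<in>{J \<in> words e m. word_expo J (\<rho> I) = \<alpha>}. g J)
    = (\<Sum>J\<in>{J \<in> words e m. word_expo J I = \<alpha>}. g (\<rho> J))"
proof -
  have b: "bij_betw \<rho> (words e m) (words e m)" using assms unfolding place_perm_def by blast
  have e: "word_expo (\<rho> J) (\<rho> I) = word_expo J I" if "J \<in> words e m" for J
    using assms that unfolding place_perm_def by blast
  have "bij_betw \<rho> {J \<in> words e m. word_expo J I = \<alpha>} {J \<in> words e m. word_expo J (\<rho> I) = \<alpha>}"
    unfolding bij_betw_def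
  proof
    show "inj_on \<rho> {J \<in> words e m. word_expo J I = \<alpha>}"
      using b by (auto simp: bij_betw_def inj_on_def)
    show "\<rho> ` {J \<in> words e m. word_expo J I = \<alpha>} = {J \<in> words e m. word_expo J (\<rho> I) = \<alpha>}"
    proof (intro equalityI subsetI)
      fix x assume x: "x \<in> {J \<in> words e m. word_expo J (\<rho> I) = \<alpha>}"
      then obtain y where "y \<in> words e m" "x = \<rho> y" using b unfolding bij_betw_def by blast
      then show "x \<in> \<rho> ` {J \<in> words e m. word_expo J I = \<alpha>}" using x e by auto
    qed (use b e in \<open>auto simp: bij_betw_def\<close>)
  qed
  then show ?thesis by (simp add: sum.reindex_bij_betw)
qed

section \<open>Independence of the representative word\<close>

lemma permute_list_append_left:
  assumes "\<sigma> permutes {..<length x}"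
  shows "permute_list \<sigma> (x @ w) = permute_list \<sigma> x @ w"
proof (rule nth_equalityI)
  fix i assume "i < length (permute_list \<sigma> (x @ w))"
  then have i: "i < length x + length w" by simp
  have p: "\<sigma> permutes {..<length (x @ w)}" by (rule permutes_subset[OF assms]) auto
  show "permute_list \<sigma> (x @ w) ! i = (permute_list \<sigma> x @ w) ! i"
  proof (cases "i < length x")
    case True
    then have "\<sigma> i < length x" using permutes_in_image[OF assms] by auto
    then show ?thesis using True i p assms by (simp add: permute_list_nth nth_append)
  next
    case False
    then have "\<sigma> i = i" using permutes_not_in[OF assms] by auto
    then show ?thesis using False i p assms by (simp add: permute_list_nth nth_append)
  qed
qed simp

text \<open>Two words with the same label differ by a rearrangement of the first \<open>c\<close>
  places. Such a place permutation fixes the last \<open>b\<close> places, so it preserves the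
  labels of all words, not only of these two.\<close>

lemma wlabel_eq_obtain:
  assumes "wlabel c I = wlabel c I'" "I \<in> words (c + b) n" "I' \<in> words (c + b) n'"
  obtains \<sigma> where "\<sigma> permutes {..<c + b}" "I' = permute_list \<sigma> I"
    "\<And>J m. J \<in> words (c + b) m \<Longrightarrow> wlabel c (permute_list \<sigma> J) = wlabel c J"
proof -
  obtain x w where x: "I = x @ w" "x \<in> words c n" "w \<in> words b n" using assms word_split by blast
  obtain x' w' where x': "I' = x' @ w'" "x' \<in> words c n'" "w' \<in> words b n'" using assms word_split by blast
  have m: "mset x' = mset x" "w' = w" using assms(1) x x' by (auto simp: wlabel_append length_words)
  obtain \<sigma> where s: "\<sigma> permutes {..<length x}" "permute_list \<sigma> x = x'"
    using mset_eq_permutation[OF m(1)] by blast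
  have l: "length x = c" using x by (simp add: length_words)
  have p: "\<sigma> permutes {..<c + b}" by (rule permutes_subset[OF s(1)]) (auto simp: l)
  moreover have "I' = permute_list \<sigma> I" using x x' s m by (simp add: permute_list_append_left)
  moreover have "wlabel c (permute_list \<sigma> J) = wlabel c J" if J: "J \<in> words (c + b) m" for J m
  proof -
    obtain y u where y: "J = y @ u" "y \<in> words c m" using J word_split by blast
    then have "length y = c" by (simp add: length_words)
    then show ?thesis using y s(1) l by (simp add: permute_list_append_left wlabel_append)
  qed
  ultimately show thesis using that by blast
qed

text \<open>\<open>sym_power\<close> computes with the sorted representative of a label. By place
  permutations any other word gives the same result, so proofs can work with words
  throughout.\<close>

lemma SI_coef_unit:
  assumes "I \<in> words (c + b) n"
  shows "coef (SI c b) m n \<alpha> (unit_vec (wlabel c I))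
    = (\<Sum>J\<in>{J \<in> words (c + b) m. word_expo J I = \<alpha>}. unit_vec (wlabel c J) :: _ \<Rightarrow> 'k::field)"
proof -
  have L: "wlabel c I \<in> labels c b n" using assms wlabel_in_labels by blast
  obtain \<sigma> where s: "\<sigma> permutes {..<c + b}" "lword (wlabel c I) = permute_list \<sigma> I"
    "\<And>J m. J \<in> words (c + b) m \<Longrightarrow> wlabel c (permute_list \<sigma> J) = wlabel c J"
    using wlabel_eq_obtain[of c I "lword (wlabel c I)" b n n] L wlabel_lword lword_in_words assms by metis
  show ?thesis unfolding SI_coef_lword[OF L] s(2)
      sum_place_perm[OF place_perm_permute_list[OF s(1)] assms]
    by (rule sum.cong) (auto simp: s(3))
qed

lemma lin_SI_coef: "lin (coef (SI c b) m n \<alpha>)"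
  by (simp add: SI_def sym_power_def lin_lin_ext)

lemma lin_eq_on_SI:
  assumes "lin f" "lin g" "\<And>I. I \<in> words (c + b) n \<Longrightarrow> f (unit_vec (wlabel c I)) = g (unit_vec (wlabel c I))"
    and "v \<in> coord_space (labels c b n)"
  shows "f v = g v"
  by (rule lin_eq_on_coord_space[OF assms(1,2) finite_labels _ assms(4)]) (use assms(3) labels_eq in auto)

lemma sum_in_coord_space:
  "(\<And>i. i \<in> X \<Longrightarrow> f i \<in> coord_space A) \<Longrightarrow> (\<Sum>i\<in>X. f i) \<in> coord_space A"
  by (rule fun_vs.subspace_sum[OF subspace_coord_space])

lemma lin_maps_coord_space:
  assumes "lin f" "finite A" "\<And>x. x \<in> A \<Longrightarrow> f (unit_vec x) \<in> coord_space B" "v \<in> coord_space A"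
  shows "f v \<in> coord_space B"
proof -
  have "f v = (\<Sum>x\<in>A. vscale (v x) (f (unit_vec x)))"
    by (subst coord_space_decomp[OF assms(2,4)]) (simp add: lin_sum[OF assms(1)] lin_scale[OF assms(1)])
  then show ?thesis
    using assms(3) by (auto intro!: sum_in_coord_space fun_vs.subspace_scale[OF subspace_coord_space])
qed

lemma SI_coef_in:
  assumes "v \<in> coord_space (labels c b n)"
  shows "coef (SI c b) m n \<alpha> v \<in> coord_space (labels c b m)"
  by (rule lin_maps_coord_space[OF lin_SI_coef finite_labels _ assms])
    (auto simp: SI_coef_lword intro!: sum_in_coord_space wlabel_in_labels)

lemma lin_sum_scale:
  assumes "\<And>i. i \<in> A \<Longrightarrow> lin (f i)"
  shows "lin (\<lambda>v. \<Sum>i\<in>A. vscale (c i) (f i v))"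
proof -
  have "f i (x + y) = f i x + f i y" "f i (vscale a x) = vscale a (f i x)" if "i \<in> A" for i x y a
    using assms[OF that] unfolding lin_iff by auto
  then show ?thesis unfolding lin_iff
    by (simp add: fun_vs.scale_right_distrib sum.distrib fun_vs.scale_sum_right mult.commute)
qed

lemma lin_compose: "lin f \<Longrightarrow> lin g \<Longrightarrow> lin (\<lambda>v. g (f v))"
  unfolding lin_iff by simp

lemma sum_expos_group:
  assumes "I \<in> words e n"
  shows "(\<Sum>\<gamma>\<in>expos l n e. \<Sum>K\<in>{K \<in> words e l. word_expo K I = \<gamma>}. h \<gamma> K)
    = (\<Sum>K\<in>words e l. h (word_expo K I) K)"
proof -
  have "(\<Sum>\<gamma>\<in>expos l n e. \<Sum>K\<in>{K \<in> words e l. word_expo K I = \<gamma>}. h \<gamma> K)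
     = (\<Sum>\<gamma>\<in>expos l n e. \<Sum>K\<in>{K \<in> words e l. word_expo K I = \<gamma>}. h (word_expo K I) K)"
    by (intro sum.cong) auto
  also have "\<dots> = (\<Sum>K\<in>words e l. h (word_expo K I) K)"
    by (rule sum.group) (use assms word_expo_in_expos in auto)
  finally show ?thesis .
qed

lemma sum_vscale_const: "(\<Sum>J\<in>A. v) = vscale (of_nat (card A)) (v :: 'l \<Rightarrow> 'k::field)"
  by (rule ext) (unfold fun_sum_apply vscale_apply, simp)

text \<open>Both functor identities are tested on basis vectors. In the sum for the identity matrix
  only \<open>K = I\<close> survives; in the composition law both sides count, for each word
  \<open>K\<close>, the middle words \<open>J\<close> with the two prescribed exponents.\<close>

lemma strict_poly_functor_SI: "strict_poly_functor (c + b) (SI c b :: (nat multiset list, 'k::field) spf)"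
  unfolding strict_poly_functor_def
proof (intro conjI allI ballI)
  fix n show "fin_dim_subspace (obj (SI c b :: (nat multiset list, 'k) spf) n)"
    by (simp add: obj_SI fin_dim_subspace_coord_space)
next
  fix m n \<alpha>
  show "linear_between (obj (SI c b) n) (obj (SI c b) m) (coef (SI c b) m n \<alpha> :: _ \<Rightarrow> (_ \<Rightarrow> 'k))"
    by (rule linear_betweenI) (auto simp: lin_SI_coef obj_SI SI_coef_in)
next
  fix n and v :: "nat multiset list \<Rightarrow> 'k" assume "v \<in> obj (SI c b) n"
  then have v: "v \<in> coord_space (labels c b n)" by (simp add: obj_SI)
  show "(\<Sum>\<alpha>\<in>expos n n (c + b). vscale (mono_eval \<alpha> id_matrix) (coef (SI c b) n n \<alpha> v)) = v"
  proof (rule lin_eq_on_SI[OF _ _ _ v])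
    show "lin (\<lambda>v. \<Sum>\<alpha>\<in>expos n n (c + b). vscale (mono_eval \<alpha> id_matrix) (coef (SI c b) n n \<alpha> v)
        :: _ \<Rightarrow> 'k)"
      by (rule lin_sum_scale) (rule lin_SI_coef)
    show "lin (\<lambda>v. v :: nat multiset list \<Rightarrow> 'k)" by (simp add: lin_iff)
    fix I assume I: "I \<in> words (c + b) n"
    have "(\<Sum>\<alpha>\<in>expos n n (c + b). vscale (mono_eval \<alpha> id_matrix) (coef (SI c b) n n \<alpha> (unit_vec (wlabel c I))))
      = (\<Sum>\<alpha>\<in>expos n n (c + b). \<Sum>K\<in>{K \<in> words (c + b) n. word_expo K I = \<alpha>}.
          vscale (mono_eval \<alpha> id_matrix) (unit_vec (wlabel c K) :: _ \<Rightarrow> 'k))"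
      by (simp add: SI_coef_unit[OF I] fun_vs.scale_sum_right)
    also have "\<dots> = (\<Sum>K\<in>words (c + b) n. vscale (mono_eval (word_expo K I) id_matrix) (unit_vec (wlabel c K)))"
      by (rule sum_expos_group[OF I])
    also have "\<dots> = (\<Sum>K\<in>words (c + b) n. if K = I then unit_vec (wlabel c K) else 0)"
      by (rule sum.cong) (use I in \<open>auto simp: mono_eval_id_word length_words\<close>)
    also have "\<dots> = unit_vec (wlabel c I)" using I by simp
    finally show "(\<Sum>\<alpha>\<in>expos n n (c + b). vscale (mono_eval \<alpha> id_matrix)
      (coef (SI c b) n n \<alpha> (unit_vec (wlabel c I)))) = (unit_vec (wlabel c I) :: _ \<Rightarrow> 'k)" .
  qed
next
  fix l m n \<alpha> \<beta> and v :: "nat multiset list \<Rightarrow> 'k" assume "v \<in> obj (SI c b) n"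
  then have v: "v \<in> coord_space (labels c b n)" by (simp add: obj_SI)
  let ?c = "\<lambda>\<gamma>. Poly_Mapping.lookup (mono_eval \<gamma> (generic_product m)) (\<alpha>, \<beta>) :: 'k"
  show "coef (SI c b) l m \<alpha> (coef (SI c b) m n \<beta> v)
    = (\<Sum>\<gamma>\<in>expos l n (c + b). vscale (?c \<gamma>) (coef (SI c b) l n \<gamma> v))"
  proof (rule lin_eq_on_SI[OF _ _ _ v])
    show "lin (\<lambda>v. coef (SI c b) l m \<alpha> (coef (SI c b) m n \<beta> v) :: _ \<Rightarrow> 'k)"
      by (rule lin_compose) (rule lin_SI_coef)+
    show "lin (\<lambda>v. \<Sum>\<gamma>\<in>expos l n (c + b). vscale (?c \<gamma>) (coef (SI c b) l n \<gamma> v))"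
      by (rule lin_sum_scale) (rule lin_SI_coef)
    fix I assume I: "I \<in> words (c + b) n"
    let ?u = "\<lambda>K. unit_vec (wlabel c K) :: _ \<Rightarrow> 'k"
    have "coef (SI c b) l m \<alpha> (coef (SI c b) m n \<beta> (?u I))
      = (\<Sum>J\<in>{J \<in> words (c + b) m. word_expo J I = \<beta>}.
          \<Sum>K\<in>{K \<in> words (c + b) l. word_expo K J = \<alpha>}. ?u K)"
      by (simp add: SI_coef_unit[OF I] lin_sum[OF lin_SI_coef] SI_coef_unit)
    also have "\<dots> = (\<Sum>K\<in>words (c + b) l. \<Sum>J\<in>{J \<in> words (c + b) m. word_expo K J = \<alpha> \<and> word_expo J I = \<beta>}. ?u K)"
      by (subst sum.swap_restrict) (auto simp del: sum_constant intro!: sum.cong)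
    also have "\<dots> = (\<Sum>K\<in>words (c + b) l. vscale (?c (word_expo K I)) (?u K))"
    proof (rule sum.cong[OF refl])
      fix K assume K: "K \<in> words (c + b) l"
      have l: "length K = length I" "length I = c + b" using K I by (simp_all add: words_def)
      show "(\<Sum>J\<in>{J \<in> words (c + b) m. word_expo K J = \<alpha> \<and> word_expo J I = \<beta>}. ?u K)
        = vscale (?c (word_expo K I)) (?u K)"
        unfolding sum_vscale_const lookup_generic_product[OF l(1)] l(2) ..
    qed
    also have "\<dots> = (\<Sum>\<gamma>\<in>expos l n (c + b). \<Sum>K\<in>{K \<in> words (c + b) l. word_expo K I = \<gamma>}. vscale (?c \<gamma>) (?u K))"
      by (rule sum_expos_group[OF I, symmetric])
    also have "\<dots> = (\<Sum>\<gamma>\<in>expos l n (c + b). vscale (?c \<gamma>) (coef (SI c b) l n \<gamma> (?u I)))"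
      by (simp add: SI_coef_unit[OF I] fun_vs.scale_sum_right)
    finally show "coef (SI c b) l m \<alpha> (coef (SI c b) m n \<beta> (?u I))
      = (\<Sum>\<gamma>\<in>expos l n (c + b). vscale (?c \<gamma>) (coef (SI c b) l n \<gamma> (?u I)))" .
  qed
qed

text \<open>The natural maps below are, on words, linear combinations of place permutations,
  possibly with the places divided differently between the two factors. Place permutations preserve
  \<open>word_expo\<close>, so they can be pulled through the sum that describes a
  coefficient.\<close>

lemma natural_from_basis:
  fixes L :: "(nat multiset list \<Rightarrow> 'k::field) \<Rightarrow> (nat multiset list \<Rightarrow> 'k)"
  assumes "lin L" "c + b = c' + b'"
    and unit: "\<And>n I. I \<in> words (c + b) n \<Longrightarrow>
      L (unit_vec (wlabel c I)) = (\<Sum>s\<in>X. vscale (a s) (unit_vec (wlabel c' (\<rho> s I))))"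
    and \<rho>: "\<And>s. s \<in> X \<Longrightarrow> place_perm (c + b) (\<rho> s)"
    and v: "v \<in> coord_space (labels c b n)"
  shows "L (coef (SI c b) m n \<alpha> v) = coef (SI c' b') m n \<alpha> (L v)"
proof (rule lin_eq_on_SI[OF _ _ _ v])
  show "lin (\<lambda>v. L (coef (SI c b) m n \<alpha> v))" "lin (\<lambda>v. coef (SI c' b') m n \<alpha> (L v))"
    using assms(1) lin_SI_coef lin_compose by blast+
  fix I assume I: "I \<in> words (c + b) n"
  have \<rho>I: "\<rho> s I \<in> words (c' + b') n" if "s \<in> X" for s
    using \<rho>[OF that] I assms(2) unfolding place_perm_def bij_betw_def by auto
  let ?S = "{J \<in> words (c + b) m. word_expo J I = \<alpha>}"
  have "L (coef (SI c b) m n \<alpha> (unit_vec (wlabel c I)))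
    = (\<Sum>J\<in>?S. \<Sum>s\<in>X. vscale (a s) (unit_vec (wlabel c' (\<rho> s J))))"
    unfolding SI_coef_unit[OF I] lin_sum[OF assms(1)] by (rule sum.cong) (auto intro: unit)
  also have "\<dots> = (\<Sum>s\<in>X. vscale (a s) (\<Sum>J\<in>?S. unit_vec (wlabel c' (\<rho> s J))))"
    by (subst sum.swap) (simp add: fun_vs.scale_sum_right)
  also have "\<dots> = (\<Sum>s\<in>X. vscale (a s) (coef (SI c' b') m n \<alpha> (unit_vec (wlabel c' (\<rho> s I)))))"
  proof (rule sum.cong[OF refl])
    fix s assume s: "s \<in> X"
    show "vscale (a s) (\<Sum>J\<in>?S. unit_vec (wlabel c' (\<rho> s J)))
      = vscale (a s) (coef (SI c' b') m n \<alpha> (unit_vec (wlabel c' (\<rho> s I))))"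
      unfolding SI_coef_unit[OF \<rho>I[OF s]] unfolding assms(2)[symmetric] sum_place_perm[OF \<rho>[OF s] I] ..
  qed
  also have "\<dots> = coef (SI c' b') m n \<alpha> (L (unit_vec (wlabel c I)))"
    by (simp add: unit[OF I] lin_sum[OF lin_SI_coef] lin_scale[OF lin_SI_coef])
  finally show "L (coef (SI c b) m n \<alpha> (unit_vec (wlabel c I)))
    = coef (SI c' b') m n \<alpha> (L (unit_vec (wlabel c I)))" .
qed

section \<open>Morphisms of strict polynomial functors\<close>

lemma strict_subspace: "strict_poly_functor e F \<Longrightarrow> fun_vs.subspace (obj F n)"
  unfolding strict_poly_functor_def using fin_dim_subspace_imp_subspace by blast

lemma strict_linear_between:
  "strict_poly_functor e F \<Longrightarrow> \<alpha> \<in> expos m n e \<Longrightarrow> linear_between (obj F n) (obj F m) (coef F m n \<alpha>)"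
  unfolding strict_poly_functor_def by blast

lemma strict_coef_in:
  "strict_poly_functor e F \<Longrightarrow> \<alpha> \<in> expos m n e \<Longrightarrow> v \<in> obj F n \<Longrightarrow> coef F m n \<alpha> v \<in> obj F m"
  using strict_linear_between unfolding linear_between_def by blast

lemma strict_coef_comp:
  assumes "strict_poly_functor e F" "\<alpha> \<in> expos l m e" "\<beta> \<in> expos m n e" "v \<in> obj F n"
  shows "coef F l m \<alpha> (coef F m n \<beta> v) = (\<Sum>\<gamma>\<in>expos l n e.
    vscale (Poly_Mapping.lookup (mono_eval \<gamma> (generic_product m)) (\<alpha>, \<beta>)) (coef F l n \<gamma> v))"
  using assms unfolding strict_poly_functor_def by blast

lemma HomI:
  assumes "\<And>n. linear_between (obj F n) (obj G n) (f n)" "\<And>n v. v \<notin> obj F n \<Longrightarrow> f n v = 0"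
    "\<And>m n \<alpha> v. \<alpha> \<in> expos m n e \<Longrightarrow> v \<in> obj F n \<Longrightarrow> f m (coef F m n \<alpha> v) = coef G m n \<alpha> (f n v)"
  shows "f \<in> Hom e F G"
  using assms unfolding Hom_def by blast

lemma Hom_linear: "f \<in> Hom e F G \<Longrightarrow> linear_between (obj F n) (obj G n) (f n)"
  unfolding Hom_def by blast

lemma Hom_in: "f \<in> Hom e F G \<Longrightarrow> v \<in> obj F n \<Longrightarrow> f n v \<in> obj G n"
  using Hom_linear unfolding linear_between_def by blast

lemma Hom_outside: "f \<in> Hom e F G \<Longrightarrow> v \<notin> obj F n \<Longrightarrow> f n v = 0"
  unfolding Hom_def by blast

lemma Hom_natural: "f \<in> Hom e F G \<Longrightarrow> \<alpha> \<in> expos m n e \<Longrightarrow> v \<in> obj F n \<Longrightarrow>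
    f m (coef F m n \<alpha> v) = coef G m n \<alpha> (f n v)"
  unfolding Hom_def by blast

lemma Hom_add: "f \<in> Hom e F G \<Longrightarrow> x \<in> obj F n \<Longrightarrow> y \<in> obj F n \<Longrightarrow> f n (x + y) = f n x + f n y"
  using Hom_linear unfolding linear_between_def by blast

lemma Hom_scale: "f \<in> Hom e F G \<Longrightarrow> x \<in> obj F n \<Longrightarrow> f n (vscale c x) = vscale c (f n x)"
  using Hom_linear unfolding linear_between_def by blast

lemma Hom_zero: "strict_poly_functor e F \<Longrightarrow> f \<in> Hom e F G \<Longrightarrow> f n 0 = 0"
  using linear_between_zero Hom_linear strict_subspace by blast

lemma Hom_comp:
  assumes "f \<in> Hom e F G" "g \<in> Hom e G H" "strict_poly_functor e G"
  shows "comp_family g f \<in> Hom e F H"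
proof (rule HomI)
  fix n
  have "linear_between (obj F n) (obj G n) (f n)" "linear_between (obj G n) (obj H n) (g n)"
    using assms Hom_linear by blast+
  then show "linear_between (obj F n) (obj H n) (comp_family g f n)"
    unfolding linear_between_def comp_family_def image_subset_iff by metis
next
  fix n v assume "v \<notin> obj F n"
  then show "comp_family g f n v = 0"
    using Hom_outside[OF assms(1)] Hom_zero[OF assms(3,2)] unfolding comp_family_def by metis
next
  fix m n \<alpha> v assume "\<alpha> \<in> expos m n e" "v \<in> obj F n"
  then show "comp_family g f m (coef F m n \<alpha> v) = coef H m n \<alpha> (comp_family g f n v)"
    using assms Hom_natural Hom_in unfolding comp_family_def by metis
qed

text \<open>Kernels, images and the zero functor all arise in this way; only closure under the
  coefficients has to be checked for them.\<close>

lemma strict_poly_subfunctor: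
  assumes F: "strict_poly_functor e F" and U: "\<And>n. fun_vs.subspace (U n)" "\<And>n. U n \<subseteq> obj F n"
    and cl: "\<And>m n \<alpha> v. \<alpha> \<in> expos m n e \<Longrightarrow> v \<in> U n \<Longrightarrow> coef F m n \<alpha> v \<in> U m"
  shows "strict_poly_functor e \<lparr>obj = U, coef = coef F\<rparr>"
  unfolding strict_poly_functor_def spf.simps
proof (intro conjI allI ballI)
  fix n
  have "fin_dim_subspace (obj F n)" using F unfolding strict_poly_functor_def by blast
  then show "fin_dim_subspace (U n)" using fin_dim_subspace_mono U by blast
next
  fix m n \<alpha> assume a: "\<alpha> \<in> expos m n e"
  show "linear_between (U n) (U m) (coef F m n \<alpha>)"
    using strict_linear_between[OF F a] U(2)[of n] cl[OF a] unfolding linear_between_def by blast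
next
  fix n v assume "v \<in> U n"
  then have "v \<in> obj F n" using U by blast
  then show "(\<Sum>\<alpha>\<in>expos n n e. vscale (mono_eval \<alpha> id_matrix) (coef F n n \<alpha> v)) = v"
    using F unfolding strict_poly_functor_def by blast
next
  fix l m n \<alpha> \<beta> v assume "\<alpha> \<in> expos l m e" "\<beta> \<in> expos m n e" "v \<in> U n"
  then show "coef F l m \<alpha> (coef F m n \<beta> v) = (\<Sum>\<gamma>\<in>expos l n e.
    vscale (Poly_Mapping.lookup (mono_eval \<gamma> (generic_product m)) (\<alpha>, \<beta>)) (coef F l n \<gamma> v))"
    using strict_coef_comp[OF F] U by blast
qed

text \<open>The maps to be used are given by one formula on all functions on labels, the same for
  all \<open>n\<close>. Cutting it off meets the normalization in \<open>Hom\<close>.\<close>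

definition restrict_family :: "('l, 'k::field) spf \<Rightarrow> (('l \<Rightarrow> 'k) \<Rightarrow> ('m \<Rightarrow> 'k)) \<Rightarrow> ('l, 'm, 'k) family" where
  "restrict_family F L = (\<lambda>n v. if v \<in> obj F n then L v else 0)"

lemma restrict_family_in [simp]: "v \<in> obj F n \<Longrightarrow> restrict_family F L n v = L v"
  by (simp add: restrict_family_def)

lemma restrict_family_Hom:
  assumes F: "strict_poly_functor e F" and L: "lin L" "\<And>n v. v \<in> obj F n \<Longrightarrow> L v \<in> obj G n"
    "\<And>m n \<alpha> v. \<alpha> \<in> expos m n e \<Longrightarrow> v \<in> obj F n \<Longrightarrow> L (coef F m n \<alpha> v) = coef G m n \<alpha> (L v)"
  shows "restrict_family F L \<in> Hom e F G"
proof (rule HomI)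
  fix n
  show "linear_between (obj F n) (obj G n) (restrict_family F L n)"
    using L(2) lin_iff[THEN iffD1, OF L(1)] strict_subspace[OF F, of n]
    unfolding linear_between_def restrict_family_def
    by (auto simp: fun_vs.subspace_add fun_vs.subspace_scale)
next
  fix m n \<alpha> v assume a: "\<alpha> \<in> expos m n e" "v \<in> obj F n"
  then have "coef F m n \<alpha> v \<in> obj F m" using strict_coef_in[OF F] by blast
  then show "restrict_family F L m (coef F m n \<alpha> v) = coef G m n \<alpha> (restrict_family F L n v)"
    using a L(3) by simp
qed (simp add: restrict_family_def)

section \<open>A Yoneda lemma\<close>

text \<open>The place permutations that fix this word are exactly those of the first
  \<open>c\<close> places. So S^c \<otimes> I^b is the space of coinvariants of the stabilizer of
  this word in the tensor power, and morphisms into it correspond to functionals on the vectors of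
  this content.\<close>

definition std_word :: "nat \<Rightarrow> nat \<Rightarrow> nat list" where
  "std_word c b = replicate c 0 @ [1..<b + 1]"

lemma std_word_in_words: "std_word c b \<in> words (c + b) (b + 1)"
  by (auto simp: words_def std_word_def)

lemma wlabel_std_word: "wlabel c (std_word c b) = label (replicate_mset c 0) [1..<b + 1]"
  unfolding std_word_def by (subst wlabel_append) auto

lemma wlabel_eq_wlabel_std_word:
  assumes "J \<in> words (c + b) l" "wlabel c J = wlabel c (std_word c b)"
  shows "J = std_word c b"
proof -
  obtain x w where x: "J = x @ w" "length x = c" using assms(1) by (rule word_split) (simp add: words_def)
  then have m: "mset x = replicate_mset c 0" "w = [1..<b + 1]" using assms(2) wlabel_std_word[of c b] by (auto simp: wlabel_append)
  then have "set x \<subseteq> {0}" by (metis in_replicate_mset set_mset_mset singletonI subsetI)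
  then have "x = replicate c 0" using x(2) by (metis replicate_length_same singletonD subsetD)
  then show ?thesis using x m by (simp add: std_word_def)
qed

lemma zip_upt_inject:
  assumes "mset (zip [s..<s + b] w) = mset (zip [s..<s + b] w')" "length w = b" "length w' = b"
  shows "w = w'"
proof (rule nth_equalityI)
  fix i assume i: "i < length w"
  have "(s + i, w ! i) \<in> set (zip [s..<s + b] w)"
    using i assms(2) by (auto simp: in_set_zip intro!: exI[of _ i])
  then have "(s + i, w ! i) \<in> set (zip [s..<s + b] w')" by (metis assms(1) set_mset_mset)
  then show "w ! i = w' ! i" by (auto simp: in_set_zip)
qed (use assms in simp)

text \<open>Against \<open>std_word c b\<close>, the monomial records which letters stand at the
  places of the zeros, without their order, and which single letter stands at the place of each of
  1, ..., b. These are the two parts of the label.\<close>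

lemma word_expo_std_word_iff:
  assumes I: "I \<in> words (c + b) n" and I': "I' \<in> words (c + b) n'"
  shows "word_expo (std_word c b) I = word_expo (std_word c b) I' \<longleftrightarrow> wlabel c I = wlabel c I'"
proof
  assume "wlabel c I = wlabel c I'"
  then obtain \<sigma> where s: "\<sigma> permutes {..<c + b}" "I' = permute_list \<sigma> I"
    "\<And>J m. J \<in> words (c + b) m \<Longrightarrow> wlabel c (permute_list \<sigma> J) = wlabel c J"
    using wlabel_eq_obtain[OF _ I I'] by blast
  have "permute_list \<sigma> (std_word c b) = std_word c b"
    using wlabel_eq_wlabel_std_word permute_list_in_words[OF s(1) std_word_in_words] s(3)[OF std_word_in_words] by blast
  moreover have "word_expo (permute_list \<sigma> (std_word c b)) (permute_list \<sigma> I) = word_expo (std_word c b) I"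
    by (rule word_expo_permute) (use s(1) I std_word_in_words[of c b] in \<open>simp_all add: words_def\<close>)
  ultimately show "word_expo (std_word c b) I = word_expo (std_word c b) I'" using s(2) by simp
next
  assume e: "word_expo (std_word c b) I = word_expo (std_word c b) I'"
  \<comment> \<open>Separating the pairs by whether the first entry is 0 recovers the symmetric and
    the tensor factor.\<close>
  have *: "filter_mset (\<lambda>u. fst u = 0) (mset (zip (std_word c b) (x @ w))) = mset (zip (replicate c 0) x)"
     "filter_mset (\<lambda>u. fst u \<noteq> 0) (mset (zip (std_word c b) (x @ w))) = mset (zip [1..<b + 1] w)"
    if "length x = c" "length w = b" for x w :: "nat list"
  proof -
    have z: "mset (zip (std_word c b) (x @ w)) = mset (zip (replicate c 0) x) + mset (zip [1..<b + 1] w)"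
      using that by (simp add: std_word_def)
    have 1: "fst u = 0" if "u \<in># mset (zip (replicate c 0) x)" for u
      using that by (cases u) (auto dest: set_zip_leftD)
    have 2: "fst u \<noteq> 0" if "u \<in># mset (zip [1..<b + 1] w)" for u
    proof -
      have "fst u \<in> set [1..<b + 1]" using that by (cases u) (auto dest: set_zip_leftD simp del: upt_Suc)
      then show ?thesis by auto
    qed
    show "filter_mset (\<lambda>u. fst u = 0) (mset (zip (std_word c b) (x @ w))) = mset (zip (replicate c 0) x)"
      "filter_mset (\<lambda>u. fst u \<noteq> 0) (mset (zip (std_word c b) (x @ w))) = mset (zip [1..<b + 1] w)"
      unfolding z filter_union_mset
      by (rule multiset_eqI; use 1 2 in \<open>fastforce simp: not_in_iff[symmetric] simp del: upt_Suc\<close>)+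
  qed
  obtain x w where x: "I = x @ w" "length x = c" "length w = b" using I by (rule word_split) (simp add: words_def)
  obtain x' w' where x': "I' = x' @ w'" "length x' = c" "length w' = b" using I' by (rule word_split) (simp add: words_def)
  have m: "mset (zip (std_word c b) (x @ w)) = mset (zip (std_word c b) (x' @ w'))"
    using e word_expo_eq_iff[of "std_word c b" I "std_word c b" I'] x x' by (simp add: std_word_def)
  have "mset (zip (replicate c 0) x) = mset (zip (replicate c (0::nat)) x')"
    using m *(1)[OF x(2,3)] *(1)[OF x'(2,3)] by simp
  then have "mset (map snd (zip (replicate c (0::nat)) x)) = mset (map snd (zip (replicate c (0::nat)) x'))"
    unfolding mset_map by simp
  then have "mset x = mset x'" using x x' by simp
  moreover have "mset (zip [1..<1 + b] w) = mset (zip [1..<1 + b] w')"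
    using m *(2)[OF x(2,3)] *(2)[OF x'(2,3)] by simp
  then have "w = w'" using zip_upt_inject x x' by blast
  ultimately show "wlabel c I = wlabel c I'" using x x' by (simp add: wlabel_append)
qed

lemma SI_coef_apply:
  "coef (SI c b) m n \<alpha> v L = (\<Sum>Ms\<in>labels c b n. v Ms *
     of_nat (card {J \<in> words (c + b) m. word_expo J (lword Ms) = \<alpha> \<and> wlabel c J = L}) :: 'k::field)"
proof -
  have "coef (SI c b) m n \<alpha> v = (\<Sum>Ms\<in>labels c b n. vscale (v Ms) (coef (SI c b) m n \<alpha> (unit_vec Ms)))"
    unfolding SI_def sym_power_def spf.simps labels_def[symmetric]
    by (subst lin_ext_def) (rule sum.cong[OF refl], subst lin_ext_unit, auto)
  then have "coef (SI c b) m n \<alpha> v L = (\<Sum>Ms\<in>labels c b n. v Ms * coef (SI c b) m n \<alpha> (unit_vec Ms) L)"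
    by (simp add: fun_sum_apply vscale_apply)
  also have "\<dots> = (\<Sum>Ms\<in>labels c b n. v Ms *
     of_nat (card {J \<in> words (c + b) m. word_expo J (lword Ms) = \<alpha> \<and> wlabel c J = L}))"
  proof (rule sum.cong[OF refl])
    fix Ms assume Ms: "Ms \<in> labels c b n"
    have "(\<Sum>J\<in>{J \<in> words (c + b) m. word_expo J (lword Ms) = \<alpha>}. unit_vec (wlabel c J) L)
      = (\<Sum>J\<in>{J \<in> words (c + b) m. word_expo J (lword Ms) = \<alpha>}. if wlabel c J = L then 1 else 0 :: 'k)"
      by (rule sum.cong) (auto simp: unit_vec_apply)
    also have "\<dots> = of_nat (card ({J \<in> words (c + b) m. word_expo J (lword Ms) = \<alpha>} \<inter> {J. wlabel c J = L}))"
      by (simp add: sum.If_cases)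
    also have "{J \<in> words (c + b) m. word_expo J (lword Ms) = \<alpha>} \<inter> {J. wlabel c J = L}
      = {J \<in> words (c + b) m. word_expo J (lword Ms) = \<alpha> \<and> wlabel c J = L}" by blast
    finally show "v Ms * coef (SI c b) m n \<alpha> (unit_vec Ms) L = v Ms *
      of_nat (card {J \<in> words (c + b) m. word_expo J (lword Ms) = \<alpha> \<and> wlabel c J = L})"
      unfolding SI_coef_lword[OF Ms] fun_sum_apply by simp
  qed
  finally show ?thesis .
qed

text \<open>In the matrix of this coefficient, the row of \<open>wlabel c (std_word c b)\<close> has
  a single entry 1, in the column of \<open>wlabel c I\<close>. So any coordinate can be moved to
  the one fixed label.\<close>

lemma SI_coef_std_word:
  assumes I: "I \<in> words (c + b) n"
  shows "coef (SI c b) (b + 1) n (word_expo (std_word c b) I) v (wlabel c (std_word c b)) = v (wlabel c I)"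
proof -
  have L: "wlabel c I \<in> labels c b n" using wlabel_in_labels[OF I] .
  have "card {J \<in> words (c + b) (b + 1). word_expo J (lword Ms) = word_expo (std_word c b) I \<and> wlabel c J = wlabel c (std_word c b)}
     = (if Ms = wlabel c I then 1 else 0)" if Ms: "Ms \<in> labels c b n" for Ms
  proof -
    have "word_expo (std_word c b) (lword Ms) = word_expo (std_word c b) I \<longleftrightarrow> Ms = wlabel c I"
      using word_expo_std_word_iff[OF lword_in_words[OF Ms] I] wlabel_lword[OF Ms] by simp
    then have "{J \<in> words (c + b) (b + 1). word_expo J (lword Ms) = word_expo (std_word c b) I \<and> wlabel c J = wlabel c (std_word c b)}
      = (if Ms = wlabel c I then {std_word c b} else {})"
      using wlabel_eq_wlabel_std_word[of _ c b "b + 1"] std_word_in_words[of c b] by auto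
    then show ?thesis by simp
  qed
  then have "coef (SI c b) (b + 1) n (word_expo (std_word c b) I) v (wlabel c (std_word c b))
    = (\<Sum>Ms\<in>labels c b n. if Ms = wlabel c I then v Ms else 0)"
    unfolding SI_coef_apply by (intro sum.cong) auto
  then show ?thesis using L by simp
qed

text \<open>Naturality moves the coordinate at \<open>L\<close> to the fixed label, so the morphism
  is known from a single functional on \<open>obj F (b + 1)\<close>. Asking only for the
  coefficients of \<open>SI c b\<close> covers its subfunctors as targets.\<close>

lemma yoneda_determined:
  assumes f: "f \<in> Hom (c + b) F G" "coef G = coef (SI c b)" and v: "v \<in> obj F n" "L \<in> labels c b n"
  shows "f n v L = f (b + 1) (coef F (b + 1) n (word_expo (std_word c b) (lword L)) v) (wlabel c (std_word c b))"
proof -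
  have w: "lword L \<in> words (c + b) n" using lword_in_words v by blast
  have "f (b + 1) (coef F (b + 1) n (word_expo (std_word c b) (lword L)) v)
     = coef (SI c b) (b + 1) n (word_expo (std_word c b) (lword L)) (f n v)"
    using Hom_natural[OF f(1) word_expo_in_expos[OF std_word_in_words w] v(1)] f(2) by simp
  moreover have "coef (SI c b) (b + 1) n (word_expo (std_word c b) (lword L)) (f n v) (wlabel c (std_word c b)) = f n v (wlabel c (lword L))"
    by (rule SI_coef_std_word[OF w])
  ultimately show ?thesis using wlabel_lword[OF v(2)] by simp
qed

lemma linf_sum_scale: "linf psi \<Longrightarrow> psi (\<Sum>i\<in>A. vscale (a i) (x i)) = (\<Sum>i\<in>A. a i * psi (x i))"
  by (simp add: fun_vsf.linear_sum fun_vsf.linear_scale)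

text \<open>The formula of \<open>yoneda_determined\<close>, read as a definition: the functional
  \<open>psi\<close> produces all coordinates.\<close>

definition yoneda_map ::
  "nat \<Rightarrow> nat \<Rightarrow> ('l, 'k::field) spf \<Rightarrow> (('l \<Rightarrow> 'k) \<Rightarrow> 'k) \<Rightarrow> ('l, nat multiset list, 'k) family" where
  "yoneda_map c b G psi = (\<lambda>n v. if v \<in> obj G n then
     (\<lambda>L. if L \<in> labels c b n then psi (coef G (b + 1) n (word_expo (std_word c b) (lword L)) v) else 0) else 0)"

lemma yoneda_map_Hom:
  fixes G :: "('l, 'k::field) spf"
  assumes G: "strict_poly_functor (c + b) G" and psi: "linf psi"
  shows "yoneda_map c b G psi \<in> Hom (c + b) G (SI c b)"
proof (rule HomI)
  fix n
  have e: "word_expo (std_word c b) (lword L) \<in> expos (b + 1) n (c + b)" if "L \<in> labels c b n" for L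
    using that lword_in_words std_word_in_words word_expo_in_expos by blast
  define P where "P L v = psi (coef G (b + 1) n (word_expo (std_word c b) (lword L)) v)" for L v
  have "P L (x + y) = P L x + P L y" if "L \<in> labels c b n" "x \<in> obj G n" "y \<in> obj G n" for L x y
    using strict_linear_between[OF G e[OF that(1)]] that psi
    unfolding linear_between_def P_def linf_iff by metis
  moreover have "P L (vscale a x) = a * P L x" if "L \<in> labels c b n" "x \<in> obj G n" for L x a
    using strict_linear_between[OF G e[OF that(1)]] that psi
    unfolding linear_between_def P_def linf_iff by metis
  ultimately show "linear_between (obj G n) (obj (SI c b) n) (yoneda_map c b G psi n)"
    using strict_subspace[OF G, of n] unfolding linear_between_def yoneda_map_def P_def[symmetric]
    by (auto simp: obj_SI coord_space_def fun_vs.subspace_add fun_vs.subspace_scale vscale_apply)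
next
  fix n v assume "v \<notin> obj G n"
  then show "yoneda_map c b G psi n v = 0" by (simp add: yoneda_map_def)
next
  fix m n \<alpha> v assume a: "\<alpha> \<in> expos m n (c + b)" and v: "v \<in> obj G n"
  let ?g = "yoneda_map c b G psi"
  let ?k = "\<lambda>L. word_expo (std_word c b) (lword L)"
  have av: "coef G m n \<alpha> v \<in> obj G m" using strict_coef_in[OF G a v] .
  show "?g m (coef G m n \<alpha> v) = coef (SI c b) m n \<alpha> (?g n v)"
  proof
    fix L
    show "?g m (coef G m n \<alpha> v) L = coef (SI c b) m n \<alpha> (?g n v) L"
    proof (cases "L \<in> labels c b m")
      case False
      have "?g n v \<in> coord_space (labels c b n)"
        using v by (auto simp: yoneda_map_def coord_space_def)
      then have "coef (SI c b) m n \<alpha> (?g n v) \<in> coord_space (labels c b m)" by (rule SI_coef_in)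
      then show ?thesis using False av by (auto simp: yoneda_map_def coord_space_def)
    next
      case True
      let ?N = "\<lambda>\<gamma>. Poly_Mapping.lookup (mono_eval \<gamma> (generic_product m)) (?k L, \<alpha>) :: 'k"
      have wL: "lword L \<in> words (c + b) m" using lword_in_words[OF True] .
      have kL: "?k L \<in> expos (b + 1) m (c + b)" using word_expo_in_expos[OF std_word_in_words wL] .
      have "?g m (coef G m n \<alpha> v) L = psi (coef G (b + 1) m (?k L) (coef G m n \<alpha> v))"
        using av True by (simp add: yoneda_map_def)
      also have "\<dots> = (\<Sum>\<gamma>\<in>expos (b + 1) n (c + b). ?N \<gamma> * psi (coef G (b + 1) n \<gamma> v))"
        unfolding strict_coef_comp[OF G kL a v] by (rule linf_sum_scale[OF psi])
      \<comment> \<open>If the structure constant of \<open>\<gamma> = word_expo K I\<close> is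
        nonzero, then some middle word shows that \<open>K\<close> is a rearrangement of
        \<open>std_word c b\<close>, and a common place permutation of \<open>K\<close> and
        \<open>I\<close> exhibits \<open>\<gamma>\<close> as some \<open>?k Ms\<close>.\<close>
      also have "\<dots> = (\<Sum>\<gamma>\<in>?k ` labels c b n. ?N \<gamma> * psi (coef G (b + 1) n \<gamma> v))"
      proof (rule sum.mono_neutral_right)
        show "?k ` labels c b n \<subseteq> expos (b + 1) n (c + b)"
          using word_expo_in_expos[OF std_word_in_words lword_in_words] by blast
        show "\<forall>\<gamma>\<in>expos (b + 1) n (c + b) - ?k ` labels c b n. ?N \<gamma> * psi (coef G (b + 1) n \<gamma> v) = 0"
        proof
          fix \<gamma> assume g: "\<gamma> \<in> expos (b + 1) n (c + b) - ?k ` labels c b n"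
          then obtain K I where K: "K \<in> words (c + b) (b + 1)" "I \<in> words (c + b) n" "\<gamma> = word_expo K I"
            using expos_obtain by blast
          have l: "length K = length I" "length I = c + b" using K by (simp_all add: words_def)
          have "{J \<in> words (c + b) m. word_expo K J = ?k L \<and> word_expo J I = \<alpha>} = {}"
          proof (rule ccontr)
            assume "\<not> ?thesis"
            then obtain J where J: "J \<in> words (c + b) m" "word_expo K J = ?k L" by blast
            have lJ: "length J = c + b" "length (lword L) = c + b" "length (std_word c b) = c + b"
              using J wL std_word_in_words[of c b] by (simp_all add: words_def)
            have "mset (zip K J) = mset (zip (std_word c b) (lword L))"
              using J(2) l lJ by (subst (asm) word_expo_eq_iff) auto
            then have "mset (map fst (zip K J)) = mset (map fst (zip (std_word c b) (lword L)))"
              unfolding mset_map by simp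
            then have "mset (std_word c b) = mset K" using l lJ by simp
            then obtain \<sigma> where s: "\<sigma> permutes {..<length K}" "permute_list \<sigma> K = std_word c b"
              using mset_eq_permutation by blast
            define I' where "I' = permute_list \<sigma> I"
            have I': "I' \<in> words (c + b) n" unfolding I'_def using s l K permute_list_in_words by simp
            have "\<gamma> = word_expo (std_word c b) I'"
              unfolding K(3) I'_def s(2)[symmetric] using word_expo_permute[of \<sigma> I K] s(1) l by simp
            also have "\<dots> = ?k (wlabel c I')"
              using word_expo_std_word_iff[OF I' lword_in_words[OF wlabel_in_labels[OF I']]] wlabel_lword[OF wlabel_in_labels[OF I']] by simp
            finally show False using g wlabel_in_labels[OF I'] by blast
          qed
          then have "?N \<gamma> = 0" unfolding K(3) lookup_generic_product[OF l(1)] l(2) by (simp only: card.empty of_nat_0)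
          then show "?N \<gamma> * psi (coef G (b + 1) n \<gamma> v) = 0" by simp
        qed
      qed simp
      also have "\<dots> = (\<Sum>Ms\<in>labels c b n. ?N (?k Ms) * psi (coef G (b + 1) n (?k Ms) v))"
      proof (rule sum.reindex[unfolded comp_def])
        show "inj_on ?k (labels c b n)"
          by (rule inj_onI) (metis word_expo_std_word_iff lword_in_words wlabel_lword)
      qed
      also have "\<dots> = (\<Sum>Ms\<in>labels c b n. ?g n v Ms *
          of_nat (card {J \<in> words (c + b) m. word_expo J (lword Ms) = \<alpha> \<and> wlabel c J = L}))"
      proof (rule sum.cong[OF refl])
        fix Ms assume Ms: "Ms \<in> labels c b n"
        have l: "length (std_word c b) = length (lword Ms)" "length (lword Ms) = c + b"
          using lword_in_words[OF Ms] std_word_in_words[of c b] by (simp_all add: words_def)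
        \<comment> \<open>This turns the words counted by the structure constant into those counted
          by the matrix entries of \<open>SI c b\<close>.\<close>
        have "word_expo (std_word c b) J = ?k L \<longleftrightarrow> wlabel c J = L" if "J \<in> words (c + b) m" for J
          using word_expo_std_word_iff[OF that wL] wlabel_lword[OF True] by simp
        then have "{J \<in> words (c + b) m. word_expo (std_word c b) J = ?k L \<and> word_expo J (lword Ms) = \<alpha>}
          = {J \<in> words (c + b) m. word_expo J (lword Ms) = \<alpha> \<and> wlabel c J = L}" by blast
        then have "?N (?k Ms) = of_nat (card {J \<in> words (c + b) m. word_expo J (lword Ms) = \<alpha> \<and> wlabel c J = L})"
          unfolding lookup_generic_product[OF l(1)] l(2) by simp
        then show "?N (?k Ms) * psi (coef G (b + 1) n (?k Ms) v) = ?g n v Ms *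
          of_nat (card {J \<in> words (c + b) m. word_expo J (lword Ms) = \<alpha> \<and> wlabel c J = L})"
          using v Ms by (simp add: yoneda_map_def mult.commute)
      qed
      also have "\<dots> = coef (SI c b) m n \<alpha> (?g n v) L" unfolding SI_coef_apply ..
      finally show ?thesis .
    qed
  qed
qed

text \<open>As morphisms into \<open>SI c b\<close> are functionals, extending \<open>f\<close>
  along \<open>i\<close> only requires extending one functional along the component at
  \<open>b + 1\<close>. The retraction then carries the extension from \<open>SI c b\<close> into
  the summand \<open>J\<close>.\<close>

lemma injective_retract:
  fixes J :: "(nat multiset list, 'k::field) spf"
  assumes J: "strict_poly_functor (c + b) J" "\<And>n. obj J n \<subseteq> obj (SI c b) n" "coef J = coef (SI c b)"
    and R: "R \<in> Hom (c + b) (SI c b) J" "\<And>n v. v \<in> obj J n \<Longrightarrow> R n v = v"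
  shows "injective_spf (c + b) J"
  unfolding injective_spf_def
proof (intro conjI allI impI J(1))
  fix F G :: "(nat multiset list, 'k) spf" and i f
  assume "strict_poly_functor (c + b) F \<and> strict_poly_functor (c + b) G \<and>
       i \<in> Hom (c + b) F G \<and> monic F i \<and> f \<in> Hom (c + b) F J"
  then have F: "strict_poly_functor (c + b) F" and G: "strict_poly_functor (c + b) G"
    and i: "i \<in> Hom (c + b) F G" "monic F i" and f: "f \<in> Hom (c + b) F J" by auto
  let ?phi = "\<lambda>v. f (b + 1) v (wlabel c (std_word c b))"
  obtain psi where psi: "linf psi" "\<And>v. v \<in> obj F (b + 1) \<Longrightarrow> psi (i (b + 1) v) = ?phi v"
  proof (rule functional_extend[of "obj F (b + 1)" "obj G (b + 1)" "i (b + 1)" ?phi])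
    show "linear_between (obj F (b + 1)) (obj G (b + 1)) (i (b + 1))" using Hom_linear[OF i(1)] .
    show "inj_on (i (b + 1)) (obj F (b + 1))" using i(2) unfolding monic_def by blast
    show "fun_vs.subspace (obj F (b + 1))" using strict_subspace[OF F] .
  qed (auto simp: Hom_add[OF f] Hom_scale[OF f] vscale_apply)
  let ?g = "yoneda_map c b G psi"
  have g: "?g \<in> Hom (c + b) G (SI c b)" using yoneda_map_Hom[OF G psi(1)] .
  have W: "strict_poly_functor (c + b) (SI c b :: (nat multiset list, 'k) spf)"
    using strict_poly_functor_SI .
  have "comp_family (comp_family R ?g) i = f"
  proof (intro ext)
    fix n v L
    show "comp_family (comp_family R ?g) i n v L = f n v L"
    proof (cases "v \<in> obj F n")
      case False
      then show ?thesis
        using Hom_outside[OF i(1)] Hom_outside[OF f] Hom_zero[OF G g] Hom_zero[OF W R(1)]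
        by (simp add: comp_family_def)
    next
      case True
      have iv: "i n v \<in> obj G n" using Hom_in[OF i(1) True] .
      have fv: "f n v \<in> obj J n" using Hom_in[OF f True] .
      have "?g n (i n v) = f n v"
      proof
        fix L
        show "?g n (i n v) L = f n v L"
        proof (cases "L \<in> labels c b n")
          case False
          then show ?thesis using fv J(2)[of n] iv by (auto simp: obj_SI coord_space_def yoneda_map_def)
        next
          case L: True
          let ?k = "word_expo (std_word c b) (lword L)"
          have k: "?k \<in> expos (b + 1) n (c + b)"
            using word_expo_in_expos[OF std_word_in_words lword_in_words[OF L]] .
          have "?g n (i n v) L = psi (coef G (b + 1) n ?k (i n v))"
            using iv L by (simp add: yoneda_map_def)
          also have "\<dots> = psi (i (b + 1) (coef F (b + 1) n ?k v))"
            using Hom_natural[OF i(1) k True] by simp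
          also have "\<dots> = ?phi (coef F (b + 1) n ?k v)"
            using psi(2) strict_coef_in[OF F k True] by blast
          also have "\<dots> = f n v L" using yoneda_determined[OF f J(3) True L] by simp
          finally show ?thesis .
        qed
      qed
      then show ?thesis using R(2)[OF fv] by (simp add: comp_family_def)
    qed
  qed
  moreover have "comp_family R ?g \<in> Hom (c + b) G J" using Hom_comp[OF g R(1) W] .
  ultimately show "\<exists>g\<in>Hom (c + b) G J. comp_family g i = f" by blast
qed

section \<open>Natural transformations between the functors $S^c \otimes I^{\otimes b}$\<close>

text \<open>
  The maps below are the Koszul differential $S^c \otimes I^{\otimes b+1} \to S^{c+1} \otimes
  I^{\otimes b}$, which multiplies the first tensor factor into the symmetric power; the
  antisymmetrization of the tensor factors, without division by \<open>b!\<close>; and the comultiplication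
  $S^{c+1} \otimes I^{\otimes b} \to S^c \otimes I^{\otimes b+1}$.
\<close>

definition koszul :: "(nat multiset list \<Rightarrow> 'k::field) \<Rightarrow> (nat multiset list \<Rightarrow> 'k)" where
  "koszul v = (\<lambda>L. case L of [] \<Rightarrow> 0 | N # T \<Rightarrow> \<Sum>i\<in>set_mset N. v ((N - {#i#}) # {#i#} # T))"

definition altern :: "nat \<Rightarrow> (nat multiset list \<Rightarrow> 'k::field) \<Rightarrow> (nat multiset list \<Rightarrow> 'k)" where
  "altern b v = (\<lambda>L. case L of [] \<Rightarrow> 0 | N # T \<Rightarrow>
     \<Sum>\<sigma>\<in>{\<sigma>. \<sigma> permutes {..<b}}. of_int (sign \<sigma>) * v (N # permute_list \<sigma> T))"

definition comult :: "(nat multiset list \<Rightarrow> 'k::field) \<Rightarrow> (nat multiset list \<Rightarrow> 'k)" where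
  "comult v = (\<lambda>L. case L of N # S # T \<Rightarrow> if size S = 1
     then \<Sum>i\<in>set_mset S. of_nat (count (N + S) i) * v ((N + S) # T) else 0 | _ \<Rightarrow> 0)"

lemma koszul_label: "koszul v (label N w) = (\<Sum>i\<in>set_mset N. v (label (N - {#i#}) (i # w)))"
  by (simp add: koszul_def label_def)

text \<open>The factor is that of a partial derivative: in \<open>add_mset i N\<close>, the letter
  \<open>i\<close> has the exponent \<open>count N i + 1\<close>.\<close>

lemma comult_label: "comult v (label N (i # w)) = of_nat (Suc (count N i)) * v (label (add_mset i N) w)"
  by (simp add: comult_def label_def)

lemma altern_label:
  assumes "length w = b"
  shows "altern b v (label N w) =
    (\<Sum>\<sigma>\<in>{\<sigma>. \<sigma> permutes {..<b}}. of_int (sign \<sigma>) * v (label N (permute_list \<sigma> w)))"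
  unfolding altern_def label_def using assms
  by (auto intro!: sum.cong simp: permute_list_map)

lemma lin_koszul: "lin koszul"
  unfolding lin_iff koszul_def
  by (auto simp: fun_eq_iff sum.distrib sum_distrib_left vscale_apply split: list.split)

lemma lin_altern: "lin (altern b)"
  unfolding lin_iff altern_def
  by (auto simp: fun_eq_iff sum.distrib sum_distrib_left vscale_apply distrib_left mult.left_commute split: list.split)

lemma lin_comult: "lin comult"
  unfolding lin_iff comult_def
  by (auto simp: fun_eq_iff sum.distrib sum_distrib_left vscale_apply distrib_left mult.left_commute split: list.split)

section \<open>Values of the three maps on basis vectors\<close>

lemma koszul_unit: "koszul (unit_vec (label M (i # w))) = unit_vec (label (add_mset i M) w)"
proof
  fix L
  show "koszul (unit_vec (label M (i # w))) L = (unit_vec (label (add_mset i M) w) L :: 'k::field)"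
  proof (cases L)
    case Nil
    then show ?thesis by (simp add: koszul_def unit_vec_apply label_def)
  next
    case (Cons N T)
    define X :: 'k where "X = (if N - {#i#} = M \<and> T = map (\<lambda>x. {#x#}) w then 1 else 0)"
    have "koszul (unit_vec (label M (i # w))) L = (\<Sum>j\<in>set_mset N. if j = i then X else 0)"
      unfolding Cons koszul_def list.case
      by (rule sum.cong[OF refl]) (auto simp: unit_vec_apply label_def X_def)
    also have "\<dots> = (if i \<in># N then X else 0)" by simp
    also have "\<dots> = unit_vec (label (add_mset i M) w) L"
      unfolding Cons X_def by (auto simp: unit_vec_apply label_def)
    finally show ?thesis .
  qed
qed

lemma koszul_unit_wlabel:
  assumes "I \<in> words (c + Suc b) n"
  shows "koszul (unit_vec (wlabel c I)) = unit_vec (wlabel (Suc c) I)"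
proof -
  have l: "length I = c + Suc b" using assms by (simp add: words_def)
  then have "drop c I = I ! c # drop (Suc c) I" by (simp add: Cons_nth_drop_Suc)
  moreover have "mset (take (Suc c) I) = add_mset (I ! c) (mset (take c I))"
    using l by (simp add: take_Suc_conv_app_nth)
  ultimately show ?thesis unfolding wlabel_def by (simp add: koszul_unit)
qed

lemma altern_unit:
  assumes b: "length w = b"
  shows "altern b (unit_vec (label M w)) = (\<Sum>\<sigma>\<in>{\<sigma>. \<sigma> permutes {..<b}}.
    vscale (of_int (sign \<sigma>)) (unit_vec (label M (permute_list \<sigma> w))) :: _ \<Rightarrow> 'k::field)"
proof
  fix L
  show "altern b (unit_vec (label M w)) L = (\<Sum>\<sigma>\<in>{\<sigma>. \<sigma> permutes {..<b}}.
    vscale (of_int (sign \<sigma>)) (unit_vec (label M (permute_list \<sigma> w)) :: _ \<Rightarrow> 'k)) L"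
  proof (cases L)
    case Nil
    then show ?thesis by (simp add: altern_def fun_sum_apply vscale_apply unit_vec_apply label_def)
  next
    case (Cons N T)
    \<comment> \<open>Permuting the argument of a coordinate function moves its support by the
      inverse permutation. Passing to inverses does not affect the sum, since it preserves
      signs.\<close>
    have eq: "N # permute_list \<sigma> T = label M w \<longleftrightarrow> L = label M (permute_list (inv \<sigma>) w)"
      if s: "\<sigma> permutes {..<b}" for \<sigma>
    proof
      assume a: "N # permute_list \<sigma> T = label M w"
      then have T: "permute_list \<sigma> T = map (\<lambda>x. {#x#}) w" "N = M" by (auto simp: label_def)
      then have "length T = b" using b by (metis length_permute_list length_map)
      then have "T = permute_list (inv \<sigma>) (map (\<lambda>x. {#x#}) w)"
        using permute_list_inv(1)[OF s] T(1) by metis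
      then show "L = label M (permute_list (inv \<sigma>) w)"
        using Cons T(2) permutes_inv[OF s] b by (simp add: label_def permute_list_map)
    next
      assume "L = label M (permute_list (inv \<sigma>) w)"
      then have "N = M" "T = map (\<lambda>x. {#x#}) (permute_list (inv \<sigma>) w)" using Cons by (auto simp: label_def)
      then show "N # permute_list \<sigma> T = label M w"
        using permute_list_inv(2)[OF s b] b s by (simp add: label_def permute_list_map)
    qed
    have "(\<Sum>\<sigma>\<in>{\<sigma>. \<sigma> permutes {..<b}}.
        vscale (of_int (sign \<sigma>)) (unit_vec (label M (permute_list \<sigma> w)))) L
      = (\<Sum>\<sigma>\<in>{\<sigma>. \<sigma> permutes {..<b}}. of_int (sign \<sigma>) * (unit_vec (label M (permute_list \<sigma> w)) L :: 'k))"
      by (simp add: fun_sum_apply vscale_apply)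
    also have "\<dots> = (\<Sum>\<sigma>\<in>{\<sigma>. \<sigma> permutes {..<b}}.
        of_int (sign (inv \<sigma>)) * unit_vec (label M (permute_list (inv \<sigma>) w)) L)"
      by (rule sum_permutations_inverse)
    also have "\<dots> = (\<Sum>\<sigma>\<in>{\<sigma>. \<sigma> permutes {..<b}}.
        of_int (sign \<sigma>) * unit_vec (label M w) (N # permute_list \<sigma> T))"
    proof (rule sum.cong[OF refl])
      fix \<sigma> assume "\<sigma> \<in> {\<sigma>. \<sigma> permutes {..<b}}"
      then have s: "\<sigma> permutes {..<b}" by simp
      then have "sign (inv \<sigma>) = sign \<sigma>" using permutes_imp_permutation[of "{..<b}" \<sigma>] sign_inverse by blast
      then show "of_int (sign (inv \<sigma>)) * unit_vec (label M (permute_list (inv \<sigma>) w)) L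
        = (of_int (sign \<sigma>) * unit_vec (label M w) (N # permute_list \<sigma> T) :: 'k)"
        using eq[OF s] by (simp add: unit_vec_apply)
    qed
    also have "\<dots> = altern b (unit_vec (label M w)) L" unfolding Cons altern_def by simp
    finally show ?thesis by (rule sym)
  qed
qed

definition act_tail :: "nat \<Rightarrow> (nat \<Rightarrow> nat) \<Rightarrow> nat list \<Rightarrow> nat list" where
  "act_tail c \<sigma> I = take c I @ permute_list \<sigma> (drop c I)"

lemma act_tail_append: "length x = c \<Longrightarrow> act_tail c \<sigma> (x @ w) = x @ permute_list \<sigma> w"
  by (simp add: act_tail_def)

lemma words_append: "x \<in> words c n \<Longrightarrow> w \<in> words b n \<Longrightarrow> x @ w \<in> words (c + b) n"
  by (auto simp: words_def)

lemma act_tail_in_words: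
  assumes "\<sigma> permutes {..<b}" "I \<in> words (c + b) n"
  shows "act_tail c \<sigma> I \<in> words (c + b) n"
proof -
  obtain x w where "I = x @ w" "x \<in> words c n" "w \<in> words b n" using assms(2) by (rule word_split)
  then show ?thesis
    using permute_list_in_words[OF assms(1)] length_words by (simp add: act_tail_append words_append)
qed

lemma place_perm_act_tail:
  assumes s: "\<sigma> permutes {..<b}"
  shows "place_perm (c + b) (act_tail c \<sigma>)"
  unfolding place_perm_def
proof (intro conjI allI ballI)
  fix m
  have inv: "act_tail c (inv \<tau>) (act_tail c \<tau> I) = I" "act_tail c \<tau> (act_tail c (inv \<tau>) I) = I"
    if I: "I \<in> words (c + b) m" and "\<tau> permutes {..<b}" for \<tau> I
  proof -
    obtain x w where "I = x @ w" "x \<in> words c m" "w \<in> words b m" using I by (rule word_split)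
    then have "I = x @ w" "length x = c" "length w = b" by (auto simp: words_def)
    then show "act_tail c (inv \<tau>) (act_tail c \<tau> I) = I" "act_tail c \<tau> (act_tail c (inv \<tau>) I) = I"
      using permute_list_inv[OF that(2)] by (simp_all add: act_tail_append)
  qed
  show "bij_betw (act_tail c \<sigma>) (words (c + b) m) (words (c + b) m)"
  proof (rule bij_betw_byWitness[where f' = "act_tail c (inv \<sigma>)"])
    show "\<forall>a\<in>words (c + b) m. act_tail c (inv \<sigma>) (act_tail c \<sigma> a) = a"
      "\<forall>a\<in>words (c + b) m. act_tail c \<sigma> (act_tail c (inv \<sigma>) a) = a" using inv s by blast+
    show "act_tail c \<sigma> ` words (c + b) m \<subseteq> words (c + b) m" "act_tail c (inv \<sigma>) ` words (c + b) m \<subseteq> words (c + b) m"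
      using act_tail_in_words s permutes_inv[OF s] by blast+
  qed
next
  fix m n J I assume J: "J \<in> words (c + b) m" and I: "I \<in> words (c + b) n"
  obtain x w where x: "I = x @ w" "x \<in> words c n" "w \<in> words b n" using I by (rule word_split)
  obtain y u where y: "J = y @ u" "y \<in> words c m" "u \<in> words b m" using J by (rule word_split)
  have l: "length x = c" "length y = c" "length w = b" "length u = b" using x y by (auto simp: words_def)
  show "word_expo (act_tail c \<sigma> J) (act_tail c \<sigma> I) = word_expo J I"
    using l s word_expo_permute[of \<sigma> w u] by (simp add: x(1) y(1) act_tail_append word_expo_append)
qed

lemma altern_unit_wlabel:
  assumes "I \<in> words (c + b) n"
  shows "altern b (unit_vec (wlabel c I)) = (\<Sum>\<sigma>\<in>{\<sigma>. \<sigma> permutes {..<b}}.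
    vscale (of_int (sign \<sigma>)) (unit_vec (wlabel c (act_tail c \<sigma> I))) :: _ \<Rightarrow> 'k::field)"
proof -
  obtain x w where x: "I = x @ w" "x \<in> words c n" "w \<in> words b n" using assms by (rule word_split)
  have l: "length x = c" "length w = b" using x by (auto simp: words_def)
  show ?thesis unfolding x(1) using l by (simp add: act_tail_append wlabel_append altern_unit)
qed

text \<open>The sum runs over the places of \<open>x\<close>, not over its distinct letters. This
  accounts for the exponents in \<open>comult\<close> and prepares the form that
  \<open>natural_from_basis\<close> requires.\<close>

lemma comult_unit:
  "comult (unit_vec (label (mset x) w)) =
    (\<Sum>s<length x. unit_vec (label (mset x - {#x ! s#}) (x ! s # w)) :: _ \<Rightarrow> 'k::field)"
proof
  fix L
  show "comult (unit_vec (label (mset x) w)) L =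
    ((\<Sum>s<length x. unit_vec (label (mset x - {#x ! s#}) (x ! s # w))) L :: 'k)"
  proof (cases "\<exists>N i u. L = label N (i # u)")
    case True
    then obtain N i u where L: "L = label N (i # u)" by blast
    have "(\<Sum>s<length x. unit_vec (label (mset x - {#x ! s#}) (x ! s # w))) L
      = (\<Sum>s<length x. if x ! s = i then (if mset x - {#i#} = N \<and> u = w then 1 else 0) else 0 :: 'k)"
      unfolding fun_sum_apply L by (rule sum.cong) (auto simp: unit_vec_apply)
    also have "\<dots> = of_nat (card {s. s < length x \<and> x ! s = i}) * (if mset x - {#i#} = N \<and> u = w then 1 else 0)"
      by (simp add: sum.If_cases Int_def lessThan_def)
    also have "card {s. s < length x \<and> x ! s = i} = count (mset x) i"
      using length_filter_conv_card[of "(=) i" x]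
      by (simp add: count_mset count_list_eq_length_filter eq_commute)
    also have "of_nat (count (mset x) i) * (if mset x - {#i#} = N \<and> u = w then 1 else 0 :: 'k)
      = of_nat (Suc (count N i)) * (if add_mset i N = mset x \<and> u = w then 1 else 0)"
    proof (cases "i \<in># mset x")
      case True
      then have "mset x - {#i#} = N \<longleftrightarrow> add_mset i N = mset x"
        by (metis add_mset_remove_trivial insert_DiffM)
      moreover have "add_mset i N = mset x \<Longrightarrow> count (mset x) i = Suc (count N i)"
        by (metis count_add_mset)
      ultimately show ?thesis by auto
    next
      case False
      then have "count (mset x) i = 0" "add_mset i N \<noteq> mset x"
        by (auto simp: count_eq_zero_iff) (metis union_single_eq_member set_mset_mset)
      then show ?thesis by (simp only: of_nat_0 mult_zero_left mult_zero_right simp_thms if_False)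
    qed
    also have "\<dots> = comult (unit_vec (label (mset x) w)) L"
      unfolding L comult_label by (auto simp: unit_vec_apply)
    finally show ?thesis by simp
  next
    case False
    have "(\<Sum>s<length x. unit_vec (label (mset x - {#x ! s#}) (x ! s # w))) L = (0 :: 'k)"
      unfolding fun_sum_apply using False by (auto simp: unit_vec_apply intro!: sum.neutral)
    moreover have "comult (unit_vec (label (mset x) w)) L = (0 :: 'k)"
    proof -
      have "L \<noteq> N # {#i#} # map (\<lambda>x. {#x#}) w" for N i using False unfolding label_def
        by (metis list.simps(9))
      then show ?thesis
        unfolding comult_def by (auto split: list.split simp: unit_vec_apply label_def size_1_singleton_mset
            dest!: size_1_singleton_mset[OF trans[OF _ One_nat_def[symmetric]]])
    qed
    ultimately show ?thesis by simp
  qed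
qed

text \<open>Place \<open>c\<close> is the last place of the symmetric factor in the source and the
  first tensor place in the target, so exchanging \<open>s\<close> and \<open>c\<close> extracts the
  letter at place \<open>s\<close>.\<close>

lemma comult_unit_wlabel:
  assumes I: "I \<in> words (Suc c + b) n"
  shows "comult (unit_vec (wlabel (Suc c) I)) =
    (\<Sum>s<Suc c. vscale 1 (unit_vec (wlabel c (permute_list (transpose s c) I))) :: _ \<Rightarrow> 'k::field)"
proof -
  obtain x w where x: "I = x @ w" "x \<in> words (Suc c) n" "w \<in> words b n" using I by (rule word_split)
  have l: "length x = Suc c" using x by (auto simp: words_def)
  have "wlabel c (permute_list (transpose s c) I) = label (mset x - {#x ! s#}) (x ! s # w)" if "s < Suc c" for s
  proof -
    have p: "transpose s c permutes {..<length x}" using that l by (intro permutes_swap_id) auto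
    define y where "y = permute_list (transpose s c) x"
    have y: "length y = Suc c" "y ! c = x ! s" "mset y = mset x"
      unfolding y_def using l p by (auto simp: permute_list_nth)
    have "y = take c y @ [y ! c]" using y(1) by (metis lessI take_Suc_conv_app_nth take_all order_refl)
    then have "mset y = add_mset (x ! s) (mset (take c y))" using y(2) by (metis mset_append mset.simps(1,2) union_mset_add_mset_right add_0_right)
    then have m: "mset (take c y) = mset x - {#x ! s#}" using y(3) by simp
    have "permute_list (transpose s c) I = y @ w" unfolding x(1) y_def by (rule permute_list_append_left[OF p])
    also have "\<dots> = take c y @ (x ! s # w)" using \<open>y = take c y @ [y ! c]\<close> y(2)
      by (metis append.assoc append_Cons append_Nil)
    finally show ?thesis using y(1) m by (simp add: wlabel_append)
  qed
  moreover have "wlabel (Suc c) I = label (mset x) w" using x l by (simp add: wlabel_append)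
  ultimately show ?thesis using comult_unit[of x w] l by simp
qed

section \<open>Naturality of the three maps\<close>

lemma koszul_in: "v \<in> coord_space (labels c (Suc b) n) \<Longrightarrow> koszul v \<in> coord_space (labels (Suc c) b n)"
proof (rule lin_maps_coord_space[OF lin_koszul finite_labels])
  fix x assume "x \<in> labels c (Suc b) n"
  then obtain I where I: "I \<in> words (c + Suc b) n" "x = wlabel c I" using labels_eq by auto
  then show "koszul (unit_vec x) \<in> coord_space (labels (Suc c) b n)"
    by (simp add: koszul_unit_wlabel wlabel_in_labels)
qed

lemma koszul_natural:
  "v \<in> coord_space (labels c (Suc b) n) \<Longrightarrow>
    koszul (coef (SI c (Suc b)) m n \<alpha> v) = coef (SI (Suc c) b) m n \<alpha> (koszul v)"
  by (rule natural_from_basis[OF lin_koszul, where X = "{()}" and a = "\<lambda>_. 1" and \<rho> = "\<lambda>_ I. I"])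
    (auto simp: koszul_unit_wlabel place_perm_def bij_betw_def)

lemma altern_in: "v \<in> coord_space (labels c b n) \<Longrightarrow> altern b v \<in> coord_space (labels c b n)"
proof (rule lin_maps_coord_space[OF lin_altern finite_labels])
  fix x assume "x \<in> labels c b n"
  then obtain I where I: "I \<in> words (c + b) n" "x = wlabel c I" using labels_eq by auto
  then show "altern b (unit_vec x) \<in> coord_space (labels c b n)"
    by (auto simp: altern_unit_wlabel wlabel_in_labels act_tail_in_words
        intro!: sum_in_coord_space fun_vs.subspace_scale[OF subspace_coord_space])
qed

lemma altern_natural:
  "v \<in> coord_space (labels c b n) \<Longrightarrow>
    altern b (coef (SI c b) m n \<alpha> v) = coef (SI c b) m n \<alpha> (altern b v)"
  by (rule natural_from_basis[OF lin_altern, where X = "{\<sigma>. \<sigma> permutes {..<b}}"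
        and a = "\<lambda>\<sigma>. of_int (sign \<sigma>)" and \<rho> = "act_tail c"])
    (auto simp: altern_unit_wlabel place_perm_act_tail)

lemma place_perm_transpose:
  assumes "s < e" "t < e"
  shows "place_perm e (permute_list (transpose s t))"
  by (rule place_perm_permute_list, rule permutes_swap_id) (use assms in auto)

lemma comult_in: "v \<in> coord_space (labels (Suc c) b n) \<Longrightarrow> comult v \<in> coord_space (labels c (Suc b) n)"
proof (rule lin_maps_coord_space[OF lin_comult finite_labels])
  fix x assume "x \<in> labels (Suc c) b n"
  then obtain I where I: "I \<in> words (Suc c + b) n" "x = wlabel (Suc c) I" using labels_eq by auto
  have "permute_list (transpose s c) I \<in> words (c + Suc b) n" if "s < Suc c" for s
    using I that by (intro permute_list_in_words permutes_swap_id) auto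
  then show "comult (unit_vec x) \<in> coord_space (labels c (Suc b) n)"
    unfolding I(2) comult_unit_wlabel[OF I(1)]
    by (auto simp del: sum.lessThan_Suc intro!: sum_in_coord_space wlabel_in_labels)
qed

lemma comult_natural:
  "v \<in> coord_space (labels (Suc c) b n) \<Longrightarrow>
    comult (coef (SI (Suc c) b) m n \<alpha> v) = coef (SI c (Suc b)) m n \<alpha> (comult v)"
  by (rule natural_from_basis[OF lin_comult, where X = "{..<Suc c}" and a = "\<lambda>_. 1"
        and \<rho> = "\<lambda>s. permute_list (transpose s c)"])
    (auto simp: comult_unit_wlabel place_perm_transpose simp del: sum.lessThan_Suc)

section \<open>Signs of words\<close>

lemma word_sign_Nil [simp]: "word_sign [] = 1"
  by (simp add: word_sign_def)

lemma word_sign_Cons: "word_sign (x # w) = (- 1) ^ length (filter (\<lambda>y. y < x) w) * word_sign w"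
proof -
  let ?S = "\<lambda>w. {(s, t). s < t \<and> t < length w \<and> w ! s > w ! t}"
  have fin: "finite (?S w)" for w
    by (rule finite_subset[of _ "{..<length w} \<times> {..<length w}"]) auto
  have eq: "?S (x # w) = (\<lambda>t. (0, Suc t)) ` {t. t < length w \<and> w ! t < x} \<union> map_prod Suc Suc ` ?S w"
  proof (intro equalityI subsetI)
    fix u assume "u \<in> ?S (x # w)"
    then obtain s t where "u = (s, Suc t)" "s < Suc t" "t < length w" "(x # w) ! s > w ! t"
      by (cases u; cases "snd u") auto
    then show "u \<in> (\<lambda>t. (0, Suc t)) ` {t. t < length w \<and> w ! t < x} \<union> map_prod Suc Suc ` ?S w"
      by (cases s) (auto simp: image_iff)
  qed auto
  have "card (?S (x # w)) = card ((\<lambda>t. (0::nat, Suc t)) ` {t. t < length w \<and> w ! t < x}) + card (map_prod Suc Suc ` ?S w)"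
    unfolding eq by (rule card_Un_disjoint) (use fin in auto)
  also have "\<dots> = length (filter (\<lambda>y. y < x) w) + card (?S w)"
    by (subst (1 2) card_image) (auto simp: inj_on_def length_filter_conv_card)
  finally show ?thesis by (simp add: word_sign_def power_add)
qed

lemma word_sign_swap:
  "a \<noteq> b \<Longrightarrow> word_sign (xs @ b # a # ys) = - (word_sign (xs @ a # b # ys) :: 'k::field)"
proof (induction xs)
  case Nil
  then have "a < b \<or> b < a" by auto
  then show ?case by (auto simp: word_sign_Cons)
qed (simp add: word_sign_Cons)

lemma word_sign_permute_adjacent:
  assumes "distinct w" "Suc s < length w"
  shows "word_sign (permute_list (transpose s (Suc s)) w) = - (word_sign w :: 'k::field)"
proof -
  define xs where "xs = take s w"
  obtain a b ys where w: "w = xs @ a # b # ys"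
  proof
    show "w = xs @ w ! s # w ! Suc s # drop (Suc (Suc s)) w"
      using assms(2) id_take_nth_drop[of s w] Cons_nth_drop_Suc[OF assms(2)] unfolding xs_def by simp
  qed
  have l: "length xs = s" using assms(2) by (simp add: xs_def)
  have p: "transpose s (Suc s) permutes {..<length w}" using assms(2) by (intro permutes_swap_id) auto
  have "permute_list (transpose s (Suc s)) w = xs @ b # a # ys"
  proof (rule nth_equalityI)
    fix i assume "i < length (permute_list (transpose s (Suc s)) w)"
    then have i: "i < length w" by simp
    show "permute_list (transpose s (Suc s)) w ! i = (xs @ b # a # ys) ! i"
      unfolding permute_list_nth[OF p i] unfolding w using l
      by (cases "i < s"; cases "i = s"; cases "i = Suc s") (auto simp: transpose_def nth_append nth_Cons split: nat.split)
  qed (simp add: w)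
  moreover have "a \<noteq> b" using assms(1) w by auto
  ultimately show ?thesis using word_sign_swap[of a b xs ys] w by simp
qed

text \<open>Conjugation by an adjacent transposition shortens the distance of the two places by one
  and contributes two further sign changes.\<close>

lemma word_sign_permute_transpose:
  assumes "distinct w" "s < t" "t < length w"
  shows "word_sign (permute_list (transpose s t) w) = - (word_sign w :: 'k::field)"
  using assms
proof (induction "t - s" arbitrary: t w)
  case (Suc d)
  show ?case
  proof (cases "t = Suc s")
    case True
    then show ?thesis using word_sign_permute_adjacent Suc by blast
  next
    case False
    then obtain t' where t: "t = Suc t'" "s < t'" using Suc by (cases t) auto
    let ?a = "transpose t' (Suc t')" let ?b = "transpose s t'"
    have pa: "?a permutes {..<length w}" and pb: "?b permutes {..<length w}"
      using Suc t by (auto intro!: permutes_swap_id)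
    have "transpose s t = ?a \<circ> ?b \<circ> ?a"
      using transpose_comp_triple[of "Suc t'" s t'] t by (simp add: transpose_commute)
    then have "permute_list (transpose s t) w = permute_list ?a (permute_list ?b (permute_list ?a w))"
      using pa pb by (simp add: permute_list_compose)
    also have "word_sign \<dots> = - (word_sign (permute_list ?b (permute_list ?a w)) :: 'k)"
      by (rule word_sign_permute_adjacent) (use Suc t pa pb in auto)
    also have "word_sign (permute_list ?b (permute_list ?a w)) = - (word_sign (permute_list ?a w) :: 'k)"
      by (rule Suc.hyps(1)) (use Suc t pa in auto)
    also have "word_sign (permute_list ?a w) = - (word_sign w :: 'k)"
      by (rule word_sign_permute_adjacent) (use Suc t in auto)
    finally show ?thesis by simp
  qed
qed simp

text \<open>The exterior powers are defined with signs that count inversions, antisymmetrization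
  with signs of permutations. For distinct letters, both change under every transposition.\<close>

lemma word_sign_permute:
  assumes "\<sigma> permutes {..<length w}" "distinct w"
  shows "word_sign (permute_list \<sigma> w) = (of_int (sign \<sigma>) * word_sign w :: 'k::field)"
proof -
  define b where "b = length w"
  have "\<forall>w. length w = b \<longrightarrow> distinct w \<longrightarrow> word_sign (permute_list \<sigma> w) = (of_int (sign \<sigma>) * word_sign w :: 'k)"
    using assms(1)[folded b_def] finite_lessThan
  proof (induction \<sigma> rule: permutes_induct)
    case (swap s t p)
    show ?case
    proof (intro allI impI)
      fix w :: "nat list" assume w: "length w = b" "distinct w"
      have wlabel: "transpose s t permutes {..<length w}" using swap w by (intro permutes_swap_id) auto
      have "word_sign (permute_list (transpose s t) w) = - (word_sign w :: 'k)"
      proof (cases "s < t")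
        case True
        then show ?thesis using word_sign_permute_transpose w swap by auto
      next
        case False
        then have "t < s" using swap by auto
        then show ?thesis using word_sign_permute_transpose[of w t s] w swap by (auto simp: transpose_commute)
      qed
      moreover have "permute_list (transpose s t \<circ> p) w = permute_list p (permute_list (transpose s t) w)"
        using swap w by (intro permute_list_compose) auto
      moreover have "sign (transpose s t \<circ> p) = - sign p"
        using swap permutes_imp_permutation[of "{..<b}" p] permutes_imp_permutation[OF _ wlabel]
        by (simp add: sign_compose sign_swap_id)
      ultimately show "word_sign (permute_list (transpose s t \<circ> p) w) = (of_int (sign (transpose s t \<circ> p)) * word_sign w :: 'k)"
        using swap w wlabel by simp
    qed
  qed auto
  then show ?thesis using assms b_def by blast
qed

text \<open>The coefficient of the increasingly ordered basis vector in the wedge product of the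
  letters of \<open>w\<close>, which vanishes for a repeated letter.\<close>

definition altsign :: "nat list \<Rightarrow> 'k::field" where
  "altsign w = (if distinct w then word_sign w else 0)"

lemma altsign_Cons:
  "altsign (x # w) = (if x \<in> set w then 0 else (- 1) ^ length (filter (\<lambda>y. y < x) w)) * altsign w"
  by (simp add: altsign_def word_sign_Cons)

lemma altsign_Nil [simp]: "altsign [] = 1"
  by (simp add: altsign_def)

lemma altsign_permute:
  "\<sigma> permutes {..<length w} \<Longrightarrow> altsign (permute_list \<sigma> w) = of_int (sign \<sigma>) * altsign w"
  by (simp add: altsign_def word_sign_permute)

lemma altsign_sorted: "sorted w \<Longrightarrow> distinct w \<Longrightarrow> altsign w = 1"
proof -
  assume w: "sorted w" "distinct w"
  have "{(s, t). s < t \<and> t < length w \<and> w ! s > w ! t} = {}"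
  proof -
    have "w ! s \<le> w ! t" if "s < t" "t < length w" for s t
      using sorted_nth_mono[OF w(1)] that by simp
    then show ?thesis by (auto simp: not_less[symmetric])
  qed
  then show ?thesis using w unfolding altsign_def word_sign_def by (simp only: card.empty power_0 if_True)
qed

lemma of_int_sign_mult [simp]: "of_int (sign \<sigma>) * of_int (sign \<sigma>) = (1 :: 'k::field)"
  by (metis of_int_1 of_int_mult sign_idempotent)

lemma of_int_sign_mult_left [simp]: "of_int (sign \<sigma>) * (of_int (sign \<sigma>) * x) = (x :: 'k::field)"
  by (simp flip: mult.assoc)

section \<open>The functors $S^c \otimes \Lambda^b$ and the Koszul complex\<close>

text \<open>
  If \<open>b!\<close> is invertible, then the antisymmetric tensors cut out here form $S^c \otimes \Lambda^b$; compare
  \<open>SL_eq_alternating\<close>. The spaces \<open>alternating c b n\<close> below are $S^c \otimes \Lambda^b$ in any characteristic;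
  they are needed for \<open>b = p\<close>, too.
\<close>

definition SL :: "nat \<Rightarrow> nat \<Rightarrow> (nat multiset list, 'k::field) spf" where
  "SL c b = \<lparr>obj = \<lambda>n. {v \<in> coord_space (labels c b n). altern b v = vscale (of_nat (fact b)) v},
     coef = coef (SI c b)\<rparr>"

lemma coef_SL [simp]: "coef (SL c b) = coef (SI c b)"
  by (simp add: SL_def)

lemma obj_SL: "obj (SL c b) n = {v \<in> coord_space (labels c b n). altern b v = vscale (of_nat (fact b)) v}"
  by (simp add: SL_def)

lemma obj_SL_subset: "obj (SL c b) n \<subseteq> obj (SI c b) n"
  by (auto simp: obj_SL obj_SI)

lemma strict_poly_functor_SL: "strict_poly_functor (c + b) (SL c b :: (nat multiset list, 'k::field) spf)"
proof -
  let ?U = "\<lambda>n. {v \<in> coord_space (labels c b n). altern b v = vscale (of_nat (fact b)) v} :: (_ \<Rightarrow> 'k) set"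
  have add: "altern b (x + y) = altern b x + altern b y" and scale: "altern b (vscale a x) = vscale a (altern b x)"
    for x y :: "nat multiset list \<Rightarrow> 'k" and a
    using lin_altern unfolding lin_iff by blast+
  have "strict_poly_functor (c + b) \<lparr>obj = ?U, coef = coef (SI c b)\<rparr>"
  proof (rule strict_poly_subfunctor[OF strict_poly_functor_SI])
    fix n show "fun_vs.subspace (?U n)"
      unfolding fun_vs.subspace_def
    proof (intro conjI ballI allI)
      have "altern b (vscale 0 0) = vscale 0 (altern b (0 :: nat multiset list \<Rightarrow> 'k))" by (rule scale)
      then have "altern b 0 = (0 :: nat multiset list \<Rightarrow> 'k)" by (simp only: fun_vs.scale_zero_left)
      then show "0 \<in> ?U n"
        using fun_vs.subspace_0[OF subspace_coord_space] by (simp only: mem_Collect_eq fun_vs.scale_zero_right simp_thms)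
    next
      fix x y assume "x \<in> ?U n" "y \<in> ?U n"
      then show "x + y \<in> ?U n"
        by (auto simp only: mem_Collect_eq add fun_vs.scale_right_distrib
            intro: fun_vs.subspace_add[OF subspace_coord_space])
    next
      fix a x assume "x \<in> ?U n"
      then show "vscale a x \<in> ?U n"
        by (auto simp: scale mult.commute intro: fun_vs.subspace_scale[OF subspace_coord_space])
    qed
    show "?U n \<subseteq> obj (SI c b) n" by (auto simp: obj_SI)
  next
    fix m n \<alpha> v assume "v \<in> ?U n"
    then show "coef (SI c b) m n \<alpha> v \<in> ?U m"
      using SI_coef_in altern_natural lin_scale[OF lin_SI_coef] by (auto simp: altern_natural lin_scale[OF lin_SI_coef])
  qed
  then show ?thesis by (simp add: SL_def)
qed

lemma coord_space_labels_eqI: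
  assumes "v \<in> coord_space (labels c b n)" "v' \<in> coord_space (labels c b n)"
    and "\<And>N w. label N w \<in> labels c b n \<Longrightarrow> v (label N w) = v' (label N w)"
  shows "v = v'"
proof
  fix L show "v L = v' L"
  proof (cases "L \<in> labels c b n")
    case True
    then show ?thesis using assms(3) labels_iff by auto
  qed (use assms(1,2) in \<open>auto simp: coord_space_def\<close>)
qed

lemma coord_space_label_0:
  "v \<in> coord_space (labels c b n) \<Longrightarrow> length w \<noteq> b \<Longrightarrow> v (label N w) = 0"
  by (auto simp: coord_space_def)

lemma altern_permute:
  assumes \<tau>: "\<tau> permutes {..<b}" and w: "length w = b"
  shows "altern b v (label N (permute_list \<tau> w)) = of_int (sign \<tau>) * altern b v (label N w)"
proof -
  have t: "\<tau> permutes {..<length w}" using assms by simp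
  have "altern b v (label N w) = (\<Sum>\<sigma>\<in>{\<sigma>. \<sigma> permutes {..<b}}. of_int (sign \<sigma>) * v (label N (permute_list \<sigma> w)))"
    by (rule altern_label[OF w])
  also have "\<dots> = (\<Sum>\<sigma>\<in>{\<sigma>. \<sigma> permutes {..<b}}. of_int (sign (\<tau> \<circ> \<sigma>)) * v (label N (permute_list (\<tau> \<circ> \<sigma>) w)))"
    by (rule sum.reindex_bij_witness[of _ "\<lambda>\<sigma>. \<tau> \<circ> \<sigma>" "\<lambda>\<sigma>. inv \<tau> \<circ> \<sigma>"])
      (use \<tau> permutes_inv[OF \<tau>] permutes_inv_o[OF \<tau>] in \<open>auto simp: permutes_compose simp flip: o_assoc\<close>,
       auto simp: o_assoc)
  also have "\<dots> = (\<Sum>\<sigma>\<in>{\<sigma>. \<sigma> permutes {..<b}}. of_int (sign \<tau>) *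
      (of_int (sign \<sigma>) * v (label N (permute_list \<sigma> (permute_list \<tau> w)))))"
  proof (rule sum.cong[OF refl])
    fix \<sigma> assume "\<sigma> \<in> {\<sigma>. \<sigma> permutes {..<b}}"
    then have s: "\<sigma> permutes {..<b}" by simp
    have "sign (\<tau> \<circ> \<sigma>) = sign \<tau> * sign \<sigma>"
      using sign_compose[of \<tau> \<sigma>] permutes_imp_permutation[OF _ s] permutes_imp_permutation[OF _ \<tau>] by simp
    moreover have "permute_list (\<tau> \<circ> \<sigma>) w = permute_list \<sigma> (permute_list \<tau> w)"
      by (rule permute_list_compose) (use s w in simp)
    ultimately show "of_int (sign (\<tau> \<circ> \<sigma>)) * v (label N (permute_list (\<tau> \<circ> \<sigma>) w)) =
      of_int (sign \<tau>) * (of_int (sign \<sigma>) * v (label N (permute_list \<sigma> (permute_list \<tau> w))))" by simp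
  qed
  also have "\<dots> = of_int (sign \<tau>) * altern b v (label N (permute_list \<tau> w))"
    using w by (simp add: altern_label sum_distrib_left)
  finally show ?thesis by simp
qed

lemma altern_eq_factI:
  assumes v: "v \<in> coord_space (labels c b n)"
    and "\<And>N w \<sigma>. \<sigma> permutes {..<b} \<Longrightarrow> length w = b \<Longrightarrow>
      v (label N (permute_list \<sigma> w)) = of_int (sign \<sigma>) * v (label N w)"
  shows "altern b v = vscale (of_nat (fact b)) (v :: _ \<Rightarrow> 'k::field)"
proof (rule coord_space_labels_eqI[OF altern_in[OF v]])
  show "vscale (of_nat (fact b)) v \<in> coord_space (labels c b n)"
    using fun_vs.subspace_scale[OF subspace_coord_space v] .
  fix N w assume "label N w \<in> labels c b n"
  then have w: "length w = b" by simp
  have "altern b v (label N w) = (\<Sum>\<sigma>\<in>{\<sigma>. \<sigma> permutes {..<b}}. v (label N w))"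
    unfolding altern_label[OF w] by (rule sum.cong) (use assms(2) w in auto)
  also have "\<dots> = of_nat (fact b) * v (label N w)"
    using card_permutations[of "{..<b}" b] by simp
  finally show "altern b v (label N w) = vscale (of_nat (fact b)) v (label N w)" by (simp add: vscale_apply)
qed

lemma altern_in_SL: "v \<in> coord_space (labels c b n) \<Longrightarrow> altern b v \<in> obj (SL c b) n"
  unfolding obj_SL using altern_in altern_eq_factI[OF altern_in] altern_permute by blast

lemma lin_vscale: "lin f \<Longrightarrow> lin (\<lambda>v. vscale a (f v))"
  unfolding lin_iff by (simp add: fun_vs.scale_right_distrib mult.commute)

lemma SL_permute:
  assumes f: "of_nat (fact b) \<noteq> (0 :: 'k::field)" and v: "v \<in> obj (SL c b) n"
    and s: "\<sigma> permutes {..<b}" "length w = b"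
  shows "v (label N (permute_list \<sigma> w)) = (of_int (sign \<sigma>) * v (label N w) :: 'k)"
proof -
  have "of_nat (fact b) * v (label N w) = altern b v (label N w)" for w
    using v by (simp add: obj_SL vscale_apply)
  then have "of_nat (fact b) * v (label N (permute_list \<sigma> w)) = of_nat (fact b) * (of_int (sign \<sigma>) * v (label N w))"
    using altern_permute[OF s, of v N] by (simp add: mult.left_commute)
  then show ?thesis using f by simp
qed

definition altern_retract :: "nat \<Rightarrow> nat \<Rightarrow> (nat multiset list, nat multiset list, 'k::field) family" where
  "altern_retract c b = restrict_family (SI c b) (\<lambda>v. vscale (1 / of_nat (fact b)) (altern b v))"

lemma altern_retract_Hom: "altern_retract c b \<in> Hom (c + b) (SI c b) (SL c b :: (nat multiset list, 'k::field) spf)"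
  unfolding altern_retract_def
proof (rule restrict_family_Hom[OF strict_poly_functor_SI])
  show "lin (\<lambda>v :: nat multiset list \<Rightarrow> 'k. vscale (1 / of_nat (fact b)) (altern b v))"
    by (rule lin_vscale[OF lin_altern])
  fix n and v :: "nat multiset list \<Rightarrow> 'k" assume "v \<in> obj (SI c b) n"
  then show "vscale (1 / of_nat (fact b)) (altern b v) \<in> obj (SL c b) n"
    by (intro fun_vs.subspace_scale[OF strict_subspace[OF strict_poly_functor_SL]] altern_in_SL) (simp add: obj_SI)
next
  fix m n \<alpha> and v :: "nat multiset list \<Rightarrow> 'k" assume "v \<in> obj (SI c b) n"
  then show "vscale (1 / of_nat (fact b)) (altern b (coef (SI c b) m n \<alpha> v))
      = coef (SL c b) m n \<alpha> (vscale (1 / of_nat (fact b)) (altern b v))"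
    by (simp add: obj_SI altern_natural lin_scale[OF lin_SI_coef])
qed

lemma injective_SL:
  assumes "of_nat (fact b) \<noteq> (0 :: 'k::field)"
  shows "injective_spf (c + b) (SL c b :: (nat multiset list, 'k) spf)"
proof (rule injective_retract[OF strict_poly_functor_SL obj_SL_subset coef_SL altern_retract_Hom])
  fix n and v :: "nat multiset list \<Rightarrow> 'k" assume v: "v \<in> obj (SL c b) n"
  then have "altern_retract c b n v = vscale (1 / of_nat (fact b)) (altern b v)"
    using obj_SL_subset[of c b n] unfolding altern_retract_def by (intro restrict_family_in) blast
  also have "\<dots> = v" using v assms by (simp add: obj_SL fun_vs.scale_scale)
  finally show "altern_retract c b n v = v" .
qed

definition alternating :: "nat \<Rightarrow> nat \<Rightarrow> nat \<Rightarrow> (nat multiset list \<Rightarrow> 'k::field) set" where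
  "alternating c b n = {v \<in> coord_space (labels c b n). \<forall>N w. v (label N w) = altsign w * v (label N (sort w))}"

lemma AbD: "v \<in> alternating c b n \<Longrightarrow> v (label N w) = altsign w * v (label N (sort w))"
  unfolding alternating_def by blast

lemma alternating_coord: "v \<in> alternating c b n \<Longrightarrow> v \<in> coord_space (labels c b n)"
  unfolding alternating_def by blast

lemma alternating_not_distinct: "v \<in> alternating c b n \<Longrightarrow> \<not> distinct w \<Longrightarrow> v (label N w) = 0"
  using AbD[of v c b n N w] by (simp add: altsign_def)

lemma sort_eq_iff_mset: "sort (xs :: nat list) = sort ys \<longleftrightarrow> mset xs = mset ys"
  by (metis mset_sort sorted_list_of_multiset_mset)

lemma alternating_permute:
  assumes "v \<in> alternating c b n" "mset u = mset w" "distinct w"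
  shows "v (label N u) = altsign u * altsign w * v (label N w)"
proof -
  have "altsign w * altsign w = (1 :: 'a)"
    using assms(3) by (simp add: altsign_def word_sign_def flip: power_add)
  moreover have "sort u = sort w" using assms(2) sort_eq_iff_mset by blast
  ultimately show ?thesis using AbD[OF assms(1), of N u] AbD[OF assms(1), of N w]
    by (simp add: mult.assoc)
qed

text \<open>An eigenvector of \<open>altern b\<close> is sign equivariant because b! is invertible.
  For a word with a repeated letter this only says that twice the value is 0; but then b \<ge> 2, so
  2 divides b! and is invertible as well.\<close>

lemma SL_eq_alternating:
  assumes f: "of_nat (fact b) \<noteq> (0 :: 'k::field)"
  shows "obj (SL c b) n = (alternating c b n :: (_ \<Rightarrow> 'k) set)"
proof (intro equalityI subsetI)
  fix v :: "nat multiset list \<Rightarrow> 'k" assume v: "v \<in> obj (SL c b) n"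
  then have vc: "v \<in> coord_space (labels c b n)" by (simp add: obj_SL)
  have "v (label N w) = altsign w * v (label N (sort w))" for N w
  proof (cases "length w = b")
    case False
    then show ?thesis using coord_space_label_0[OF vc] by simp
  next
    case b: True
    show ?thesis
    proof (cases "distinct w")
      case True
      obtain \<sigma> where s: "\<sigma> permutes {..<length (sort w)}" "permute_list \<sigma> (sort w) = w"
        using mset_eq_permutation[of w "sort w"] by auto
      have "altsign (sort w) = (1 :: 'k)" by (rule altsign_sorted) (use True in auto)
      then have "altsign w = (of_int (sign \<sigma>) :: 'k)"
        using altsign_permute[OF s(1), where 'a = 'k] s(2) by simp
      then show ?thesis using SL_permute[OF f v, of \<sigma> "sort w" N] s b by simp
    next
      case False
      then obtain s t where st: "s < length w" "t < length w" "s \<noteq> t" "w ! s = w ! t"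
        by (auto simp: distinct_conv_nth)
      let ?t = "transpose s t"
      have p: "?t permutes {..<length w}" using st by (intro permutes_swap_id) auto
      have "permute_list ?t w = w"
        by (rule nth_equalityI) (use st p in \<open>auto simp: permute_list_nth transpose_def\<close>)
      then have "v (label N w) = - v (label N w)"
        using SL_permute[OF f v, of ?t w N] p b st by (simp add: sign_swap_id)
      then have "2 * v (label N w) = 0" by (metis add.right_inverse mult_2)
      moreover have "2 \<noteq> (0 :: 'k)"
      proof
        assume "2 = (0 :: 'k)"
        moreover have "2 dvd (fact b :: nat)"
          by (rule dvd_fact) (use st b in auto)
        then obtain r where "fact b = 2 * (r :: nat)" by (auto simp: dvd_def)
        ultimately show False using f by (simp del: of_nat_fact)
      qed
      ultimately show ?thesis using False by (simp add: altsign_def)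
    qed
  qed
  then show "v \<in> alternating c b n" using vc unfolding alternating_def by blast
next
  fix v :: "nat multiset list \<Rightarrow> 'k" assume v: "v \<in> alternating c b n"
  have "v (label N (permute_list \<sigma> w)) = of_int (sign \<sigma>) * v (label N w)"
    if "\<sigma> permutes {..<b}" "length w = b" for N w \<sigma>
  proof -
    have "sort (permute_list \<sigma> w) = sort w" using that by (subst sort_eq_iff_mset) simp
    then show ?thesis
      using AbD[OF v, of N w] AbD[OF v, of N "permute_list \<sigma> w"] altsign_permute[of \<sigma> w, where 'a = 'k] that
      by (simp add: mult.assoc)
  qed
  then show "v \<in> obj (SL c b) n" using altern_eq_factI[OF alternating_coord[OF v]] alternating_coord[OF v] by (simp add: obj_SL)
qed

lemma length_filter_sort: "length (filter P (sort w)) = length (filter P (w :: nat list))"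
  by (metis mset_filter mset_sort size_mset)

text \<open>Reordering \<open>w\<close> does not change the number of its letters below
  \<open>i\<close>, so the two signs separate.\<close>

lemma altsign_Cons_sort: "altsign (i # w) = altsign (i # sort w) * altsign w"
  by (cases "distinct w") (simp_all add: altsign_Cons length_filter_sort altsign_sorted, simp add: altsign_def)

section \<open>The Koszul differential on antisymmetric tensors\<close>

lemma koszul_alternating:
  assumes v: "v \<in> alternating c (Suc b) n"
  shows "koszul v \<in> alternating (Suc c) b n"
proof -
  have "koszul v (label N w) = altsign w * koszul v (label N (sort w))" for N w
  proof -
    have "v (label (N - {#i#}) (i # w)) = altsign w * v (label (N - {#i#}) (i # sort w))" for i
    proof -
      have "sort (i # sort w) = sort (i # w)" by (subst sort_eq_iff_mset) simp
      then show ?thesis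
        using AbD[OF v, of "N - {#i#}" "i # w"] AbD[OF v, of "N - {#i#}" "i # sort w"]
        by (simp add: altsign_Cons_sort[of i w] mult.assoc mult.left_commute)
    qed
    then show ?thesis by (simp add: koszul_label sum_distrib_left)
  qed
  then show ?thesis using koszul_in[OF alternating_coord[OF v]] unfolding alternating_def by blast
qed

text \<open>The diagonal has a hypothesis of its own because antisymmetry does not force it to
  vanish in characteristic 2.\<close>

lemma sum_antisymmetric:
  fixes g :: "'a \<Rightarrow> 'a \<Rightarrow> 'b::ab_group_add"
  assumes "finite A" "\<And>i. g i i = 0" "\<And>i j. g i j = - g j i"
  shows "(\<Sum>i\<in>A. \<Sum>j\<in>A. g i j) = 0"
  using assms(1)
proof (induction A)
  case (insert a A)
  have "(\<Sum>i\<in>A. g i a) + (\<Sum>j\<in>A. g a j) = (\<Sum>i\<in>A. g i a + g a i)" by (simp add: sum.distrib)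
  also have "\<dots> = 0" by (rule sum.neutral) (metis assms(3) add.left_inverse)
  finally show ?case using insert assms(2) by (simp add: sum.distrib add.assoc add.commute add.left_commute)
qed simp

text \<open>Taking two letters out of the symmetric factor in either order yields the same monomial,
  but opposite signs in the exterior factor.\<close>

lemma koszul_koszul:
  assumes v: "v \<in> alternating c (Suc (Suc b)) n"
  shows "koszul (koszul v) = 0"
proof (rule coord_space_labels_eqI)
  show "koszul (koszul v) \<in> coord_space (labels (Suc (Suc c)) b n)" using alternating_coord[OF v] koszul_in by blast
  show "0 \<in> coord_space (labels (Suc (Suc c)) b n)" by (rule fun_vs.subspace_0[OF subspace_coord_space])
  fix N w
  \<comment> \<open>Diagonal terms have a repeated letter and are 0, also if \<open>i\<close> occurs
    twice in \<open>N\<close>. Setting them to 0 lets both indices range over the same set.\<close>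
  define g where "g i j = (if i = j then 0 else v (label (N - {#i#} - {#j#}) (j # i # w)))" for i j
  have "koszul (koszul v) (label N w) = (\<Sum>i\<in>set_mset N. \<Sum>j\<in>set_mset (N - {#i#}). v (label (N - {#i#} - {#j#}) (j # i # w)))"
    by (simp add: koszul_label)
  also have "\<dots> = (\<Sum>i\<in>set_mset N. \<Sum>j\<in>set_mset N. g i j)"
  proof (rule sum.cong[OF refl])
    fix i assume i: "i \<in># N"
    have "(\<Sum>j\<in>set_mset (N - {#i#}). v (label (N - {#i#} - {#j#}) (j # i # w))) = (\<Sum>j\<in>set_mset (N - {#i#}). g i j)"
      by (rule sum.cong) (use alternating_not_distinct[OF v] in \<open>auto simp: g_def\<close>)
    also have "\<dots> = (\<Sum>j\<in>set_mset N. g i j)"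
      by (rule sum.mono_neutral_left) (auto simp: g_def dest: in_diffD, metis insert_noteq_member insert_DiffM i)
    finally show "(\<Sum>j\<in>set_mset (N - {#i#}). v (label (N - {#i#} - {#j#}) (j # i # w))) = (\<Sum>j\<in>set_mset N. g i j)" .
  qed
  also have "\<dots> = 0"
  proof (rule sum_antisymmetric)
    fix i j show "g i j = - g j i"
    proof (cases "distinct (j # i # w)")
      case True
      have "altsign (j # i # w) = - (altsign (i # j # w) :: 'a)"
        using True word_sign_swap[of i j "[]" w] by (auto simp: altsign_def)
      moreover have "sort (j # i # w) = sort (i # j # w)" by (subst sort_eq_iff_mset) simp
      ultimately show ?thesis
        using AbD[OF v, of _ "j # i # w"] AbD[OF v, of _ "i # j # w"] True
        by (simp add: g_def add_mset_commute del: sort_key_simps)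
    next
      case False
      then have "\<not> distinct (i # j # w)" by auto
      then have "v (label M (j # i # w)) = 0" "v (label M (i # j # w)) = 0" for M
        using False alternating_not_distinct[OF v] by blast+
      then show ?thesis by (simp only: g_def if_cancel minus_zero)
    qed
  qed (auto simp: g_def)
  finally show "koszul (koszul v) (label N w) = 0 (label N w)" by simp
qed

text \<open>
  The contraction of the Koszul complex moves the smallest letter of a basis vector from the
  symmetric into the exterior factor. It is not natural.
\<close>

definition min_letter :: "nat multiset \<Rightarrow> nat list \<Rightarrow> nat" where
  "min_letter N w = Min (set_mset N \<union> set w)"

definition contraction :: "nat \<Rightarrow> nat \<Rightarrow> nat \<Rightarrow> (nat multiset list \<Rightarrow> 'k::field) \<Rightarrow> (nat multiset list \<Rightarrow> 'k)" where
  "contraction c b n v = (\<lambda>L. if L \<in> labels c (Suc b) n then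
     (let N = hd L; w = drop c (lword L); i = min_letter N w
      in if i \<in> set w then altsign w * v (label (add_mset i N) (tl (sort w))) else 0) else 0)"

lemma hd_label [simp]: "hd (label N w) = N"
  by (simp add: label_def)

lemma drop_lword_label: "size N = c \<Longrightarrow> drop c (lword (label N w)) = w"
proof -
  assume "size N = c"
  then have "length (sorted_list_of_multiset N) = c" by (metis mset_sorted_list_of_multiset size_mset)
  then show ?thesis by (simp add: lword_label)
qed

text \<open>If the least letter lies in \<open>w\<close>, it is the head of \<open>sort w\<close>,
  and \<open>tl (sort w)\<close> drops it. So the coordinate is read at the label in which that
  letter is still in the symmetric factor.\<close>

lemma contraction_label:
  assumes "label N w \<in> labels c (Suc b) n"
  shows "contraction c b n v (label N w) = (if min_letter N w \<in> set w
    then altsign w * v (label (add_mset (min_letter N w) N) (tl (sort w))) else 0)"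
  using assms by (simp add: contraction_def drop_lword_label Let_def)

lemma contraction_outside: "L \<notin> labels c (Suc b) n \<Longrightarrow> contraction c b n v L = 0"
  by (simp add: contraction_def)

lemma contraction_alternating: "contraction c b n v \<in> alternating c (Suc b) n"
  unfolding alternating_def
proof (intro CollectI conjI allI)
  show "contraction c b n v \<in> coord_space (labels c (Suc b) n)" by (simp add: contraction_def coord_space_def)
  fix N w
  show "contraction c b n v (label N w) = altsign w * contraction c b n v (label N (sort w))"
  proof (cases "label N w \<in> labels c (Suc b) n")
    case False
    then have "label N (sort w) \<notin> labels c (Suc b) n" by simp
    then show ?thesis using False contraction_outside by (metis mult_zero_right)
  next
    case True
    then have s: "label N (sort w) \<in> labels c (Suc b) n" by simp
    have "min_letter N (sort w) = min_letter N w" by (simp add: min_letter_def)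
    moreover have "sort (sort w) = sort w" by (simp add: sort_eq_iff_mset)
    moreover have "altsign w = (0 :: 'a) \<or> altsign (sort w) = (1 :: 'a)"
      by (cases "distinct w") (simp_all add: altsign_sorted, simp add: altsign_def)
    ultimately show ?thesis unfolding contraction_label[OF True] contraction_label[OF s] by auto
  qed
qed

text \<open>For generators of the hook functors, this leaves only labels whose exterior factor
  contains the least letter.\<close>

lemma contraction_nonzero:
  assumes "contraction c b n v (label N w) \<noteq> 0"
  shows "min_letter N w \<in> set w"
proof -
  have "label N w \<in> labels c (Suc b) n" using assms contraction_outside by blast
  then show ?thesis using assms contraction_label[of N w c b n v] by (auto split: if_splits)
qed

lemma alternating_eqI:
  assumes "v \<in> alternating c b n" "v' \<in> alternating c b n"
    and "\<And>N w. label N w \<in> labels c b n \<Longrightarrow> sorted w \<Longrightarrow> distinct w \<Longrightarrow> v (label N w) = v' (label N w)"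
  shows "v = v'"
proof (rule coord_space_labels_eqI[OF alternating_coord[OF assms(1)] alternating_coord[OF assms(2)]])
  fix N w assume L: "label N w \<in> labels c b n"
  show "v (label N w) = v' (label N w)"
  proof (cases "distinct w")
    case True
    then have "v (label N (sort w)) = v' (label N (sort w))" using L by (intro assms(3)) auto
    then show ?thesis using AbD[OF assms(1), of N w] AbD[OF assms(2), of N w] by simp
  next
    case False
    then show ?thesis using alternating_not_distinct assms(1,2) by metis
  qed
qed

text \<open>At a label whose least letter lies only in the symmetric factor, the Koszul sum has just
  the term of that letter. If the least letter lies in the exterior factor, the cycle condition at
  the label with that letter moved back identifies the Koszul sum with the value of
  \<open>v\<close>.\<close>

lemma koszul_contraction:
  assumes v: "v \<in> alternating (Suc c) b n" and k: "b = 0 \<or> koszul v = 0"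
  shows "koszul (contraction c b n v) = v"
proof (rule alternating_eqI[OF koszul_alternating[OF contraction_alternating] v])
  fix N w assume L: "label N w \<in> labels (Suc c) b n" and w: "sorted w" "distinct w"
  define x where "x = contraction c b n v"
  define i0 where "i0 = min_letter N w"
  have xA: "x \<in> alternating c (Suc b) n" unfolding x_def by (rule contraction_alternating)
  have Nne: "set_mset N \<union> set w \<noteq> {}" using L by auto
  have fin: "finite (set_mset N \<union> set w)" by simp
  have i0: "i0 \<in> set_mset N \<union> set w" unfolding i0_def min_letter_def using Min_in[OF fin Nne] .
  have le: "i0 \<le> j" if "j \<in> set_mset N \<union> set w" for j
    unfolding i0_def min_letter_def using that fin by (intro Min_le)
  have m: "min_letter (N - {#i#}) (i # w) = i0" if "i \<in># N" for i
  proof -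
    have "set_mset (N - {#i#}) \<union> set (i # w) = set_mset N \<union> set w"
      using that by (auto dest: in_diffD) (metis insert_DiffM insert_noteq_member)
    then show ?thesis by (simp add: i0_def min_letter_def)
  qed
  have L': "label (N - {#i#}) (i # w) \<in> labels c (Suc b) n" if "i \<in># N" for i
    using L that by (auto simp: size_Diff_singleton dest: in_diffD)
  have xv: "x (label (N - {#i#}) (i # w)) = (if i0 \<in> set (i # w)
      then altsign (i # w) * v (label (add_mset i0 (N - {#i#})) (tl (sort (i # w)))) else 0)"
    if "i \<in># N" for i
    unfolding x_def contraction_label[OF L'[OF that]] m[OF that] ..
  show "koszul (contraction c b n v) (label N w) = v (label N w)"
  proof (cases "i0 \<in> set w")
    case True
    then obtain w' where ww: "w = i0 # w'"
    proof (cases w)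
      case (Cons j w')
      then have "j \<le> i0" using w True by auto
      then have "j = i0" using le[of j] Cons by simp
      then show ?thesis using Cons that by blast
    qed simp
    have w': "sorted w'" "distinct w'" "i0 \<notin> set w'" using w ww by auto
    have b: "b \<noteq> 0" using L ww by auto
    then have kv: "koszul v = 0" using k by blast
    have gt: "i0 < i" if "i \<in># N" "i \<noteq> i0" for i using le[of i] that by simp
    let ?T = "\<lambda>i. v (label (add_mset i0 (N - {#i#})) (i # w'))"
    \<comment> \<open>Sorting \<open>i # w\<close> moves \<open>i\<close> past \<open>i0\<close> as
      well, unlike sorting \<open>i # w'\<close>; hence the sign. If \<open>i\<close> is in
      \<open>w\<close>, a repeated letter makes the value 0.\<close>
    have term1: "x (label (N - {#i#}) (i # w)) = (if i = i0 then 0 else - ?T i)" if i: "i \<in># N" for i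
    proof (cases "i \<in> set w")
      case True
      then have "\<not> distinct (i # w)" by simp
      moreover have "i = i0 \<or> \<not> distinct (i # w')" using True ww by auto
      ultimately show ?thesis using alternating_not_distinct[OF xA] alternating_not_distinct[OF v] by auto
    next
      case False
      then have ne: "i \<noteq> i0" "i \<notin> set w'" using ww by auto
      have lt: "i0 < i" using gt[OF i ne(1)] .
      have s: "sort (i # w) = i0 # sort (i # w')"
      proof -
        have "sort (i # w) = sort (i0 # i # w')" by (subst sort_eq_iff_mset) (simp add: ww)
        also have "\<dots> = insort i0 (sort (i # w'))" by simp
        also have "\<dots> = i0 # sort (i # w')"
          by (rule insort_is_Cons) (use lt w ww in \<open>auto simp: set_insort_key\<close>)
        finally show ?thesis .
      qed
      have a: "altsign w = (1 :: 'a)" "altsign w' = (1 :: 'a)" using w w' by (auto intro: altsign_sorted)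
      have "altsign (i # w) = - (altsign (i # w') :: 'a)"
        unfolding altsign_Cons[of i w] altsign_Cons[of i w'] a using ne lt by (simp add: ww)
      then have "x (label (N - {#i#}) (i # w)) = - (altsign (i # w') * v (label (add_mset i0 (N - {#i#})) (sort (i # w'))))"
        unfolding xv[OF i] s using True by simp
      also have "\<dots> = - ?T i" using AbD[OF v, of "add_mset i0 (N - {#i#})" "i # w'"] by simp
      finally show ?thesis using ne by simp
    qed
    \<comment> \<open>The cycle condition, evaluated with \<open>i0\<close> moved back into the
      symmetric factor, has the wanted value as its \<open>i0\<close> term.\<close>
    have "0 = koszul v (label (add_mset i0 N) w')" using kv by simp
    also have "\<dots> = (\<Sum>i\<in>insert i0 (set_mset N - {i0}). v (label (add_mset i0 N - {#i#}) (i # w')))"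
      unfolding koszul_label by simp
    also have "\<dots> = v (label N w) + (\<Sum>i\<in>set_mset N - {i0}. v (label (add_mset i0 N - {#i#}) (i # w')))"
      by (subst sum.insert) (auto simp: ww)
    also have "(\<Sum>i\<in>set_mset N - {i0}. v (label (add_mset i0 N - {#i#}) (i # w'))) = (\<Sum>i\<in>set_mset N - {i0}. ?T i)"
      by (rule sum.cong) auto
    finally have "v (label N w) = - (\<Sum>i\<in>set_mset N - {i0}. ?T i)" by (simp add: eq_neg_iff_add_eq_0)
    moreover have "koszul x (label N w) = (\<Sum>i\<in>set_mset N - {i0}. - ?T i)"
      unfolding koszul_label by (rule sum.mono_neutral_cong_right) (auto simp: term1)
    ultimately show ?thesis by (simp add: x_def sum_negf)
  next
    case False
    then have iN: "i0 \<in># N" using i0 by simp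
    \<comment> \<open>The contraction is nonzero only if the exterior word contains
      \<open>i0\<close>, and only the choice \<open>i = i0\<close> puts it there.\<close>
    have "koszul x (label N w) = (\<Sum>i\<in>set_mset N. if i = i0 then v (label N w) else 0)"
      unfolding koszul_label
    proof (rule sum.cong[OF refl])
      fix i assume i: "i \<in># N"
      have s: "sort (i0 # w) = i0 # w" using w le by (intro sorted_sort_id) auto
      have a: "altsign (i0 # w) = (1 :: 'a)"
        by (rule altsign_sorted) (use w le False in auto)
      show "x (label (N - {#i#}) (i # w)) = (if i = i0 then v (label N w) else 0)"
        unfolding xv[OF i] using False a s iN by auto
    qed
    then show ?thesis using iN by (simp add: x_def)
  qed
qed

text \<open>The tensor product of the monomial \<open>M\<close> and the wedge product of the letters
  of \<open>w\<close>, written as an antisymmetric tensor. The factor \<open>altsign w\<close> makes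
  the coefficient at \<open>w\<close> equal to 1 if \<open>w\<close> is distinct.\<close>

definition wedge :: "nat multiset \<Rightarrow> nat list \<Rightarrow> nat multiset list \<Rightarrow> 'k::field" where
  "wedge M w = (\<Sum>u\<in>{u. mset u = mset w}. vscale (altsign u * altsign w) (unit_vec (label M u)))"

lemma finite_mset_eq [simp]: "finite {u. mset u = M}"
  by (rule finite_subset[OF _ finite_lists_length_eq[of "set_mset M" "size M"]]) auto

lemma wedge_label: "wedge M w (label N u) = (if N = M \<and> mset u = mset w then altsign u * altsign w else 0)"
proof -
  have "wedge M w (label N u) = (\<Sum>u'\<in>{u'. mset u' = mset w}. if u' = u then (if N = M then altsign u * altsign w else 0) else 0 :: 'a)"
    unfolding wedge_def fun_sum_apply by (rule sum.cong) (auto simp: unit_vec_apply vscale_apply)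
  then show ?thesis by simp
qed

lemma wedge_coord: "label M w \<in> labels c b n \<Longrightarrow> wedge M w \<in> coord_space (labels c b n)"
proof -
  assume L: "label M w \<in> labels c b n"
  have "label M u \<in> labels c b n" if "mset u = mset w" for u
    using L mset_eq_setD[OF that] mset_eq_length[OF that] by simp
  then show ?thesis unfolding wedge_def
    by (intro sum_in_coord_space fun_vs.subspace_scale[OF subspace_coord_space]) auto
qed

lemma wedge_alternating:
  assumes "label M w \<in> labels c b n" "distinct w"
  shows "wedge M w \<in> alternating c b n"
  unfolding alternating_def
proof (intro CollectI conjI allI wedge_coord assms)
  fix N u
  show "wedge M w (label N u) = (altsign u * wedge M w (label N (sort u)) :: 'a)"
  proof (cases "mset u = mset w")
    case True
    then have "distinct u" using assms(2) by (metis mset_eq_imp_distinct_iff)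
    then have "altsign (sort u) = (1 :: 'a)" by (intro altsign_sorted) auto
    then show ?thesis by (simp add: wedge_label)
  qed (simp add: wedge_label)
qed

text \<open>The set keeps the condition that the coordinate of \<open>v\<close> is nonzero: if
  \<open>v\<close> is a contraction, only some wedges occur, and this reduces the generators of the
  hook functors later.\<close>

lemma alternating_span:
  fixes v :: "nat multiset list \<Rightarrow> 'k::field"
  assumes v: "v \<in> alternating c b n"
  shows "v \<in> fun_vs.span {wedge M w | M w. label M w \<in> labels c b n \<and> sorted w \<and> distinct w \<and> v (label M w) \<noteq> 0}"
    (is "v \<in> fun_vs.span ?S")
proof -
  define B where "B = {L \<in> labels c b n. sorted (drop c (lword L)) \<and> distinct (drop c (lword L)) \<and> v L \<noteq> 0}"
  define x where "x = (\<Sum>L\<in>B. vscale (v L) (wedge (hd L) (drop c (lword L))))"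
  have finB: "finite B" unfolding B_def by simp
  have B: "\<exists>M w. L = label M w \<and> label M w \<in> labels c b n \<and> sorted w \<and> distinct w \<and> v (label M w) \<noteq> 0 \<and>
      hd L = M \<and> drop c (lword L) = w" if "L \<in> B" for L
  proof -
    have "L \<in> labels c b n" using that by (simp add: B_def)
    then obtain M w where "L = label M w" "size M = c" using labels_iff[of L c b n] by blast
    then show ?thesis using that drop_lword_label[of M c w] unfolding B_def by auto
  qed
  have in_S: "(wedge (hd L) (drop c (lword L)) :: _ \<Rightarrow> 'k) \<in> ?S" if L: "L \<in> B" for L
  proof -
    obtain M w where "label M w \<in> labels c b n" "sorted w" "distinct w" "v (label M w) \<noteq> 0"
      "hd L = M" "drop c (lword L) = w" using B[OF L] by blast
    then show ?thesis by blast
  qed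
  have "x \<in> coord_space (labels c b n)"
    unfolding x_def
  proof (intro sum_in_coord_space fun_vs.subspace_scale[OF subspace_coord_space])
    fix L assume "L \<in> B"
    then obtain M w where M: "label M w \<in> labels c b n" "hd L = M" "drop c (lword L) = w" using B by blast
    show "wedge (hd L) (drop c (lword L)) \<in> coord_space (labels c b n)" unfolding M(2,3) by (rule wedge_coord[OF M(1)])
  qed
  moreover have "x (label N u) = v (label N u)" if L: "label N u \<in> labels c b n" for N u
  proof -
    have L': "label N (sort u) \<in> labels c b n" using L by simp
    have dw: "drop c (lword (label N (sort u))) = sort u" using L by (intro drop_lword_label) simp
    have "x (label N u) = (\<Sum>L\<in>B. v L * wedge (hd L) (drop c (lword L)) (label N u))"
      by (simp add: x_def fun_sum_apply vscale_apply)
    also have "\<dots> = (\<Sum>L\<in>B. if L = label N (sort u) then altsign u * v L else 0)"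
    proof (rule sum.cong[OF refl])
      fix L assume "L \<in> B"
      then obtain M w where M: "L = label M w" "sorted w" "distinct w" "hd L = M" "drop c (lword L) = w"
        using B by blast
      have "mset u = mset w \<longleftrightarrow> w = sort u" using sort_eq_iff_mset[of w u] sorted_sort_id[OF M(2)] by auto
      then show "v L * wedge (hd L) (drop c (lword L)) (label N u) = (if L = label N (sort u) then altsign u * v L else 0)"
        unfolding M(4,5) wedge_label using M(1) altsign_sorted[OF M(2,3)] by (auto simp: mult.commute)
    qed
    also have "\<dots> = (if label N (sort u) \<in> B then altsign u * v (label N (sort u)) else 0)"
      using finB by simp
    also have "\<dots> = altsign u * v (label N (sort u))"
    proof (cases "distinct u")
      case True
      then show ?thesis using L' dw by (auto simp: B_def)
    qed (simp add: altsign_def)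
    also have "\<dots> = v (label N u)" using AbD[OF v, of N u] by simp
    finally show ?thesis .
  qed
  ultimately have "x = v" using coord_space_labels_eqI[OF _ alternating_coord[OF v]] by blast
  moreover have "x \<in> fun_vs.span ?S"
    unfolding x_def by (intro fun_vs.span_sum fun_vs.span_scale fun_vs.span_base in_S)
  ultimately show ?thesis by simp
qed

lemma AbI:
  assumes "v \<in> coord_space (labels c b n)" "\<And>N w. v (label N w) = altsign w * v (label N (sort w))"
  shows "v \<in> alternating c b n"
  using assms unfolding alternating_def by blast

lemma subspace_alternating: "fun_vs.subspace (alternating c b n)"
  unfolding fun_vs.subspace_def
proof (intro conjI ballI allI)
  show "0 \<in> alternating c b n" by (rule AbI[OF fun_vs.subspace_0[OF subspace_coord_space]]) simp
next
  fix x y :: "nat multiset list \<Rightarrow> 'a" assume x: "x \<in> alternating c b n" and y: "y \<in> alternating c b n"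
  show "x + y \<in> alternating c b n"
  proof (rule AbI)
    fix N w show "(x + y) (label N w) = altsign w * (x + y) (label N (sort w))"
      using AbD[OF x, of N w] AbD[OF y, of N w] by (simp add: distrib_left)
  qed (use fun_vs.subspace_add[OF subspace_coord_space] alternating_coord x y in blast)
next
  fix a and x :: "nat multiset list \<Rightarrow> 'a" assume x: "x \<in> alternating c b n"
  show "vscale a x \<in> alternating c b n"
  proof (rule AbI)
    fix N w show "vscale a x (label N w) = altsign w * vscale a x (label N (sort w))"
      using AbD[OF x, of N w] by (simp add: vscale_apply)
  qed (use fun_vs.subspace_scale[OF subspace_coord_space] alternating_coord x in blast)
qed

lemma alternating_eq_span: "alternating c b n = fun_vs.span {wedge M w | M w. label M w \<in> labels c b n \<and> sorted w \<and> distinct w}"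
  (is "_ = fun_vs.span ?S")
proof (intro equalityI subsetI)
  fix v :: "nat multiset list \<Rightarrow> 'a" assume "v \<in> alternating c b n"
  from alternating_span[OF this] show "v \<in> fun_vs.span ?S"
    by (rule subsetD[OF fun_vs.span_mono, rotated]) blast
next
  fix v :: "nat multiset list \<Rightarrow> 'a" assume "v \<in> fun_vs.span ?S"
  moreover have "fun_vs.span ?S \<subseteq> alternating c b n"
    by (rule fun_vs.span_minimal[OF _ subspace_alternating]) (auto simp: wedge_alternating)
  ultimately show "v \<in> alternating c b n" by blast
qed

section \<open>Hook Schur functors\<close>

text \<open>By \<open>hook_schur_eq\<close> this is the Schur functor of the hook (m + 1, 1^c), of
  degree c + m + 1. The source is given by \<open>alternating\<close> rather than \<open>SL\<close>,
  since the exterior degree m + 1 may equal p.\<close>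

definition hookf :: "nat \<Rightarrow> nat \<Rightarrow> (nat multiset list, 'k::field) spf" where
  "hookf c m = \<lparr>obj = \<lambda>n. koszul ` alternating c (Suc m) n, coef = coef (SI (Suc c) m)\<rparr>"

lemma coef_hookf [simp]: "coef (hookf c m) = coef (SI (Suc c) m)"
  by (simp add: hookf_def)

lemma obj_hookf: "obj (hookf c m) n = koszul ` alternating c (Suc m) n"
  by (simp add: hookf_def)

text \<open>Exactness of the Koszul complex at S^(c+1) \<otimes> \<Lambda>^m. The disjunct
  \<open>m = 0\<close> marks the end of the complex, where no exterior letter is left to
  move.\<close>

lemma obj_hookf_eq: "obj (hookf c m) n = {v \<in> alternating (Suc c) m n. m = 0 \<or> koszul v = 0}"
proof (intro equalityI subsetI)
  fix v :: "nat multiset list \<Rightarrow> 'a" assume "v \<in> obj (hookf c m) n"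
  then obtain x where x: "x \<in> alternating c (Suc m) n" "v = koszul x" by (auto simp: obj_hookf)
  have "koszul v = 0" if m: "m = Suc m'" for m' using koszul_koszul x unfolding m by blast
  then show "v \<in> {v \<in> alternating (Suc c) m n. m = 0 \<or> koszul v = 0}" using x koszul_alternating not0_implies_Suc by blast
next
  fix v :: "nat multiset list \<Rightarrow> 'a" assume v: "v \<in> {v \<in> alternating (Suc c) m n. m = 0 \<or> koszul v = 0}"
  then have "v = koszul (contraction c m n v)" using koszul_contraction[of v c m n] by simp
  then show "v \<in> obj (hookf c m) n" unfolding obj_hookf using contraction_alternating by blast
qed

lemma obj_hookf_contraction:
  assumes "v \<in> obj (hookf c m) n"
  shows "v = koszul (contraction c m n v)"
  using assms koszul_contraction[of v c m n] unfolding obj_hookf_eq by simp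

text \<open>
  By the exactness of the Koszul complex, \<open>hookf c m\<close> is a kernel as well as an image. The first
  description makes it a subfunctor without any reference to $S^c \otimes \Lambda^{m+1}$.
\<close>

lemma strict_poly_functor_hookf:
  assumes f: "of_nat (fact m) \<noteq> (0 :: 'k::field)"
  shows "strict_poly_functor (Suc c + m) (hookf c m :: (nat multiset list, 'k) spf)"
proof -
  let ?J = "SL (Suc c) m :: (nat multiset list, 'k) spf"
  let ?U = "\<lambda>n. koszul ` alternating c (Suc m) n :: (nat multiset list \<Rightarrow> 'k) set"
  have U: "?U n = {v \<in> obj ?J n. m = 0 \<or> koszul v = 0}" for n
    using obj_hookf_eq[of c m n, where 'a = 'k] unfolding obj_hookf SL_eq_alternating[OF f] .
  have "strict_poly_functor (Suc c + m) \<lparr>obj = ?U, coef = coef ?J\<rparr>"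
  proof (rule strict_poly_subfunctor[OF strict_poly_functor_SL])
    fix n
    show "fun_vs.subspace (?U n)" by (rule fun_vsp.linear_subspace_image[OF lin_koszul subspace_alternating])
    show "?U n \<subseteq> obj ?J n" unfolding U by blast
  next
    fix n' n \<alpha> v assume a: "\<alpha> \<in> expos n' n (Suc c + m)" and v: "v \<in> ?U n"
    have vJ: "v \<in> obj ?J n" and k: "m = 0 \<or> koszul v = 0" using v unfolding U by blast+
    have "coef ?J n' n \<alpha> v \<in> obj ?J n'" using strict_coef_in[OF strict_poly_functor_SL a vJ] .
    moreover have "m = 0 \<or> koszul (coef ?J n' n \<alpha> v) = 0"
    proof (cases m)
      case (Suc m')
      have "v \<in> coord_space (labels (Suc c) (Suc m') n)" using vJ unfolding obj_SL Suc by blast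
      then have "koszul (coef ?J n' n \<alpha> v) = coef (SI (Suc (Suc c)) m') n' n \<alpha> (koszul v)"
        unfolding Suc coef_SL by (rule koszul_natural)
      also have "koszul v = 0" using k Suc by simp
      also have "coef (SI (Suc (Suc c)) m') n' n \<alpha> (0 :: _ \<Rightarrow> 'k) = 0"
        by (rule fun_vsp.linear_0[OF lin_SI_coef])
      finally show ?thesis ..
    qed simp
    ultimately show "coef ?J n' n \<alpha> v \<in> ?U n'" unfolding U by blast
  qed
  then show ?thesis by (simp add: hookf_def)
qed

section \<open>Schur functors of hooks as images of Koszul differentials\<close>

lemma conjugate_hook: "conjugate (Suc m # replicate c 1) = Suc c # replicate m 1"
proof (rule nth_equalityI)
  have "foldr max (replicate c 1) 0 \<le> (1 :: nat)" by (induction c) auto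
  then have f: "foldr max (Suc m # replicate c 1) 0 = Suc m" by simp
  show "length (conjugate (Suc m # replicate c 1)) = length (Suc c # replicate m 1)"
    unfolding conjugate_def f by simp
  fix i assume "i < length (conjugate (Suc m # replicate c 1))"
  then have i: "i < Suc m" unfolding conjugate_def f by simp
  then have "conjugate (Suc m # replicate c 1) ! i = length (filter (\<lambda>r. i < r) (Suc m # replicate c 1))"
    unfolding conjugate_def f by (simp del: upt_Suc)
  also have "\<dots> = (Suc c # replicate m 1) ! i" using i by (cases i) auto
  finally show "conjugate (Suc m # replicate c 1) ! i = (Suc c # replicate m 1) ! i" .
qed

lemma transpose_replicate_Nil: "List.transpose (xs # replicate c []) = map (\<lambda>x. [x]) xs"
proof (induction xs)
  case Nil
  then show ?case by (induction c) auto
next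
  case (Cons x xs)
  have "concat (map (case_list [] (\<lambda>h t. [h])) (replicate c ([] :: 'a list))) = []"
    "concat (map (case_list [] (\<lambda>h t. [t])) (replicate c ([] :: 'a list))) = []" by (induction c) auto
  moreover have "List.transpose [xs] = map (\<lambda>x. [x]) xs" by (induction xs) auto
  ultimately show ?case by simp
qed

text \<open>In the hook-shaped filling \<open>x\<close> is the corner, \<open>u\<close> the rest of
  the row and \<open>d\<close> the rest of the column.\<close>

lemma transpose_hook: "List.transpose ((x # u) # map (\<lambda>y. [y]) d) = (x # d) # map (\<lambda>y. [y]) u"
proof -
  have "concat (map (case_list [] (\<lambda>h t. [h])) (map (\<lambda>y. [y]) d)) = d"
    "concat (map (case_list [] (\<lambda>h t. [t])) (map (\<lambda>y. [y]) d)) = replicate (length d) []"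
    by (induction d) auto
  then show ?thesis using transpose_replicate_Nil[of u "length d"] by simp
qed

lemma wedge_basis_hook:
  "As \<in> wedge_basis (Suc m # replicate c 1) n \<longleftrightarrow> (\<exists>A d. As = A # map (\<lambda>y. {y}) d \<and> card A = Suc m \<and>
     A \<subseteq> {..<n} \<and> d \<in> words c n)"
proof
  assume "As \<in> wedge_basis (Suc m # replicate c 1) n"
  then have "map card As = Suc m # replicate c 1" "\<forall>A\<in>set As. A \<subseteq> {..<n}" unfolding wedge_basis_def by auto
  then obtain A T where T: "As = A # T" "card A = Suc m" "map card T = replicate c 1"
    "\<forall>A\<in>set (A # T). A \<subseteq> {..<n}" by (cases As) auto
  have "{the_elem B} = B" if "B \<in> set T" for B
  proof -
    have "card B \<in> set (map card T)" using that by simp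
    then have "card B = 1" unfolding T(3) by simp
    then show ?thesis using card_1_singletonE by force
  qed
  then have "T = map (\<lambda>y. {y}) (map the_elem T)" by (simp add: map_idI comp_def)
  moreover have "map the_elem T \<in> words c n"
  proof -
    have "length T = c" using arg_cong[OF T(3), of length] by simp
    moreover have "the_elem B < n" if "B \<in> set T" for B
      using T(4) that \<open>B \<in> set T \<Longrightarrow> {the_elem B} = B\<close> by (metis insertI1 lessThan_iff list.set_intros(2) subsetD)
    ultimately show ?thesis by (auto simp: words_def)
  qed
  ultimately show "\<exists>A d. As = A # map (\<lambda>y. {y}) d \<and> card A = Suc m \<and> A \<subseteq> {..<n} \<and> d \<in> words c n"
    using T by (metis list.set_intros(1))
next
  assume "\<exists>A d. As = A # map (\<lambda>y. {y}) d \<and> card A = Suc m \<and> A \<subseteq> {..<n} \<and> d \<in> words c n"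
  then show "As \<in> wedge_basis (Suc m # replicate c 1) n"
    unfolding wedge_basis_def words_def by (auto simp: comp_def map_replicate_const)
qed

lemma finite_wedge_basis_hook: "finite (wedge_basis (Suc m # replicate c 1) n)"
proof (rule finite_subset)
  show "wedge_basis (Suc m # replicate c 1) n \<subseteq> (\<lambda>(A, d). A # map (\<lambda>y. {y}) d) ` (Pow {..<n} \<times> words c n)"
    using wedge_basis_hook by (auto simp: image_iff)
qed simp

lemma blocks_hook:
  assumes "length u = Suc m" "length d = c"
  shows "blocks (Suc m # replicate c 1) (u @ d) = u # map (\<lambda>y. [y]) d"
  using assms blocks_replicate_1[of d c] by simp

lemma lin_sym_epi: "lin (sym_epi \<mu> n)"
  unfolding sym_epi_def by (rule lin_lin_ext)

lemma lin_row_to_column: "lin (row_to_column \<mu> n)"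
  unfolding row_to_column_def by (rule lin_lin_ext)

lemma lin_wedge_mono: "lin (wedge_mono \<mu> n)"
  unfolding wedge_mono_def by (rule lin_lin_ext)

text \<open>In the column reading of the hook, the first letter of the row joins the leg in the
  first column, while the other letters of the row stand alone. So symmetrizing the columns
  multiplies the first exterior letter into the symmetric factor, which is the Koszul
  differential.\<close>

lemma hook_map_unit:
  fixes A :: "nat set"
  assumes A: "card A = Suc m" "A \<subseteq> {..<n}" and d: "d \<in> words c n"
  defines "\<mu> \<equiv> Suc m # replicate c 1"
  shows "comp_family (sym_epi (conjugate \<mu>)) (comp_family (row_to_column \<mu>) (wedge_mono \<mu>)) n
      (unit_vec (A # map (\<lambda>y. {y}) d)) = (koszul (wedge (mset d) (sorted_list_of_set A)) :: _ \<Rightarrow> 'k::field)"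
proof -
  let ?As = "A # map (\<lambda>y. {y}) d"
  have fA: "finite A" using A finite_subset by blast
  have s: "sum_list \<mu> = Suc m + c" by (simp add: \<mu>_def sum_list_replicate)
  have ld: "length d = c" using d by (simp add: words_def)
  let ?U = "{u. mset u = mset (sorted_list_of_set A)}"
  have mset_iff: "mset u = mset (sorted_list_of_set A) \<longleftrightarrow> length u = Suc m \<and> set u = A" for u
  proof
    assume "mset u = mset (sorted_list_of_set A)"
    then show "length u = Suc m \<and> set u = A"
      using mset_eq_length[of u "sorted_list_of_set A"] mset_eq_setD[of u "sorted_list_of_set A"] fA A by simp
  next
    assume u: "length u = Suc m \<and> set u = A"
    then have "distinct u" using A by (simp add: card_distinct)
    then show "mset u = mset (sorted_list_of_set A)"
      using u fA set_eq_iff_mset_eq_distinct[of u "sorted_list_of_set A"] by simp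
  qed
  have Ued: "{I \<in> words (Suc m + c) n. map set (blocks \<mu> I) = ?As} = (\<lambda>u. u @ d) ` ?U"
  proof (intro equalityI subsetI)
    fix I assume "I \<in> {I \<in> words (Suc m + c) n. map set (blocks \<mu> I) = ?As}"
    then have I: "I \<in> words (Suc m + c) n" "map set (blocks \<mu> I) = ?As" by auto
    obtain u e where u: "I = u @ e" "u \<in> words (Suc m) n" "e \<in> words c n" using I(1) by (rule word_split)
    have b: "blocks \<mu> I = u # map (\<lambda>y. [y]) e"
      unfolding u(1) \<mu>_def by (rule blocks_hook) (use u in \<open>auto simp: words_def\<close>)
    have "set u = A" "map (\<lambda>y. {y}) e = map (\<lambda>y. {y}) d" using I(2) unfolding b by (auto simp: comp_def)
    moreover have "inj (map (\<lambda>y::nat. {y}))" by (intro inj_mapI) (auto simp: inj_def)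
    ultimately have "set u = A" "e = d" by (auto dest: injD)
    then show "I \<in> (\<lambda>u. u @ d) ` ?U" using u mset_iff by (auto simp: words_def)
  next
    fix I assume "I \<in> (\<lambda>u. u @ d) ` ?U"
    then obtain u where u: "I = u @ d" "length u = Suc m" "set u = A" using mset_iff by auto
    have "blocks \<mu> I = u # map (\<lambda>y. [y]) d" unfolding u(1) \<mu>_def using blocks_hook u(2) ld by blast
    then show "I \<in> {I \<in> words (Suc m + c) n. map set (blocks \<mu> I) = ?As}"
      using u A d by (auto simp: words_def comp_def)
  qed
  have "wedge_mono \<mu> n (unit_vec ?As) =
     (\<Sum>I\<in>{I \<in> words (Suc m + c) n. map set (blocks \<mu> I) = ?As}. vscale (block_sign \<mu> I) (unit_vec I :: _ \<Rightarrow> 'k))"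
    unfolding wedge_mono_def s
    by (rule lin_ext_unit) (use finite_wedge_basis_hook wedge_basis_hook A d in \<open>auto simp: \<mu>_def\<close>)
  also have "\<dots> = (\<Sum>u\<in>?U. vscale (block_sign \<mu> (u @ d)) (unit_vec (u @ d)))"
    unfolding Ued by (subst sum.reindex) (auto simp: inj_on_def)
  also have "\<dots> = (\<Sum>u\<in>?U. vscale (altsign u) (unit_vec (u @ d)))"
  proof (rule sum.cong[OF refl])
    fix u assume "u \<in> ?U"
    then have u: "length u = Suc m" "set u = A" using mset_iff by auto
    have "distinct u" using u A by (simp add: card_distinct)
    moreover have "prod_list (map word_sign (map (\<lambda>y. [y]) d)) = (1 :: 'k)"
      by (induction d) (auto simp: word_sign_Cons)
    moreover have "blocks \<mu> (u @ d) = u # map (\<lambda>y. [y]) d" unfolding \<mu>_def using blocks_hook u(1) ld by blast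
    ultimately have "block_sign \<mu> (u @ d) = (altsign u :: 'k)"
      by (simp add: block_sign_def altsign_def)
    then show "vscale (block_sign \<mu> (u @ d)) (unit_vec (u @ d) :: _ \<Rightarrow> 'k) = vscale (altsign u) (unit_vec (u @ d))" by simp
  qed
  finally have 1: "wedge_mono \<mu> n (unit_vec ?As) = (\<Sum>u\<in>?U. vscale (altsign u) (unit_vec (u @ d) :: _ \<Rightarrow> 'k))" .
  let ?g = "\<lambda>v :: nat list \<Rightarrow> 'k. sym_epi (conjugate \<mu>) n (row_to_column \<mu> n v)"
  have lg: "lin ?g" by (rule lin_compose[OF lin_row_to_column lin_sym_epi])
  have "?g (unit_vec (u @ d)) = koszul (unit_vec (label (mset d) u))" if "u \<in> ?U" for u
  proof -
    have u: "length u = Suc m" "set u = A" using that mset_iff by auto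
    then obtain x t where x: "u = x # t" "length t = m" by (cases u) auto
    have w: "u @ d \<in> words (Suc m + c) n" using u A d by (auto simp: words_def)
    have b: "blocks \<mu> (u @ d) = u # map (\<lambda>y. [y]) d" unfolding \<mu>_def using blocks_hook u(1) ld by blast
    have "row_to_column \<mu> n (unit_vec (u @ d)) = (unit_vec (concat (List.transpose (blocks \<mu> (u @ d)))) :: _ \<Rightarrow> 'k)"
      unfolding row_to_column_def s by (rule lin_ext_unit) (use w in auto)
    also have "concat (List.transpose (blocks \<mu> (u @ d))) = (x # d) @ t"
      unfolding b unfolding x(1) transpose_hook by simp
    finally have r: "row_to_column \<mu> n (unit_vec (u @ d)) = (unit_vec ((x # d) @ t) :: _ \<Rightarrow> 'k)" .
    have w': "(x # d) @ t \<in> words (Suc c + m) n" using w x ld unfolding words_def by auto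
    have "?g (unit_vec (u @ d)) = unit_vec (wlabel (Suc c) ((x # d) @ t))"
      unfolding r unfolding \<mu>_def conjugate_hook by (rule sym_epi_unit[OF w'])
    also have "wlabel (Suc c) ((x # d) @ t) = label (add_mset x (mset d)) t"
      using ld by (subst wlabel_append) auto
    finally show ?thesis by (simp add: koszul_unit x(1))
  qed
  then have "?g (wedge_mono \<mu> n (unit_vec ?As)) = (\<Sum>u\<in>?U. vscale (altsign u) (koszul (unit_vec (label (mset d) u))))"
    unfolding 1 lin_sum[OF lg] lin_scale[OF lg] by (intro sum.cong) auto
  also have "\<dots> = koszul (wedge (mset d) (sorted_list_of_set A))"
  proof -
    have "altsign (sorted_list_of_set A) = (1 :: 'k)" by (rule altsign_sorted) auto
    then show ?thesis unfolding wedge_def lin_sum[OF lin_koszul] lin_scale[OF lin_koszul] by simp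
  qed
  finally show ?thesis by (simp add: comp_family_def)
qed

text \<open>Both functors are spanned by the images of basis vectors, and
  \<open>hook_map_unit\<close> matches these. The leg enters only as a multiset, and every multiset
  has a listing, so all basis vectors of S^c \<otimes> \<Lambda>^(m+1) are reached.\<close>

lemma hook_schur_eq:
  assumes "c + m + 1 = p"
  shows "hook_schur p m = (hookf c m :: (nat multiset list, 'k::field) spf)"
proof -
  define \<mu> where "\<mu> = Suc m # replicate c 1"
  let ?f = "\<lambda>n. comp_family (sym_epi (conjugate \<mu>)) (comp_family (row_to_column \<mu>) (wedge_mono \<mu>)) n
    :: (_ \<Rightarrow> 'k) \<Rightarrow> _"
  have "p - m - 1 = c" using assms by simp
  then have h: "hook_schur p m = image_functor (wedge_power \<mu>) (sym_power (conjugate \<mu>)) ?f"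
    unfolding hook_schur_def schur_functor_def \<mu>_def by simp
  have "?f n ` obj (wedge_power \<mu>) n = obj (hookf c m) n" for n
  proof -
    have lf: "lin (?f n)"
      unfolding comp_family_def
      by (rule lin_compose[OF lin_compose[OF lin_wedge_mono lin_row_to_column] lin_sym_epi])
    have "obj (wedge_power \<mu>) n = (coord_space (wedge_basis \<mu> n) :: (_ \<Rightarrow> 'k) set)"
      by (simp add: wedge_power_def)
    also have "\<dots> = fun_vs.span (unit_vec ` wedge_basis \<mu> n)"
      using coord_space_eq_span finite_wedge_basis_hook unfolding \<mu>_def by blast
    finally have "?f n ` obj (wedge_power \<mu>) n = fun_vs.span (?f n ` unit_vec ` wedge_basis \<mu> n)"
      using fun_vsp.linear_span_image[OF lf] by simp
    also have "?f n ` unit_vec ` wedge_basis \<mu> n =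
      koszul ` {wedge M w | M w. label M w \<in> labels c (Suc m) n \<and> sorted w \<and> distinct w}" (is "_ = koszul ` ?S")
    proof (intro equalityI subsetI)
      fix v assume "v \<in> ?f n ` unit_vec ` wedge_basis \<mu> n"
      then obtain As where As: "As \<in> wedge_basis \<mu> n" "v = ?f n (unit_vec As)" by blast
      then obtain A d where A: "As = A # map (\<lambda>y. {y}) d" "card A = Suc m" "A \<subseteq> {..<n}" "d \<in> words c n"
        unfolding \<mu>_def wedge_basis_hook by blast
      have "finite A" using A finite_subset by blast
      then have "label (mset d) (sorted_list_of_set A) \<in> labels c (Suc m) n"
        using A by (auto simp: words_def)
      moreover have "v = koszul (wedge (mset d) (sorted_list_of_set A))"
        unfolding As(2) A(1) \<mu>_def by (rule hook_map_unit[OF A(2-4)])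
      moreover have "sorted (sorted_list_of_set A)" "distinct (sorted_list_of_set A)" by auto
      ultimately show "v \<in> koszul ` ?S" by blast
    next
      fix v :: "nat multiset list \<Rightarrow> 'k" assume "v \<in> koszul ` ?S"
      then obtain M w where M: "v = koszul (wedge M w)" "label M w \<in> labels c (Suc m) n" "sorted w" "distinct w" by blast
      obtain d where d: "mset d = M" using ex_mset by blast
      have w: "sorted_list_of_set (set w) = w" using M by (simp add: sorted_list_of_set.idem_if_sorted_distinct)
      have A: "card (set w) = Suc m" "set w \<subseteq> {..<n}" "d \<in> words c n"
        using M d distinct_card[OF M(4)] by (auto simp: words_def)
      have "v = ?f n (unit_vec (set w # map (\<lambda>y. {y}) d))"
        using hook_map_unit[OF A, where 'k = 'k] unfolding M(1) \<mu>_def w d by simp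
      moreover have "set w # map (\<lambda>y. {y}) d \<in> wedge_basis \<mu> n"
        unfolding \<mu>_def wedge_basis_hook using A by blast
      ultimately show "v \<in> ?f n ` unit_vec ` wedge_basis \<mu> n" by blast
    qed
    also have "fun_vs.span (koszul ` ?S) = koszul ` alternating c (Suc m) n"
      unfolding alternating_eq_span using fun_vsp.linear_span_image[OF lin_koszul] by blast
    finally show ?thesis by (simp add: obj_hookf)
  qed
  moreover have "coef (sym_power (conjugate \<mu>)) = coef (hookf c m :: (nat multiset list, 'k) spf)"
    unfolding \<mu>_def conjugate_hook coef_hookf SI_def ..
  ultimately show ?thesis unfolding h image_functor_def hookf_def obj_hookf by simp
qed

section \<open>Morphisms from hook Schur functors to the terms of the Koszul complex\<close>

declare upt_Suc [simp del]

text \<open>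
  The monomial \<open>twist b a \<pi>\<close> acts as the permutation \<open>\<pi>\<close> of the letters on the vectors of content
  $0^b 1 \dots a$ and kills all other basis vectors.
\<close>

definition twist :: "nat \<Rightarrow> nat \<Rightarrow> (nat \<Rightarrow> nat) \<Rightarrow> expo" where
  "twist b a \<pi> = word_expo (map \<pi> (std_word b a)) (std_word b a)"

lemma mset_lword_label: "mset (lword (label M u)) = M + mset u"
  by (simp add: lword_label)

lemma map_permutes_upt:
  assumes "\<pi> permutes {1..<a + 1}"
  shows "mset (map \<pi> [1..<a + 1]) = mset [1..<a + 1]"
proof -
  have "distinct (map \<pi> [1..<a + 1])" using permutes_inj[OF assms] by (simp add: distinct_map inj_on_def inj_def)
  moreover have "set (map \<pi> [1..<a + 1]) = set [1..<a + 1]" using permutes_image[OF assms] by simp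
  ultimately show ?thesis using set_eq_iff_mset_eq_distinct distinct_upt by blast
qed

lemma map_std_word: 
  assumes "\<pi> permutes {1..<a + 1}"
  shows "map \<pi> (std_word b a) = replicate b 0 @ map \<pi> [1..<a + 1]"
  using permutes_not_in[OF assms, of 0] by (simp add: std_word_def)

lemma mset_map_std_word:
  assumes "\<pi> permutes {1..<a + 1}"
  shows "mset (map \<pi> (std_word b a)) = mset (std_word b a)"
  unfolding map_std_word[OF assms] using map_permutes_upt[OF assms] by (simp add: std_word_def)

lemma permutes_less: "\<pi> permutes {1..<a + 1} \<Longrightarrow> x < a + 1 \<Longrightarrow> \<pi> x < (a + 1 :: nat)"
  using permutes_in_image[of \<pi> "{1..<a + 1}" x] permutes_not_in[of \<pi> "{1..<a + 1}" x]
  by (cases "x \<in> {1..<a + 1}") auto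

lemma zip_map_same: "zip (map \<pi> I) I = map (\<lambda>i. (\<pi> i, i)) I" "zip I (map \<pi> I) = map (\<lambda>i. (i, \<pi> i)) I"
  by (induction I) auto

text \<open>The two words have the same content, and for an involution the pairs
  \<open>(\<pi> i, i)\<close> and \<open>(i, \<pi> i)\<close> form the same multiset. This brings
  \<open>std_word\<close> to the left, where \<open>SI_coef_std_word\<close> applies.\<close>

lemma twist_sym:
  assumes p: "\<pi> permutes {1..<a + 1}" and inv: "\<And>x. \<pi> (\<pi> x) = x"
  shows "twist b a \<pi> = word_expo (std_word b a) (map \<pi> (std_word b a))"
proof -
  have "mset (zip (std_word b a) (map \<pi> (std_word b a))) = image_mset (\<lambda>i. (i, \<pi> i)) (mset (map \<pi> (std_word b a)))"
    unfolding zip_map_same mset_map_std_word[OF p] by simp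
  also have "\<dots> = mset (zip (map \<pi> (std_word b a)) (std_word b a))"
    unfolding zip_map_same by (simp add: image_mset.compositionality comp_def inv)
  finally show ?thesis unfolding twist_def by (subst word_expo_eq_iff) auto
qed

lemma twist_in_expos:
  assumes "\<pi> permutes {1..<a + 1}"
  shows "twist b a \<pi> \<in> expos (a + 1) (a + 1) (b + a)"
  unfolding twist_def
proof (rule word_expo_in_expos[OF _ std_word_in_words])
  show "map \<pi> (std_word b a) \<in> words (b + a) (a + 1)"
    using std_word_in_words[of b a] permutes_less[OF assms] by (auto simp: words_def subset_iff)
qed

text \<open>The pairs in the monomial force the second word to have the content of
  \<open>std_word b a\<close>, and the first to be its image under \<open>\<pi>\<close> letter by
  letter. So at most one word contributes.\<close>

lemma twist_coef_unit:
  assumes p: "\<pi> permutes {1..<a + 1}" and e: "c + d = b + a" and L: "label M u \<in> labels c d (a + 1)"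
  shows "coef (SI c d) (a + 1) (a + 1) (twist b a \<pi>) (unit_vec (label M u)) =
    (if M + mset u = mset (std_word b a) then unit_vec (label (image_mset \<pi> M) (map \<pi> u)) else 0 :: _ \<Rightarrow> 'k::field)"
proof -
  define I where "I = lword (label M u)"
  have I: "I \<in> words (c + d) (a + 1)" unfolding I_def by (rule lword_in_words[OF L])
  have lK: "length (std_word b a) = c + d" using e by (simp add: std_word_def)
  have mI: "mset I = M + mset u" unfolding I_def by (rule mset_lword_label)
  have "{J \<in> words (c + d) (a + 1). word_expo J I = twist b a \<pi>} =
      (if mset I = mset (std_word b a) then {map \<pi> I} else {})"
  proof -
    have iff: "word_expo J I = twist b a \<pi> \<longleftrightarrow> mset I = mset (std_word b a) \<and> J = map \<pi> I"
      if J: "J \<in> words (c + d) (a + 1)" for J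
    proof -
      have l: "length J = length I" "length I = c + d" using I J by (auto simp: words_def)
      have eq: "word_expo J I = twist b a \<pi> \<longleftrightarrow> mset (zip J I) = image_mset (\<lambda>i. (\<pi> i, i)) (mset (std_word b a))"
        unfolding twist_def using l lK by (subst word_expo_eq_iff) (auto simp: zip_map_same)
      show ?thesis
      proof
        assume "word_expo J I = twist b a \<pi>"
        then have m: "mset (zip J I) = image_mset (\<lambda>i. (\<pi> i, i)) (mset (std_word b a))" using eq by blast
        have "mset (map snd (zip J I)) = mset (std_word b a)"
          unfolding mset_map m by (simp add: image_mset.compositionality comp_def)
        moreover have "J = map \<pi> I"
        proof (rule nth_equalityI)
          fix t assume "t < length J"
          then have "(J ! t, I ! t) \<in> set (zip J I)" using l by (auto simp: in_set_zip)
          then have "(J ! t, I ! t) \<in># image_mset (\<lambda>i. (\<pi> i, i)) (mset (std_word b a))" using m by (metis set_mset_mset)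
          then show "J ! t = map \<pi> I ! t" using \<open>t < length J\<close> l by auto
        qed (use l in simp)
        ultimately show "mset I = mset (std_word b a) \<and> J = map \<pi> I" using l by simp
      next
        assume "mset I = mset (std_word b a) \<and> J = map \<pi> I"
        then show "word_expo J I = twist b a \<pi>" unfolding eq by (simp add: zip_map_same)
      qed
    qed
    have "map \<pi> I \<in> words (c + d) (a + 1)"
      using I permutes_less[OF p] by (auto simp: words_def subset_iff)
    then show ?thesis using iff by auto
  qed
  moreover have "wlabel c (map \<pi> I) = label (image_mset \<pi> M) (map \<pi> u)"
  proof -
    have "length (sorted_list_of_multiset M) = c" using L by (metis label_in_labels mset_sorted_list_of_multiset size_mset)
    then show ?thesis unfolding I_def lword_label by (simp add: wlabel_append)
  qed
  ultimately show ?thesis unfolding SI_coef_lword[OF L] I_def[symmetric] mI[symmetric] by simp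
qed

text \<open>A place permutation that carries \<open>w\<close> to \<open>u\<close> carries
  \<open>map \<pi> w\<close> to \<open>map \<pi> u\<close>; both products are its sign.\<close>

lemma altsign_map:
  assumes "mset u = mset w" "distinct w" "inj \<pi>"
  shows "altsign (map \<pi> u) * altsign (map \<pi> w) = (altsign u * altsign w :: 'k::field)"
proof -
  obtain \<tau> where t: "\<tau> permutes {..<length w}" "permute_list \<tau> w = u"
    using mset_eq_permutation[OF assms(1)] by blast
  have sq: "altsign x * altsign x = (1 :: 'k)" if "distinct x" for x
    using that by (simp add: altsign_def word_sign_def flip: power_add)
  have "altsign u * altsign w = (of_int (sign \<tau>) :: 'k)"
    using altsign_permute[OF t(1), where 'a = 'k] t(2) sq[OF assms(2)] by (simp add: mult.assoc)
  moreover have "map \<pi> u = permute_list \<tau> (map \<pi> w)" using t by (simp add: permute_list_map)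
  moreover have "distinct (map \<pi> w)" using assms by (simp add: distinct_map inj_on_def inj_def)
  ultimately show ?thesis
    using altsign_permute[of \<tau> "map \<pi> w", where 'a = 'k] t(1) sq[of "map \<pi> w"] by (simp add: mult.assoc)
qed

lemma twist_coef_wedge:
  assumes p: "\<pi> permutes {1..<a + 1}" and e: "c + d = b + a" and L: "label M w \<in> labels c d (a + 1)" "distinct w"
  shows "coef (SI c d) (a + 1) (a + 1) (twist b a \<pi>) (wedge M w) =
    (if M + mset w = mset (std_word b a) then wedge (image_mset \<pi> M) (map \<pi> w) else 0 :: _ \<Rightarrow> 'k::field)"
proof -
  have inj: "inj \<pi>" using permutes_inj[OF p] .
  let ?U = "{u. mset u = mset w}"
  have Lu: "label M u \<in> labels c d (a + 1)" if "u \<in> ?U" for u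
    using L(1) that mset_eq_setD[of u w] mset_eq_length[of u w] by simp
  have "coef (SI c d) (a + 1) (a + 1) (twist b a \<pi>) (wedge M w) =
    (\<Sum>u\<in>?U. vscale (altsign u * altsign w) (if M + mset w = mset (std_word b a)
      then unit_vec (label (image_mset \<pi> M) (map \<pi> u)) else 0 :: _ \<Rightarrow> 'k))"
    unfolding wedge_def lin_sum[OF lin_SI_coef] lin_scale[OF lin_SI_coef]
    by (rule sum.cong[OF refl]) (simp only: twist_coef_unit[OF p e Lu] mem_Collect_eq)
  also have "\<dots> = (if M + mset w = mset (std_word b a) then
    (\<Sum>u\<in>?U. vscale (altsign (map \<pi> u) * altsign (map \<pi> w)) (unit_vec (label (image_mset \<pi> M) (map \<pi> u)))) else 0)"
    using altsign_map[OF _ L(2) inj, where 'k = 'k]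
    by (cases "M + mset w = mset (std_word b a)") (auto intro!: sum.cong sum.neutral)
  also have "(\<Sum>u\<in>?U. vscale (altsign (map \<pi> u) * altsign (map \<pi> w)) (unit_vec (label (image_mset \<pi> M) (map \<pi> u))))
    = (wedge (image_mset \<pi> M) (map \<pi> w) :: _ \<Rightarrow> 'k)"
    unfolding wedge_def
  proof (rule sum.reindex_bij_betw)
    show "bij_betw (map \<pi>) ?U {u. mset u = mset (map \<pi> w)}"
      unfolding bij_betw_def
    proof
      show "inj_on (map \<pi>) ?U" using inj by (auto intro: inj_on_subset inj_mapI)
      show "map \<pi> ` ?U = {u. mset u = mset (map \<pi> w)}"
      proof (intro equalityI subsetI)
        fix u assume u: "u \<in> {u. mset u = mset (map \<pi> w)}"
        have "u = map \<pi> (map (inv \<pi>) u)" using permutes_surj[OF p] by (simp add: surj_f_inv_f map_idI)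
        moreover have "mset (map (inv \<pi>) u) = mset w"
          using u inj by (simp add: image_mset.compositionality comp_def)
        ultimately show "u \<in> map \<pi> ` ?U" by blast
      qed auto
    qed
  qed
  finally show ?thesis .
qed

text \<open>The functional that represents a morphism into S^b \<otimes> \<Lambda>^a transforms
  under these permutations of the letters 1, ..., a by the sign, because the vectors of the target
  alternate.\<close>

lemma twist_value:
  assumes f: "f \<in> Hom (b + a) F (SL b a :: (nat multiset list, 'k::field) spf)" and a: "of_nat (fact a) \<noteq> (0 :: 'k)"
    and p: "\<pi> permutes {1..<a + 1}" "\<And>x. \<pi> (\<pi> x) = x" and v: "v \<in> obj F (a + 1)"
  shows "f (a + 1) (coef F (a + 1) (a + 1) (twist b a \<pi>) v) (wlabel b (std_word b a))
    = altsign (map \<pi> [1..<a + 1]) * f (a + 1) v (wlabel b (std_word b a))"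
proof -
  define u where "u = f (a + 1) v"
  have u: "u \<in> alternating b a (a + 1)" using Hom_in[OF f v] SL_eq_alternating[OF a] unfolding u_def by blast
  have w: "map \<pi> (std_word b a) \<in> words (b + a) (a + 1)"
    using std_word_in_words[of b a] permutes_less[OF p(1)] by (auto simp: words_def subset_iff)
  have "f (a + 1) (coef F (a + 1) (a + 1) (twist b a \<pi>) v) = coef (SI b a) (a + 1) (a + 1) (twist b a \<pi>) u"
    using Hom_natural[OF f twist_in_expos[OF p(1)] v] by (simp add: u_def)
  then have "f (a + 1) (coef F (a + 1) (a + 1) (twist b a \<pi>) v) (wlabel b (std_word b a)) = u (wlabel b (map \<pi> (std_word b a)))"
    unfolding twist_sym[OF p] using SI_coef_std_word[OF w, of u] by simp
  also have "wlabel b (map \<pi> (std_word b a)) = label (replicate_mset b 0) (map \<pi> [1..<a + 1])"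
    unfolding map_std_word[OF p(1)] by (subst wlabel_append) auto
  also have "u \<dots> = altsign (map \<pi> [1..<a + 1]) * altsign [1..<a + 1] * u (label (replicate_mset b 0) [1..<a + 1])"
    by (rule alternating_permute[OF u map_permutes_upt[OF p(1)]]) simp
  also have "altsign [1..<a + 1] = (1 :: 'k)" by (rule altsign_sorted) auto
  finally show ?thesis unfolding u_def wlabel_std_word by simp
qed

lemma altsign_transpose_upt:
  assumes "i \<in> {1..<a + 1}" "j \<in> {1..<a + 1}" "i \<noteq> j"
  shows "altsign (map (transpose i j) [1..<a + 1]) = (- 1 :: 'k::field)"
proof -
  \<comment> \<open>The letter \<open>i\<close> stands at place \<open>i - 1\<close>.\<close>
  let ?l = "[1..<a + 1]" and ?t = "transpose (i - 1) (j - 1)"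
  have p: "?t permutes {..<length ?l}" using assms by (intro permutes_swap_id) auto
  have "map (transpose i j) ?l = permute_list ?t ?l"
  proof (rule nth_equalityI)
    fix t assume "t < length (map (transpose i j) ?l)"
    then have t: "t < a" by simp
    have "?t t < a" using permutes_in_image[OF p, of t] t by simp
    then show "map (transpose i j) ?l ! t = permute_list ?t ?l ! t"
      using t p assms by (simp add: permute_list_nth del: upt_Suc) (auto simp: transpose_def simp del: upt_Suc)
  qed simp
  moreover have "altsign ?l = (1 :: 'k)" by (rule altsign_sorted) auto
  moreover have "i - 1 \<noteq> j - 1" using assms by auto
  ultimately show ?thesis using altsign_permute[OF p, where 'a = 'k] by (simp add: sign_swap_id)
qed

lemma wedge_mset_cong:
  assumes "mset u = mset w" "distinct w"
  shows "(wedge M u :: _ \<Rightarrow> 'k::field) = vscale (altsign u * altsign w) (wedge M w)"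
proof -
  have "altsign w * altsign w = (1 :: 'k)"
    using assms(2) by (simp add: altsign_def word_sign_def flip: power_add)
  then have "altsign x * altsign u = altsign u * altsign w * (altsign x * altsign w :: 'k)" for x
    by (metis mult.assoc mult.commute mult.left_commute mult_1)
  then show ?thesis unfolding wedge_def assms(1) fun_vs.scale_sum_right by (auto intro!: sum.cong)
qed

lemma linf_apply: "lin h \<Longrightarrow> linf (\<lambda>x. h x L)"
  unfolding lin_iff linf_iff by (simp add: vscale_apply)

text \<open>
  A morphism from \<open>hookf c m\<close> to \<open>SL b a\<close> is determined by the values below on the basis vectors
  whose exterior factor contains the letter \<open>0\<close>; these are the only ones in the image of the
  contraction.
\<close>

lemma Hom_hookf_eq_0:
  fixes f :: "(nat multiset list, nat multiset list, 'k::field) family"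
  assumes e: "Suc c + m = b + a" "0 < b" and m: "of_nat (fact m) \<noteq> (0 :: 'k)" and a: "of_nat (fact a) \<noteq> (0 :: 'k)"
    and f: "f \<in> Hom (b + a) (hookf c m) (SL b a)"
    and vals: "\<And>D w. D \<subseteq> {1..<a + 1} \<Longrightarrow> set w = insert 0 ({1..<a + 1} - D) \<Longrightarrow> sorted w \<Longrightarrow> distinct w \<Longrightarrow>
      length w = Suc m \<Longrightarrow> card D + m = a \<Longrightarrow>
      label (replicate_mset (b - 1) 0 + mset_set D) w \<in> labels c (Suc m) (a + 1) \<Longrightarrow>
      replicate_mset (b - 1) 0 + mset_set D + mset w = mset (std_word b a) \<Longrightarrow>
      f (a + 1) (koszul (wedge (replicate_mset (b - 1) 0 + mset_set D) w)) (wlabel b (std_word b a)) = 0"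
  shows "f = 0"
proof -
  let ?F = "hookf c m :: (nat multiset list, 'k) spf"
  let ?p = "wlabel b (std_word b a)"
  have F: "strict_poly_functor (b + a) ?F" using strict_poly_functor_hookf[OF m, of c] e by simp
  have wedge_in: "koszul (wedge M w) \<in> obj ?F (a + 1)" if "label M w \<in> labels c (Suc m) (a + 1)" "distinct w" for M w
    unfolding obj_hookf using wedge_alternating[OF that] by blast
  have gen0: "f (a + 1) (koszul (wedge M w)) ?p = 0"
    if L: "label M w \<in> labels c (Suc m) (a + 1)" and w: "sorted w" "distinct w" and mn: "min_letter M w \<in> set w" for M w
  proof (cases "M + mset w = mset (std_word b a)")
    case False
    \<comment> \<open>The identity twist projects onto the vectors of content 0^b 1 ... a. It kills
      this vector but preserves the value, so the value is 0.\<close>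
    have id: "id permutes {1..<a + 1}" by (rule permutes_id)
    have "f (a + 1) (coef ?F (a + 1) (a + 1) (twist b a id) (koszul (wedge M w))) ?p
      = altsign (map id [1..<a + 1]) * f (a + 1) (koszul (wedge M w)) ?p"
      by (rule twist_value[OF f a id _ wedge_in[OF L w(2)]]) simp
    moreover have "altsign (map id [1..<a + 1]) = (1 :: 'k)" by (rule altsign_sorted) auto
    moreover have "coef ?F (a + 1) (a + 1) (twist b a id) (koszul (wedge M w)) = 0"
    proof -
      have "coef ?F (a + 1) (a + 1) (twist b a id) (koszul (wedge M w)) =
          koszul (coef (SI c (Suc m)) (a + 1) (a + 1) (twist b a id) (wedge M w))"
        unfolding coef_hookf by (rule koszul_natural[OF wedge_coord[OF L], symmetric])
      also have "coef (SI c (Suc m)) (a + 1) (a + 1) (twist b a id) (wedge M w) = (0 :: _ \<Rightarrow> 'k)"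
        using twist_coef_wedge[OF id _ L w(2), of b, where 'k = 'k] e False by simp
      also have "koszul 0 = (0 :: _ \<Rightarrow> 'k)" by (rule fun_vsp.linear_0[OF lin_koszul])
      finally show ?thesis .
    qed
    moreover have "f (a + 1) 0 = 0" by (rule Hom_zero[OF F f])
    ultimately show ?thesis by simp
  next
    case True
    \<comment> \<open>The nonzero letters that the exterior factor lacks; the content then
      determines the symmetric factor.\<close>
    define D where "D = {1..<a + 1} - set w"
    have K: "mset (std_word b a) = replicate_mset b 0 + mset_set {1..<a + 1}"
      by (simp add: std_word_def mset_upt flip: mset_set_upto_eq_mset_upto) 
    have cont: "set_mset M \<union> set w = {..<a + 1}"
    proof -
      have "set_mset M \<union> set w = set_mset (M + mset w)" by simp
      also have "\<dots> = insert 0 {1..<a + 1}" unfolding True K using e(2) by auto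
      also have "\<dots> = {..<a + 1}" by auto
      finally show ?thesis .
    qed
    \<comment> \<open>Since \<open>b > 0\<close>, the letter 0 occurs and is the least one, so
      \<open>w\<close> contains it.\<close>
    have "min_letter M w = 0" unfolding min_letter_def cont by (rule Min_eqI) auto
    then have 0: "0 \<in> set w" using mn by simp
    have "set w \<subseteq> {..<a + 1}" unfolding cont[symmetric] by blast
    then have "set w \<subseteq> insert 0 {1..<a + 1}" by (auto simp: subset_iff)
    then have wD: "set w = insert 0 ({1..<a + 1} - D)" unfolding D_def using 0 by auto
    have mw: "mset w = mset_set (set w)" using w(2) by (simp add: mset_set_set)
    have "mset w = add_mset 0 (mset_set ({1..<a + 1} - D))" unfolding mw unfolding wD by (subst mset_set.insert) auto
    then have "M + add_mset 0 (mset_set ({1..<a + 1} - D)) = replicate_mset b 0 + mset_set {1..<a + 1}"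
      using True K by simp
    also have "mset_set {1..<a + 1} = mset_set D + mset_set ({1..<a + 1} - D)"
      by (subst mset_set_Union[symmetric]) (auto simp: D_def intro: arg_cong[of _ _ mset_set])
    also have "replicate_mset b (0::nat) = add_mset 0 (replicate_mset (b - 1) 0)" using e(2) by (cases b) auto
    finally have M: "M = replicate_mset (b - 1) 0 + mset_set D" by simp
    have lw: "length w = Suc m" using L by simp
    have "card (set w) = Suc (card ({1..<a + 1} - D))" unfolding wD by (subst card_insert_disjoint) auto
    then have "card ({1..<a + 1} - D) = m" using lw distinct_card[OF w(2)] by simp
    moreover have "card {1..<a + 1} = card D + card ({1..<a + 1} - D)"
    proof -
      have "D \<subseteq> {1..<a + 1}" by (auto simp: D_def)
      then show ?thesis
        using card_Diff_subset[of D "{1..<a + 1}"] card_mono[of "{1..<a + 1}" D] finite_subset[of D "{1..<a + 1}"]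
        by simp
    qed
    ultimately have cD: "card D + m = a" by simp
    have "D \<subseteq> {1..<a + 1}" by (auto simp: D_def)
    then show ?thesis unfolding M by (rule vals[OF _ wD w lw cD L[unfolded M] True[unfolded M]])
  qed
  have zero: "f (a + 1) v ?p = 0" if v: "v \<in> obj ?F (a + 1)" for v
  proof -
    obtain g where g: "lin g" "\<And>v. v \<in> obj ?F (a + 1) \<Longrightarrow> g v = f (a + 1) v"
      using linear_between_extend[OF Hom_linear[OF f] strict_subspace[OF F]] by blast
    \<comment> \<open>A vector of the hook functor is the Koszul image of its contraction, so the
      wedges whose exterior factor contains the least letter suffice as generators.\<close>
    define y where "y = contraction c m (a + 1) v"
    have y: "v = koszul y" "y \<in> alternating c (Suc m) (a + 1)" unfolding y_def by (rule obj_hookf_contraction[OF v], rule contraction_alternating)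
    let ?S = "{(wedge M w :: nat multiset list \<Rightarrow> 'k) | M w. label M w \<in> labels c (Suc m) (a + 1) \<and> sorted w \<and> distinct w \<and> y (label M w) \<noteq> 0}"
    have lf: "linf (\<lambda>x. g (koszul x) ?p)"
      by (rule linf_apply[OF lin_compose[OF lin_koszul g(1)]])
    have "g (koszul x) ?p = 0" if x: "x \<in> ?S" for x
    proof -
      obtain M w where M: "x = wedge M w" "label M w \<in> labels c (Suc m) (a + 1)" "sorted w" "distinct w" "y (label M w) \<noteq> 0"
        using x by blast
      have "min_letter M w \<in> set w" using contraction_nonzero M(5) unfolding y_def by blast
      then have "f (a + 1) (koszul x) ?p = 0" unfolding M(1) by (rule gen0[OF M(2-4)])
      then show ?thesis using g(2)[OF wedge_in[OF M(2,4)]] M(1) by simp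
    qed
    then have "g (koszul y) ?p = 0"
      by (intro fun_vsf.linear_eq_0_on_span[OF lf _ alternating_span[OF y(2)]])
    then show ?thesis using g(2)[OF v] y(1) by simp
  qed
  show "f = 0"
  proof (intro ext)
    fix n v L
    show "f n v L = 0 n v L"
    proof (cases "v \<in> obj ?F n \<and> L \<in> labels b a n")
      case True
      have "coef ?F (a + 1) n (word_expo (std_word b a) (lword L)) v \<in> obj ?F (a + 1)"
        using strict_coef_in[OF F word_expo_in_expos[OF std_word_in_words lword_in_words]] True by blast
      then show ?thesis using yoneda_determined[OF f coef_SL] True zero by simp
    next
      case False
      have "f n v \<in> coord_space (labels b a n)" if "v \<in> obj ?F n" using Hom_in[OF f that] by (simp add: obj_SL)
      moreover have "f n v = 0" if "v \<notin> obj ?F n" using Hom_outside[OF f that] .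
      ultimately show ?thesis using False by (cases "v \<in> obj ?F n") (auto simp: coord_space_def)
    qed
  qed
qed

text \<open>A case of \<open>twist_value\<close>: as \<open>M\<close> and \<open>w\<close> together
  have the content of \<open>std_word b a\<close>, the twist just renames their letters, and a
  transposition has sign -1.\<close>

lemma twist_value_wedge:
  fixes f :: "(nat multiset list, nat multiset list, 'k::field) family"
  assumes e: "Suc c + m = b + a" and a: "of_nat (fact a) \<noteq> (0 :: 'k)"
    and f: "f \<in> Hom (b + a) (hookf c m) (SL b a)"
    and L: "label M w \<in> labels c (Suc m) (a + 1)" "distinct w" "M + mset w = mset (std_word b a)"
    and ij: "i \<in> {1..<a + 1}" "j \<in> {1..<a + 1}" "i \<noteq> j"
  shows "f (a + 1) (koszul (wedge (image_mset (transpose i j) M) (map (transpose i j) w))) (wlabel b (std_word b a))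
    = - f (a + 1) (koszul (wedge M w)) (wlabel b (std_word b a))"
proof -
  let ?t = "transpose i j"
  have p: "?t permutes {1..<a + 1}" using ij by (intro permutes_swap_id) auto
  have E: "koszul (wedge M w) \<in> obj (hookf c m) (a + 1)" unfolding obj_hookf using wedge_alternating[OF L(1,2)] by blast
  have "f (a + 1) (coef (hookf c m) (a + 1) (a + 1) (twist b a ?t) (koszul (wedge M w))) (wlabel b (std_word b a))
    = altsign (map ?t [1..<a + 1]) * f (a + 1) (koszul (wedge M w)) (wlabel b (std_word b a))"
    by (rule twist_value[OF f a p _ E]) simp
  moreover have "coef (hookf c m) (a + 1) (a + 1) (twist b a ?t) (koszul (wedge M w)) =
      (koszul (coef (SI c (Suc m)) (a + 1) (a + 1) (twist b a ?t) (wedge M w)) :: _ \<Rightarrow> 'k)"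
    unfolding coef_hookf by (rule koszul_natural[OF wedge_coord[OF L(1)], symmetric])
  moreover have "coef (SI c (Suc m)) (a + 1) (a + 1) (twist b a ?t) (wedge M w)
      = (wedge (image_mset ?t M) (map ?t w) :: _ \<Rightarrow> 'k)"
    using twist_coef_wedge[OF p _ L(1,2), of b, where 'k = 'k] e L(3) by simp
  ultimately show ?thesis using altsign_transpose_upt[OF ij, where 'k = 'k] by simp
qed

section \<open>The three cases of the exterior degree\<close>

lemma two_neq_0:
  assumes "of_nat (fact a) \<noteq> (0 :: 'k::field)" "2 \<le> a"
  shows "(2 :: 'k) \<noteq> 0"
proof
  assume "(2 :: 'k) = 0"
  moreover have "2 dvd (fact a :: nat)" by (rule dvd_fact) (use assms in auto)
  then obtain r where "fact a = 2 * (r :: nat)" by (auto simp: dvd_def)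
  ultimately show False using assms(1) by (simp del: of_nat_fact)
qed

text \<open>A set \<open>D\<close> as in \<open>Hom_hookf_eq_0\<close> has a - m \<ge> 2 letters
  here. Exchanging two of them changes neither the symmetric nor the exterior factor, but it negates
  the value.\<close>

lemma Hom_hookf_vanish:
  fixes f :: "(nat multiset list, nat multiset list, 'k::field) family"
  assumes e: "Suc c + m = b + a" "0 < b" and m: "of_nat (fact m) \<noteq> (0 :: 'k)" and a: "of_nat (fact a) \<noteq> (0 :: 'k)"
    and f: "f \<in> Hom (b + a) (hookf c m) (SL b a)" and ne: "a \<noteq> m" "a \<noteq> Suc m"
  shows "f = 0"
proof (rule Hom_hookf_eq_0[OF e m a f])
  fix D w
  assume D: "D \<subseteq> {1..<a + 1}" and w: "set w = insert 0 ({1..<a + 1} - D)" "distinct w"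
    and cD: "card D + m = a"
    and L: "label (replicate_mset (b - 1) 0 + mset_set D) w \<in> labels c (Suc m) (a + 1)"
    and K: "replicate_mset (b - 1) 0 + mset_set D + mset w = mset (std_word b a)"
  let ?M = "replicate_mset (b - 1) 0 + mset_set D"
  have finD: "finite D" using D finite_subset by blast
  have "2 \<le> card D" using cD ne by linarith
  then obtain i j where ij: "i \<in> D" "j \<in> D" "i \<noteq> j" by (metis card_le_Suc0_iff_eq finD not_less_eq_eq numeral_2_eq_2)
  let ?t = "transpose i j"
  have ij': "i \<in> {1..<a + 1}" "j \<in> {1..<a + 1}" using ij D by blast+
  have pD: "?t permutes D" using ij by (intro permutes_swap_id)
  have "?t 0 = 0" using ij' by (auto simp: transpose_def)
  moreover have "image_mset ?t (mset_set D) = mset_set D"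
    using image_mset_mset_set[of ?t D] permutes_inj_on[OF pD] permutes_image[OF pD] by simp
  ultimately have M: "image_mset ?t ?M = ?M" by simp
  have "?t x = x" if "x \<in> set w" for x
    using that w(1) ij ij' by (auto simp: transpose_def)
  then have W: "map ?t w = w" by (simp add: map_idI)
  have "f (a + 1) (koszul (wedge ?M w)) (wlabel b (std_word b a)) = - f (a + 1) (koszul (wedge ?M w)) (wlabel b (std_word b a))"
    using twist_value_wedge[OF e(1) a f L w(2) K ij' ij(3)] unfolding M W .
  then have "2 * f (a + 1) (koszul (wedge ?M w)) (wlabel b (std_word b a)) = 0" by (metis add.right_inverse mult_2)
  then show "f (a + 1) (koszul (wedge ?M w)) (wlabel b (std_word b a)) = 0"
    using two_neq_0[OF a] \<open>2 \<le> card D\<close> cD by simp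
qed

text \<open>Here \<open>D\<close> is empty, which leaves the one generator with the exterior letters
  0, ..., m.\<close>

lemma Hom_hookf_eq_0_same:
  fixes f :: "(nat multiset list, nat multiset list, 'k::field) family"
  assumes m: "of_nat (fact m) \<noteq> (0 :: 'k)"
    and f: "f \<in> Hom (Suc c + m) (hookf c m) (SL (Suc c) m)"
    and 0: "f (m + 1) (koszul (wedge (replicate_mset c 0) [0..<Suc m])) (wlabel (Suc c) (std_word (Suc c) m)) = 0"
  shows "f = 0"
proof (rule Hom_hookf_eq_0[OF refl _ m m f])
  fix D w
  assume D: "D \<subseteq> {1..<m + 1}" and w: "set w = insert 0 ({1..<m + 1} - D)" "sorted w" "distinct w"
    and cD: "card D + m = m"
  have D0: "D = {}" using D cD finite_subset[of D "{1..<m + 1}"] by simp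
  have "set w = set [0..<Suc m]" unfolding w(1) D0 by auto
  then have "w = [0..<Suc m]" using w by (intro sorted_distinct_set_unique) auto
  then show "f (m + 1) (koszul (wedge (replicate_mset (Suc c - 1) 0 + mset_set D) w)) (wlabel (Suc c) (std_word (Suc c) m)) = 0"
    using 0 D0 by simp
qed simp

text \<open>Here \<open>D\<close> has one letter. Exchanging it with \<open>Suc m\<close> turns
  every generator into plus or minus the chosen one, so one value controls all.\<close>

lemma Hom_hookf_eq_0_next:
  fixes f :: "(nat multiset list, nat multiset list, 'k::field) family"
  assumes m: "of_nat (fact (Suc m)) \<noteq> (0 :: 'k)"
    and f: "f \<in> Hom (Suc c + Suc m) (hookf (Suc c) m) (SL (Suc c) (Suc m))"
    and 0: "f (Suc m + 1) (koszul (wedge (add_mset (Suc m) (replicate_mset c 0)) [0..<Suc m]))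
      (wlabel (Suc c) (std_word (Suc c) (Suc m))) = 0"
  shows "f = 0"
proof (rule Hom_hookf_eq_0[OF _ _ _ m f])
  show "of_nat (fact m) \<noteq> (0 :: 'k)"
  proof
    assume "of_nat (fact m) = (0 :: 'k)"
    moreover have "fact (Suc m) = Suc m * (fact m :: nat)" by simp
    ultimately show False using m by (metis mult_zero_right of_nat_mult)
  qed
  fix D w
  assume D: "D \<subseteq> {1..<Suc m + 1}" and w: "set w = insert 0 ({1..<Suc m + 1} - D)" "sorted w" "distinct w"
    and cD: "card D + m = Suc m"
    and L: "label (replicate_mset (Suc c - 1) 0 + mset_set D) w \<in> labels (Suc c) (Suc m) (Suc m + 1)"
    and K: "replicate_mset (Suc c - 1) 0 + mset_set D + mset w = mset (std_word (Suc c) (Suc m))"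
  let ?a = "Suc m" and ?p = "wlabel (Suc c) (std_word (Suc c) (Suc m))"
  let ?My = "add_mset (Suc m) (replicate_mset c 0)" and ?wx = "[0..<Suc m]"
  obtain i where i: "D = {i}" using cD card_1_singletonE by (metis add_left_cancel plus_1_eq_Suc add.commute)
  have ia: "i \<in> {1..<?a + 1}" using D i by simp
  have sw: "set w = {..<?a + 1} - {i}" unfolding w(1) i using ia by auto
  show "f (?a + 1) (koszul (wedge (replicate_mset (Suc c - 1) 0 + mset_set D) w)) ?p = 0"
  proof (cases "i = ?a")
    case True
    have "set w = set ?wx" unfolding sw True by auto
    then have "w = ?wx" using w by (intro sorted_distinct_set_unique) auto
    then show ?thesis using 0 i True by simp
  next
    case False
    let ?t = "transpose i ?a"
    have img: "?t ` ({..<?a + 1} - {i}) = {..<?a + 1} - {?a}"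
    proof -
      have "?t permutes {..<?a + 1}" using ia by (intro permutes_swap_id) auto
      then have "?t ` {..<?a + 1} = {..<?a + 1}" by (rule permutes_image)
      then show ?thesis by (simp add: image_set_diff)
    qed
    have "{..<?a + 1} - {?a} = set ?wx" by auto
    then have "set (map ?t w) = set ?wx" unfolding set_map sw img .
    moreover have "distinct (map ?t w)" using w(3) by (simp add: distinct_map)
    ultimately have ms: "mset (map ?t w) = mset ?wx"
      using set_eq_iff_mset_eq_distinct[of "map ?t w" ?wx] by simp
    have M: "image_mset ?t (replicate_mset (Suc c - 1) 0 + mset_set D) = ?My"
      using ia by (simp add: i transpose_def)
    have L1: "label ?My ?wx \<in> labels (Suc c) ?a (?a + 1)" by auto
    have "f (?a + 1) (koszul (wedge ?My (map ?t w))) ?p = - f (?a + 1) (koszul (wedge (replicate_mset (Suc c - 1) 0 + mset_set D) w)) ?p"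
      unfolding M[symmetric]
      by (rule twist_value_wedge[OF _ m f L w(3) K ia _ False]) auto
    moreover have "f (?a + 1) (koszul (wedge ?My (map ?t w))) ?p = 0"
    proof -
      have "(koszul (wedge ?My ?wx) :: _ \<Rightarrow> 'k) \<in> obj (hookf (Suc c) m) (?a + 1)"
        unfolding obj_hookf by (rule imageI, rule wedge_alternating[OF L1]) simp
      from Hom_scale[OF f this] show ?thesis
        unfolding wedge_mset_cong[OF ms distinct_upt] lin_scale[OF lin_koszul] using 0 by (simp add: vscale_apply)
    qed
    ultimately show ?thesis by simp
  qed
qed simp_all

section \<open>Values of the inclusion and of the de Rham map at test vectors\<close>

lemma card_permutes_fixed:
  assumes "t < Suc m"
  shows "card {\<sigma>. \<sigma> permutes {..<Suc m} \<and> \<sigma> 0 = t} = fact m"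
proof -
  let ?S = "{..<Suc m}" and ?t = "transpose 0 t"
  have p: "?t permutes ?S" using assms by (intro permutes_swap_id) auto
  have "bij_betw (\<lambda>\<sigma>. ?t \<circ> \<sigma>) {\<sigma>. \<sigma> permutes ?S \<and> \<sigma> 0 = t} {\<sigma>. \<sigma> permutes ?S - {0}}"
  proof (rule bij_betw_byWitness[where f' = "\<lambda>\<sigma>. ?t \<circ> \<sigma>"])
    show "(\<lambda>\<sigma>. ?t \<circ> \<sigma>) ` {\<sigma>. \<sigma> permutes ?S \<and> \<sigma> 0 = t} \<subseteq> {\<sigma>. \<sigma> permutes ?S - {0}}"
    proof (clarify)
      fix \<sigma> assume s: "\<sigma> permutes ?S" "t = \<sigma> 0"
      have "transpose 0 (\<sigma> 0) \<circ> \<sigma> permutes ?S" using permutes_compose[OF s(1) p] s(2) by simp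
      then show "transpose 0 (\<sigma> 0) \<circ> \<sigma> permutes ?S - {0}" by (rule permutes_superset) auto
    qed
    show "(\<lambda>\<sigma>. ?t \<circ> \<sigma>) ` {\<sigma>. \<sigma> permutes ?S - {0}} \<subseteq> {\<sigma>. \<sigma> permutes ?S \<and> \<sigma> 0 = t}"
    proof (clarify)
      fix \<sigma> assume s: "\<sigma> permutes ?S - {0}"
      have "\<sigma> permutes ?S" by (rule permutes_subset[OF s]) auto
      moreover have "\<sigma> 0 = 0" using permutes_not_in[OF s] by simp
      ultimately show "?t \<circ> \<sigma> permutes ?S \<and> (?t \<circ> \<sigma>) 0 = t" using permutes_compose p by auto
    qed
  qed (auto simp: fun_eq_iff)
  then have "card {\<sigma>. \<sigma> permutes ?S \<and> \<sigma> 0 = t} = card {\<sigma>. \<sigma> permutes ?S - {0}}" by (rule bij_betw_same_card)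
  also have "\<dots> = fact m" by (rule card_permutations) auto
  finally show ?thesis .
qed

lemma altsign_upt: "altsign [i..<j] = (1 :: 'k::field)"
  by (rule altsign_sorted) auto

text \<open>The test coefficient of the inclusion. Only the letter 0 can be taken out of a power of
  0, so the Koszul sum has one term.\<close>

lemma koszul_wedge_value:
  "koszul (wedge (replicate_mset c 0) [0..<Suc m]) (wlabel (Suc c) (std_word (Suc c) m)) = (1 :: 'k::field)"
proof -
  have u: "0 # [1..<m + 1] = [0..<Suc m]" by (simp add: upt_conv_Cons)
  have "koszul v (label (replicate_mset (Suc c) 0) w) = v (label (replicate_mset c 0) (0 # w))"
    for v :: "nat multiset list \<Rightarrow> 'k" and w
    unfolding koszul_label by simp
  then show ?thesis unfolding wlabel_std_word u[symmetric] by (simp only: wedge_label u altsign_upt) simp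
qed

lemma permute_list_Cons:
  assumes "\<sigma> permutes {..<Suc m}" "length l = Suc m"
  obtains w where "permute_list \<sigma> l = l ! \<sigma> 0 # w"
proof -
  have "permute_list \<sigma> l ! 0 = l ! \<sigma> 0" using assms by (intro permute_list_nth) auto
  moreover have "length (permute_list \<sigma> l) = Suc m" using assms by simp
  ultimately show thesis using that by (cases "permute_list \<sigma> l") auto
qed

text \<open>On $S^{c+1} \otimes \Lambda^m$, this is \<open>m!\<close> times the de Rham differential.\<close>

definition deRham :: "nat \<Rightarrow> (nat multiset list \<Rightarrow> 'k::field) \<Rightarrow> (nat multiset list \<Rightarrow> 'k)" where
  "deRham m v = altern (Suc m) (comult v)"

text \<open>Each of the (m + 1)! permutations contributes 1, and the m! with
  \<open>\<sigma> 0 = 0\<close> contribute \<open>c\<close> more, from the exponent of the letter 0.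
  The total m! (m + 1 + c) contains the degree as a factor; in degree p it vanishes.\<close>

lemma deRham_value_same:
  "deRham m (koszul (wedge (replicate_mset c 0) [0..<Suc m])) (label (replicate_mset c 0) [0..<Suc m])
    = (of_nat (fact m) * of_nat (Suc c + m) :: 'k::field)"
proof -
  let ?N = "replicate_mset c (0::nat)" and ?l = "[0..<Suc m]" and ?P = "{\<sigma>. \<sigma> permutes {..<Suc m}}"
  let ?x = "wedge ?N ?l :: _ \<Rightarrow> 'k"
  have ll: "length ?l = Suc m" by simp
  have "deRham m (koszul ?x) (label ?N ?l) = (\<Sum>\<sigma>\<in>?P. of_int (sign \<sigma>) * comult (koszul ?x) (label ?N (permute_list \<sigma> ?l)))"
    unfolding deRham_def by (rule altern_label[OF ll])
  also have "\<dots> = (\<Sum>\<sigma>\<in>?P. 1 + (if \<sigma> 0 = 0 then of_nat c else 0))"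
  proof (rule sum.cong[OF refl])
    fix \<sigma> assume "\<sigma> \<in> ?P"
    then have s: "\<sigma> permutes {..<Suc m}" by simp
    define j where "j = \<sigma> 0"
    have "j < Suc m" using permutes_in_image[OF s, of 0] by (simp add: j_def)
    then have lj: "?l ! \<sigma> 0 = j" using nth_upt[of 0 j "Suc m"] by (simp add: j_def)
    obtain w where w: "permute_list \<sigma> ?l = j # w" using permute_list_Cons[OF s ll] lj by metis
    have "mset (permute_list \<sigma> ?l) = mset ?l" using s by simp
    then have ms: "mset (j # w) = mset ?l" unfolding w .
    have sg: "altsign (j # w) = (of_int (sign \<sigma>) :: 'k)"
      using altsign_permute[of \<sigma> ?l, where 'a = 'k] s unfolding w altsign_upt by simp
    have "koszul ?x (label (add_mset j ?N) w) = (\<Sum>i\<in>set_mset (add_mset j ?N). if i = j then of_int (sign \<sigma>) else 0)"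
      unfolding koszul_label
    proof (rule sum.cong[OF refl])
      fix i assume i: "i \<in># add_mset j ?N"
      have "add_mset j ?N - {#i#} = ?N \<longleftrightarrow> i = j"
      proof
        assume "add_mset j ?N - {#i#} = ?N"
        then have "add_mset i ?N = add_mset j ?N" using insert_DiffM[OF i] by simp
        then have "count (add_mset i ?N) i = count (add_mset j ?N) i" by simp
        then show "i = j" by (auto split: if_splits)
      qed simp
      then show "?x (label (add_mset j ?N - {#i#}) (i # w)) = (if i = j then of_int (sign \<sigma>) else 0)"
        unfolding wedge_label altsign_upt using ms sg by auto
    qed
    also have "\<dots> = of_int (sign \<sigma>)" by simp
    finally have "of_int (sign \<sigma>) * comult (koszul ?x) (label ?N (permute_list \<sigma> ?l)) = (of_nat (Suc (count ?N j)) :: 'k)"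
      unfolding w comult_label by (simp add: mult.left_commute)
    then show "of_int (sign \<sigma>) * comult (koszul ?x) (label ?N (permute_list \<sigma> ?l)) = 1 + (if \<sigma> 0 = 0 then of_nat c else 0 :: 'k)"
      unfolding j_def by simp
  qed
  also have "\<dots> = of_nat (card ?P) + of_nat (card {\<sigma>. \<sigma> permutes {..<Suc m} \<and> \<sigma> 0 = 0}) * of_nat c"
  proof -
    have "?P \<inter> {\<sigma>. \<sigma> 0 = 0} = {\<sigma>. \<sigma> permutes {..<Suc m} \<and> \<sigma> 0 = 0}" by blast
    then show ?thesis by (simp add: sum.distrib sum.If_cases finite_permutations)
  qed
  also have "\<dots> = of_nat (fact m) * of_nat (Suc c + m)"
  proof -
    have "card ?P = fact (Suc m)" by (rule card_permutations) auto
    then have "card ?P + card {\<sigma>. \<sigma> permutes {..<Suc m} \<and> \<sigma> 0 = 0} * c = fact m * (Suc c + m)"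
      using card_permutes_fixed[of 0 m] by (simp add: algebra_simps)
    from arg_cong[OF this, of "of_nat :: nat \<Rightarrow> 'k"] show ?thesis
      by (simp only: of_nat_add of_nat_mult)
  qed
  finally show ?thesis .
qed

text \<open>The symmetric factor of the wedge contains \<open>Suc m\<close>, so only the m!
  permutations that put \<open>Suc m\<close> first contribute. Each gives (-1)^m, because
  \<open>Suc m\<close> then stands before m smaller letters.\<close>

lemma deRham_value_next:
  "deRham m (koszul (wedge (add_mset (Suc m) (replicate_mset c 0)) [0..<Suc m])) (wlabel (Suc c) (std_word (Suc c) (Suc m)))
    = ((- 1) ^ m * of_nat (fact m) :: 'k::field)"
proof -
  let ?N = "replicate_mset (Suc c) (0::nat)" and ?l = "[1..<Suc m + 1]" and ?P = "{\<sigma>. \<sigma> permutes {..<Suc m}}"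
  let ?Mx = "add_mset (Suc m) (replicate_mset c 0)" and ?lx = "[0..<Suc m]"
  let ?x = "wedge ?Mx ?lx :: _ \<Rightarrow> 'k"
  have ll: "length ?l = Suc m" by simp
  have "deRham m (koszul ?x) (label ?N ?l) = (\<Sum>\<sigma>\<in>?P. of_int (sign \<sigma>) * comult (koszul ?x) (label ?N (permute_list \<sigma> ?l)))"
    unfolding deRham_def by (rule altern_label[OF ll])
  also have "\<dots> = (\<Sum>\<sigma>\<in>?P. if \<sigma> 0 = m then (- 1) ^ m else 0)"
  proof (rule sum.cong[OF refl])
    fix \<sigma> assume "\<sigma> \<in> ?P"
    then have s: "\<sigma> permutes {..<Suc m}" by simp
    define j where "j = Suc (\<sigma> 0)"
    have "\<sigma> 0 < Suc m" using permutes_in_image[OF s, of 0] by simp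
    then have "?l ! \<sigma> 0 = 1 + \<sigma> 0" by (intro nth_upt) simp
    then have lj: "?l ! \<sigma> 0 = j" by (simp add: j_def)
    obtain w where w: "permute_list \<sigma> ?l = j # w" using permute_list_Cons[OF s ll] lj by metis
    have "mset (permute_list \<sigma> ?l) = mset ?l" using s by simp
    then have ms: "mset (j # w) = mset ?l" unfolding w .
    have sg: "altsign (j # w) = (of_int (sign \<sigma>) :: 'k)"
      using altsign_permute[of \<sigma> ?l, where 'a = 'k] s unfolding w altsign_upt by simp
    have "koszul ?x (label (add_mset j ?N) w) = (\<Sum>i\<in>{0, j}. ?x (label (add_mset j ?N - {#i#}) (i # w)))"
      unfolding koszul_label by (rule sum.cong) (auto simp: j_def)
    also have "\<dots> = ?x (label (add_mset j (replicate_mset c 0)) (0 # w)) + ?x (label ?N (j # w))"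
      by (simp add: j_def add_mset_commute)
    also have "?x (label ?N (j # w)) = 0"
    proof -
      have "?N \<noteq> ?Mx" by (metis count_replicate_mset count_add_mset nat.distinct(1))
      then show ?thesis by (simp add: wedge_label)
    qed
    also have "?x (label (add_mset j (replicate_mset c 0)) (0 # w)) = (if \<sigma> 0 = m then (- 1) ^ m * of_int (sign \<sigma>) else 0)"
    proof (cases "\<sigma> 0 = m")
      case True
      then have jm: "j = Suc m" by (simp add: j_def)
      have "mset ?l = add_mset (Suc m) (mset [1..<Suc m])" by (simp add: upt_Suc)
      then have mw: "mset w = mset [1..<Suc m]" using ms jm by simp
      then have m0: "mset (0 # w) = mset ?lx" by (simp add: upt_conv_Cons)
      have sw: "set w = {1..<Suc m}" using mset_eq_setD[OF mw] by simp
      have "length w = m" using mset_eq_length[OF mw] by simp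
      moreover have "filter (\<lambda>y. y < Suc m) w = w" using sw by (intro filter_True) auto
      ultimately have "altsign (j # w) = ((- 1) ^ m * altsign w :: 'k)"
        using sw jm by (simp add: altsign_Cons)
      then have "altsign w = ((- 1) ^ m * of_int (sign \<sigma>) :: 'k)"
        using sg by (metis (no_types, lifting) left_minus_one_mult_self)
      moreover have "altsign (0 # w) = (altsign w :: 'k)" using sw by (simp add: altsign_Cons)
      ultimately show ?thesis using True jm m0 by (simp add: wedge_label altsign_upt)
    next
      case False
      then have "add_mset j (replicate_mset c 0) \<noteq> ?Mx" by (simp add: j_def)
      then show ?thesis using False by (simp add: wedge_label)
    qed
    finally have k: "koszul ?x (label (add_mset j ?N) w) = (if \<sigma> 0 = m then (- 1) ^ m * of_int (sign \<sigma>) else 0)" by simp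
    have "count ?N j = 0" by (simp add: j_def)
    then show "of_int (sign \<sigma>) * comult (koszul ?x) (label ?N (permute_list \<sigma> ?l)) = (if \<sigma> 0 = m then (- 1) ^ m else 0 :: 'k)"
      unfolding w comult_label k by (simp add: mult.left_commute)
  qed
  also have "\<dots> = (- 1) ^ m * of_nat (fact m)"
  proof -
    have "?P \<inter> {\<sigma>. \<sigma> 0 = m} = {\<sigma>. \<sigma> permutes {..<Suc m} \<and> \<sigma> 0 = m}" by blast
    then show ?thesis using card_permutes_fixed[of m m]
      by (simp add: sum.If_cases finite_permutations del: of_nat_fact)
  qed
  finally show ?thesis unfolding wlabel_std_word .
qed

section \<open>Injective resolutions\<close>

global_interpretation fam_vs: vector_space "family_scale :: 'k::field \<Rightarrow> ('l, 'm, 'k) family \<Rightarrow> ('l, 'm, 'k) family"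
  by unfold_locales
    (auto simp: family_scale_def fun_eq_iff vscale_apply distrib_left distrib_right mult.assoc)

lemma family_scale_apply: "family_scale c f n v = vscale c (f n v)"
  by (simp add: family_scale_def)

lemma comp_family_apply: "comp_family g f n v = g n (f n v)"
  by (simp add: comp_family_def)

lemma comp_family_assoc: "comp_family h (comp_family g f) = comp_family (comp_family h g) f"
  by (simp add: comp_family_def)

lemma Hom_zero_family: "strict_poly_functor e F \<Longrightarrow> strict_poly_functor e G \<Longrightarrow> 0 \<in> Hom e F G"
proof (rule HomI)
  fix n assume G: "strict_poly_functor e G"
  have "0 \<in> obj G n" using fun_vs.subspace_0[OF strict_subspace[OF G]] .
  then show "linear_between (obj F n) (obj G n) (0 n)" unfolding linear_between_def
    by (auto simp: fun_vs.scale_zero_right simp del: zero_fun_apply) (auto simp: vscale_apply fun_eq_iff)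
next
  fix m n \<alpha> v assume G: "strict_poly_functor e G" and a: "\<alpha> \<in> expos m n e"
  have "coef G m n \<alpha> 0 = 0" using linear_between_zero[OF strict_linear_between[OF G a] strict_subspace[OF G]] .
  then show "0 m (coef F m n \<alpha> v) = coef G m n \<alpha> (0 n v)" by (metis zero_fun_apply)
qed simp

lemma Hom_add_scale:
  assumes G: "strict_poly_functor e G" and f: "f \<in> Hom e F G" and g: "g \<in> Hom e F G"
  shows "f + family_scale c g \<in> Hom e F G"
proof (rule HomI)
  fix n
  have s: "fun_vs.subspace (obj G n)" using strict_subspace[OF G] .
  show "linear_between (obj F n) (obj G n) ((f + family_scale c g) n)"
    unfolding linear_between_def
  proof (intro conjI ballI allI)
    show "(f + family_scale c g) n ` obj F n \<subseteq> obj G n"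
      using Hom_in[OF f] Hom_in[OF g] s
      by (auto simp: family_scale_apply intro!: fun_vs.subspace_add fun_vs.subspace_scale)
  next
    fix x y assume x: "x \<in> obj F n" "y \<in> obj F n"
    show "(f + family_scale c g) n (x + y) = (f + family_scale c g) n x + (f + family_scale c g) n y"
      unfolding plus_fun_apply family_scale_apply Hom_add[OF f x] Hom_add[OF g x]
      by (rule ext) (simp add: vscale_apply distrib_left)
  next
    fix a x assume x: "x \<in> obj F n"
    show "(f + family_scale c g) n (vscale a x) = vscale a ((f + family_scale c g) n x)"
      unfolding plus_fun_apply family_scale_apply Hom_scale[OF f x] Hom_scale[OF g x]
      by (rule ext) (simp add: vscale_apply distrib_left mult.left_commute)
  qed
next
  fix n v assume v: "v \<notin> obj F n"
  show "(f + family_scale c g) n v = 0"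
    unfolding plus_fun_apply family_scale_apply Hom_outside[OF f v] Hom_outside[OF g v]
    by (rule ext) (simp add: vscale_apply)
next
  fix m n \<alpha> v assume a: "\<alpha> \<in> expos m n e" and v: "v \<in> obj F n"
  note fg = Hom_in[OF f v] Hom_in[OF g v]
  have "vscale c (g n v) \<in> obj G n" using fun_vs.subspace_scale[OF strict_subspace[OF G] fg(2)] .
  then have "coef G m n \<alpha> (f n v + vscale c (g n v)) = coef G m n \<alpha> (f n v) + vscale c (coef G m n \<alpha> (g n v))"
    using strict_linear_between[OF G a] fg unfolding linear_between_def by metis
  then show "(f + family_scale c g) m (coef F m n \<alpha> v) = coef G m n \<alpha> ((f + family_scale c g) n v)"
    unfolding plus_fun_apply family_scale_apply Hom_natural[OF f a v] Hom_natural[OF g a v] by simp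
qed

lemma Hom_scale_family:
  "strict_poly_functor e F \<Longrightarrow> strict_poly_functor e G \<Longrightarrow> g \<in> Hom e F G \<Longrightarrow> family_scale c g \<in> Hom e F G"
  using Hom_add_scale[OF _ Hom_zero_family, of e G F g c] by simp

lemma Hom_minus_family:
  "strict_poly_functor e G \<Longrightarrow> f \<in> Hom e F G \<Longrightarrow> g \<in> Hom e F G \<Longrightarrow> f - g \<in> Hom e F G"
  using Hom_add_scale[of e G f F g "- 1"] by (simp add: fam_vs.scale_minus_left)

lemma Hom_in_all: "strict_poly_functor e G \<Longrightarrow> f \<in> Hom e F G \<Longrightarrow> f n v \<in> obj G n"
  using Hom_in[of f e F G v n] Hom_outside[of f e F G v n] fun_vs.subspace_0[OF strict_subspace] by metis

lemma comp_family_add_right: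
  assumes "strict_poly_functor e G" "f \<in> Hom e F G" "f' \<in> Hom e F G" "g \<in> Hom e G H"
  shows "comp_family g (f + f') = comp_family g f + comp_family g f'"
  unfolding comp_family_def plus_fun_def[of f f']
  using Hom_add[OF assms(4) Hom_in_all[OF assms(1,2)] Hom_in_all[OF assms(1,3)]]
  by (intro ext) simp

lemma comp_family_scale_right:
  assumes "strict_poly_functor e G" "f \<in> Hom e F G" "g \<in> Hom e G H"
  shows "comp_family g (family_scale c f) = family_scale c (comp_family g f)"
  unfolding comp_family_def family_scale_def
  using Hom_scale[OF assms(3) Hom_in_all[OF assms(1,2)]] by (intro ext) simp

lemma comp_family_zero_right:
  assumes "strict_poly_functor e G" "g \<in> Hom e G H"
  shows "comp_family g 0 = 0"
  unfolding comp_family_def using Hom_zero[OF assms] by (intro ext) simp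

text \<open>Injectivity speaks of monomorphisms. Since \<open>h\<close> vanishes on the kernel of
  \<open>d\<close>, it factors through the image of \<open>d\<close>, a subfunctor of
  \<open>B\<close>, and is extended along the inclusion of that image.\<close>

lemma injective_extend:
  fixes A B J :: "('l, 'k::field) spf"
  assumes J: "injective_spf e J" and A: "strict_poly_functor e A" and B: "strict_poly_functor e B"
    and d: "d \<in> Hom e A B" and h: "h \<in> Hom e A J"
    and ker: "\<And>n v. v \<in> obj A n \<Longrightarrow> d n v = 0 \<Longrightarrow> h n v = 0"
  obtains g where "g \<in> Hom e B J" "comp_family g d = h"
proof -
  have sJ: "strict_poly_functor e J" using J unfolding injective_spf_def by blast
  define F where "F = \<lparr>obj = \<lambda>n. d n ` obj A n, coef = coef B\<rparr>"
  have oF: "obj F n = d n ` obj A n" and cF: "coef F = coef B" for n by (simp_all add: F_def)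
  have F: "strict_poly_functor e F"
    unfolding F_def
  proof (rule strict_poly_subfunctor[OF B])
    fix n
    obtain d' where d': "lin d'" "\<And>v. v \<in> obj A n \<Longrightarrow> d' v = d n v"
      using linear_between_extend[OF Hom_linear[OF d] strict_subspace[OF A]] by blast
    have "d n ` obj A n = d' ` obj A n" using d'(2) by auto
    then show "fun_vs.subspace (d n ` obj A n)"
      using fun_vsp.linear_subspace_image[OF d'(1) strict_subspace[OF A]] by simp
    show "d n ` obj A n \<subseteq> obj B n" using Hom_in[OF d] by blast
  next
    fix m n \<alpha> v assume a: "\<alpha> \<in> expos m n e" and "v \<in> d n ` obj A n"
    then obtain x where x: "x \<in> obj A n" "v = d n x" by blast
    then have "coef B m n \<alpha> v = d m (coef A m n \<alpha> x)" using Hom_natural[OF d a] by simp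
    then show "coef B m n \<alpha> v \<in> d m ` obj A m" using strict_coef_in[OF A a x(1)] by blast
  qed
  define i where "i = restrict_family F (\<lambda>v. v)"
  have i: "i \<in> Hom e F B"
    unfolding i_def
  proof (rule restrict_family_Hom[OF F])
    show "lin (\<lambda>v. v :: 'l \<Rightarrow> 'k)" by (simp add: lin_iff)
  qed (use oF cF Hom_in[OF d] in auto)
  have mi: "monic F i" unfolding monic_def i_def restrict_family_def by (auto simp: inj_on_def)
  \<comment> \<open>Any preimage may be chosen, as two of them differ by an element of the kernel of
    \<open>d\<close>.\<close>
  define h' where "h' n y = (if y \<in> obj F n then h n (SOME x. x \<in> obj A n \<and> d n x = y) else 0)" for n y
  have h'd: "h' n (d n x) = h n x" if x: "x \<in> obj A n" for n x
  proof -
    define x' where "x' = (SOME x'. x' \<in> obj A n \<and> d n x' = d n x)"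
    have x': "x' \<in> obj A n" "d n x' = d n x"
      using someI[of "\<lambda>x'. x' \<in> obj A n \<and> d n x' = d n x" x] x unfolding x'_def by blast+
    have nx: "vscale (- 1) x \<in> obj A n" using fun_vs.subspace_scale[OF strict_subspace[OF A] x] .
    have s: "x' + vscale (- 1) x \<in> obj A n" using fun_vs.subspace_add[OF strict_subspace[OF A] x'(1) nx] .
    have "d n (x' + vscale (- 1) x) = d n x' + vscale (- 1) (d n x)"
      unfolding Hom_add[OF d x'(1) nx] Hom_scale[OF d x] ..
    then have "d n (x' + vscale (- 1) x) = 0" unfolding x'(2) by (simp add: fun_vs.scale_minus_left)
    then have "h n (x' + vscale (- 1) x) = 0" using ker[OF s] by blast
    then have "h n x' + vscale (- 1) (h n x) = 0"
      unfolding Hom_add[OF h x'(1) nx] Hom_scale[OF h x] .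
    then have "h n x' = h n x" by (simp add: fun_vs.scale_minus_left)
    then show ?thesis unfolding h'_def x'_def oF using x by simp
  qed
  have h': "h' \<in> Hom e F J"
  proof (rule HomI)
    fix n
    show "linear_between (obj F n) (obj J n) (h' n)"
      unfolding linear_between_def
    proof (intro conjI ballI allI)
      show "h' n ` obj F n \<subseteq> obj J n" unfolding oF using h'd Hom_in[OF h] by auto
    next
      fix x y assume "x \<in> obj F n" "y \<in> obj F n"
      then obtain x' y' where x: "x' \<in> obj A n" "x = d n x'" "y' \<in> obj A n" "y = d n y'" unfolding oF by blast
      have "h' n (x + y) = h' n (d n (x' + y'))" using Hom_add[OF d x(1,3)] x by simp
      also have "\<dots> = h n (x' + y')" using fun_vs.subspace_add[OF strict_subspace[OF A] x(1,3)] by (rule h'd)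
      also have "\<dots> = h n x' + h n y'" by (rule Hom_add[OF h x(1,3)])
      finally show "h' n (x + y) = h' n x + h' n y" unfolding x(2,4) h'd[OF x(1)] h'd[OF x(3)] .
    next
      fix c x assume "x \<in> obj F n"
      then obtain x' where x: "x' \<in> obj A n" "x = d n x'" unfolding oF by blast
      have "h' n (vscale c x) = h' n (d n (vscale c x'))" using Hom_scale[OF d x(1)] x by simp
      also have "\<dots> = h n (vscale c x')" using fun_vs.subspace_scale[OF strict_subspace[OF A] x(1)] by (rule h'd)
      also have "\<dots> = vscale c (h n x')" by (rule Hom_scale[OF h x(1)])
      finally show "h' n (vscale c x) = vscale c (h' n x)" unfolding x(2) h'd[OF x(1)] .
    qed
  next
    fix m n \<alpha> v assume a: "\<alpha> \<in> expos m n e" and "v \<in> obj F n"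
    then obtain x where x: "x \<in> obj A n" "v = d n x" unfolding oF by blast
    have "h' m (coef F m n \<alpha> v) = h' m (d m (coef A m n \<alpha> x))"
      unfolding cF x(2) Hom_natural[OF d a x(1)] ..
    also have "\<dots> = h m (coef A m n \<alpha> x)" by (rule h'd[OF strict_coef_in[OF A a x(1)]])
    also have "\<dots> = coef J m n \<alpha> (h n x)" by (rule Hom_natural[OF h a x(1)])
    finally show "h' m (coef F m n \<alpha> v) = coef J m n \<alpha> (h' n v)" unfolding x(2) h'd[OF x(1)] .
  qed (simp add: h'_def)
  obtain g where g: "g \<in> Hom e B J" "comp_family g i = h'"
    using J F B i mi h' unfolding injective_spf_def by blast
  have "comp_family g d = h"
  proof (intro ext)
    fix n v L
    show "comp_family g d n v L = h n v L"
    proof (cases "v \<in> obj A n")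
      case True
      then have "d n v \<in> obj F n" unfolding oF by blast
      then have "i n (d n v) = d n v" unfolding i_def by (rule restrict_family_in)
      then have "g n (d n v) = comp_family g i n (d n v)" by (simp add: comp_family_apply)
      also have "\<dots> = h n v" unfolding g(2) using h'd True by blast
      finally show ?thesis by (simp add: comp_family_apply)
    next
      case False
      show ?thesis
        unfolding comp_family_apply Hom_outside[OF d False] Hom_outside[OF h False] Hom_zero[OF B g(1)] ..
    qed
  qed
  then show thesis using that g(1) by blast
qed

section \<open>Comparison of injective resolutions\<close>

lemma injective_strict: "injective_spf e J \<Longrightarrow> strict_poly_functor e J"
  unfolding injective_spf_def by blast

lemma exact_atD:
  assumes "exact_at F f G g"
  shows "v \<in> obj F n \<Longrightarrow> g n (f n v) = 0" "w \<in> obj G n \<Longrightarrow> g n w = 0 \<Longrightarrow> \<exists>v\<in>obj F n. w = f n v"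
  using assms unfolding exact_at_def by blast+

lemma resolution_chain_map:
  fixes G :: "('l, 'k::field) spf"
  assumes G: "strict_poly_functor e G"
    and R: "injective_resolution e G (J, \<epsilon>, d)" and R': "injective_resolution e G (J', \<epsilon>', d')"
  obtains f where "\<And>q. f q \<in> Hom e (J q) (J' q)" "comp_family (f 0) \<epsilon> = \<epsilon>'"
    "\<And>q. comp_family (f (Suc q)) (d q) = comp_family (d' q) (f q)"
proof -
  have J: "strict_poly_functor e (J q)" and iJ': "injective_spf e (J' q)" and J': "strict_poly_functor e (J' q)"
    and d: "d q \<in> Hom e (J q) (J (Suc q))" and d': "d' q \<in> Hom e (J' q) (J' (Suc q))"
    and ex: "exact_at (J q) (d q) (J (Suc q)) (d (Suc q))"
    and ex': "exact_at (J' q) (d' q) (J' (Suc q)) (d' (Suc q))" for q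
    using R R' injective_strict by auto
  have eps: "\<epsilon> \<in> Hom e G (J 0)" "\<epsilon>' \<in> Hom e G (J' 0)" "monic G \<epsilon>"
    "exact_at G \<epsilon> (J 0) (d 0)" "exact_at G \<epsilon>' (J' 0) (d' 0)"
    using R R' by auto
  \<comment> \<open>The recursion carries along that \<open>x\<close> sends cycles to cycles:
    \<open>comp_family (d' q) x\<close> then kills the kernel of \<open>d q\<close>, as
    \<open>injective_extend\<close> requires for the next map.\<close>
  let ?P = "\<lambda>q x. x \<in> Hom e (J q) (J' q) \<and>
    (\<forall>n. \<forall>v\<in>obj (J q) n. d q n v = 0 \<longrightarrow> d' q n (x n v) = 0) \<and> (q = 0 \<longrightarrow> comp_family x \<epsilon> = \<epsilon>')"
  have "\<exists>f. \<forall>q. ?P q (f q) \<and> comp_family (f (Suc q)) (d q) = comp_family (d' q) (f q)"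
  proof (rule dependent_nat_choice)
    have k: "\<epsilon>' n v = 0" if v: "v \<in> obj G n" "\<epsilon> n v = 0" for n v
    proof -
      have "\<epsilon> n v = \<epsilon> n 0" using v Hom_zero[OF G eps(1)] by simp
      then have "v = 0" using eps(3) v(1) fun_vs.subspace_0[OF strict_subspace[OF G]]
        unfolding monic_def inj_on_def by blast
      then show ?thesis using Hom_zero[OF G eps(2)] by simp
    qed
    obtain x where x: "x \<in> Hom e (J 0) (J' 0)" "comp_family x \<epsilon> = \<epsilon>'"
      using injective_extend[OF iJ' G J eps(1,2) k] by blast
    have "d' 0 n (x n v) = 0" if v: "v \<in> obj (J 0) n" "d 0 n v = 0" for n v
    proof -
      obtain u where u: "u \<in> obj G n" "v = \<epsilon> n u" using exact_atD(2)[OF eps(4) v] by blast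
      have "x n v = \<epsilon>' n u" unfolding u(2) x(2)[symmetric] comp_family_apply ..
      then show ?thesis using exact_atD(1)[OF eps(5) u(1)] by simp
    qed
    then show "\<exists>x. ?P 0 x" using x by blast
  next
    fix x q assume P: "?P q x"
    have c: "comp_family (d' q) x \<in> Hom e (J q) (J' (Suc q))" using Hom_comp P d' J' by blast
    obtain y where y: "y \<in> Hom e (J (Suc q)) (J' (Suc q))" "comp_family y (d q) = comp_family (d' q) x"
    proof (rule injective_extend[OF iJ' J J d c])
      fix n v assume "v \<in> obj (J q) n" "d q n v = 0"
      then show "comp_family (d' q) x n v = 0" unfolding comp_family_apply using P by blast
    qed
    have "d' (Suc q) n (y n v) = 0" if v: "v \<in> obj (J (Suc q)) n" "d (Suc q) n v = 0" for n v
    proof -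
      obtain u where u: "u \<in> obj (J q) n" "v = d q n u" using exact_atD(2)[OF ex v] by blast
      have "y n v = comp_family (d' q) x n u" unfolding u(2) y(2)[symmetric] comp_family_apply ..
      then show ?thesis using exact_atD(1)[OF ex'] Hom_in[of x e "J q" "J' q"] P u(1) by (simp add: comp_family_apply)
    qed
    then show "\<exists>y. ?P (Suc q) y \<and> comp_family y (d q) = comp_family (d' q) x" using y by blast
  qed
  then show thesis using that by blast
qed

text \<open>A chain map that lifts the identity of \<open>G\<close> is homotopic to the identity.
  Only its effect on cocycles is wanted, so the homotopy is found for each degree separately,
  without a coherent choice in all degrees.\<close>

lemma resolution_homotopy:
  fixes G :: "('l, 'k::field) spf"
  assumes R: "injective_resolution e G (J, \<epsilon>, d)" and F: "strict_poly_functor e F"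
    and f: "\<And>q. f q \<in> Hom e (J q) (J q)" "comp_family (f 0) \<epsilon> = \<epsilon>"
      "\<And>q. comp_family (f (Suc q)) (d q) = comp_family (d q) (f q)"
    and z: "z \<in> cocycles e F (J, \<epsilon>, d) q"
  shows "comp_family (f q) z - z \<in> coboundaries e F (J, \<epsilon>, d) q"
proof -
  have iJ: "injective_spf e (J q)" and J: "strict_poly_functor e (J q)"
    and d: "d q \<in> Hom e (J q) (J (Suc q))"
    and ex: "exact_at (J q) (d q) (J (Suc q)) (d (Suc q))" for q
    using R injective_strict by auto
  have eps: "\<epsilon> \<in> Hom e G (J 0)" "exact_at G \<epsilon> (J 0) (d 0)" using R by auto
  define u where "u q = f q - restrict_family (J q) (\<lambda>v. v)" for q
  have u_app: "u q n v = f q n v - v" if "v \<in> obj (J q) n" for q n v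
    unfolding u_def using that by (simp add: restrict_family_def)
  have u: "u q \<in> Hom e (J q) (J q)" for q
    unfolding u_def
  proof (rule Hom_minus_family[OF J f(1)])
    show "restrict_family (J q) (\<lambda>v. v) \<in> Hom e (J q) (J q)"
      by (rule restrict_family_Hom[OF J]) (auto simp: lin_iff)
  qed
  have ud: "u (Suc q) n (d q n x) = d q n (u q n x)" if x: "x \<in> obj (J q) n" for q n x
  proof -
    have dx: "d q n x \<in> obj (J (Suc q)) n" using Hom_in[OF d x] .
    have fx: "f q n x \<in> obj (J q) n" using Hom_in[OF f(1) x] .
    have nx: "vscale (- 1) x \<in> obj (J q) n" using fun_vs.subspace_scale[OF strict_subspace[OF J] x] .
    have "f (Suc q) n (d q n x) = d q n (f q n x)"
      using f(3)[of q] unfolding comp_family_def by metis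
    moreover have "d q n (f q n x + vscale (- 1) x) = d q n (f q n x) + vscale (- 1) (d q n x)"
      unfolding Hom_add[OF d fx nx] Hom_scale[OF d x] ..
    ultimately show ?thesis unfolding u_app[OF dx] u_app[OF x] by (simp add: fun_vs.scale_minus_left)
  qed
  \<comment> \<open>In a homotopy formula u = h' d + d h, \<open>w\<close> is the summand h' d. It
    is kept as a map that kills the cycles; \<open>injective_extend\<close> factors it through
    \<open>d q\<close> when the next degree is treated.\<close>
  let ?P = "\<lambda>q w. w \<in> Hom e (J q) (J q) \<and> (\<forall>n. \<forall>v\<in>obj (J q) n. d q n v = 0 \<longrightarrow> w n v = 0) \<and>
    (case q of 0 \<Rightarrow> u q = w | Suc q' \<Rightarrow> \<exists>h\<in>Hom e (J q) (J q'). u q = w + comp_family (d q') h)"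
  have "\<exists>w. ?P q w" for q
  proof (induction q)
    case 0
    have "u 0 n v = 0" if v: "v \<in> obj (J 0) n" "d 0 n v = 0" for n v
    proof -
      obtain x where "x \<in> obj G n" "v = \<epsilon> n x" using exact_atD(2)[OF eps(2) v] by blast
      then have "f 0 n v = v" using f(2) unfolding comp_family_def by metis
      then show ?thesis using u_app[OF v(1)] by simp
    qed
    then show ?case using u by (intro exI[of _ "u 0"] conjI allI ballI impI) (simp_all only: nat.case)
  next
    case (Suc q)
    then obtain w where w: "w \<in> Hom e (J q) (J q)" "\<And>n v. v \<in> obj (J q) n \<Longrightarrow> d q n v = 0 \<Longrightarrow> w n v = 0"
      "case q of 0 \<Rightarrow> u q = w | Suc q' \<Rightarrow> \<exists>h\<in>Hom e (J q) (J q'). u q = w + comp_family (d q') h" by blast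
    obtain h where h: "h \<in> Hom e (J (Suc q)) (J q)" "comp_family h (d q) = w"
      using injective_extend[OF iJ J J d w(1,2)] by blast
    have duw: "d q n (u q n x) = d q n (w n x)" if x: "x \<in> obj (J q) n" for n x
    proof (cases q)
      case 0
      then show ?thesis using w(3) by simp
    next
      case (Suc q')
      then obtain h' where h': "h' \<in> Hom e (J q) (J q')" "u q = w + comp_family (d q') h'" using w(3) by auto
      have a: "w n x \<in> obj (J q) n" using Hom_in[OF w(1) x] .
      have b: "h' n x \<in> obj (J q') n" using Hom_in[OF h'(1) x] .
      have b': "d q' n (h' n x) \<in> obj (J q) n" using Hom_in[OF d b] Suc by simp
      have "d q n (d q' n (h' n x)) = 0" using exact_atD(1)[OF ex b] Suc by simp
      then show ?thesis
        unfolding h'(2) plus_fun_apply comp_family_apply Hom_add[OF d a b'] by simp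
    qed
    let ?w = "u (Suc q) - comp_family (d q) h"
    have dh: "comp_family (d q) h \<in> Hom e (J (Suc q)) (J (Suc q))" using Hom_comp[OF h(1) d J] .
    have "?w n v = 0" if v: "v \<in> obj (J (Suc q)) n" "d (Suc q) n v = 0" for n v
    proof -
      obtain x where x: "x \<in> obj (J q) n" "v = d q n x" using exact_atD(2)[OF ex v] by blast
      have "h n v = w n x" using h(2) x(2) unfolding comp_family_def by metis
      then have "comp_family (d q) h n v = d q n (w n x)" by (simp add: comp_family_apply)
      also have "\<dots> = u (Suc q) n v" unfolding x(2) ud[OF x(1)] duw[OF x(1)] ..
      finally show ?thesis by simp
    qed
    moreover have "u (Suc q) = ?w + comp_family (d q) h" by (rule diff_add_cancel[symmetric])
    ultimately show ?case
      using Hom_minus_family[OF J u dh] h(1)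
      by (intro exI[of _ ?w] conjI allI ballI impI) (simp_all only: nat.case, blast)
  qed
  then obtain w where w: "w \<in> Hom e (J q) (J q)" "\<And>n v. v \<in> obj (J q) n \<Longrightarrow> d q n v = 0 \<Longrightarrow> w n v = 0"
    "case q of 0 \<Rightarrow> u q = w | Suc q' \<Rightarrow> \<exists>h\<in>Hom e (J q) (J q'). u q = w + comp_family (d q') h" by blast
  have zH: "z \<in> Hom e F (J q)" and dz: "comp_family (d q) z = 0" using z by auto
  have zin: "z n v \<in> obj (J q) n" for n v using Hom_in_all[OF J zH] .
  have "d q n (z n v) = 0" for n v
    using fun_cong[OF fun_cong[OF dz, of n], of v] by (simp add: comp_family_apply)
  \<comment> \<open>A cocycle takes its values in the cycles, where \<open>w\<close>
    vanishes.\<close>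
  then have wz: "w n (z n v) = 0" for n v using w(2)[OF zin] by blast
  have fz: "comp_family (f q) z - z = comp_family (u q) z"
    by (intro ext) (simp add: comp_family_apply u_app[OF zin])
  show ?thesis
  proof (cases q)
    case 0
    then have "comp_family (u q) z = 0" using w(3) wz unfolding comp_family_def by (intro ext) simp
    then show ?thesis using fz 0 by simp
  next
    case (Suc q')
    then obtain h where h: "h \<in> Hom e (J q) (J q')" "u q = w + comp_family (d q') h" using w(3) by auto
    have "comp_family (u q) z = comp_family (d q') (comp_family h z)"
      unfolding h(2) comp_family_def using wz by (intro ext) simp
    moreover have "comp_family h z \<in> Hom e F (J q')" using Hom_comp[OF zH h(1) J] .
    ultimately show ?thesis using fz Suc by auto
  qed
qed

section \<open>Computing Ext\<close>

lemma subspace_Hom: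
  "strict_poly_functor e F \<Longrightarrow> strict_poly_functor e G \<Longrightarrow> fam_vs.subspace (Hom e F G)"
  unfolding fam_vs.subspace_def
  using Hom_zero_family Hom_scale_family Hom_add_scale[of e G _ F _ 1] by auto

lemma coset_eq_iff:
  assumes "fam_vs.subspace B"
  shows "x +o B = y +o B \<longleftrightarrow> x - y \<in> B"
proof
  assume "x +o B = y +o B"
  moreover have "x \<in> x +o B" using fam_vs.subspace_0[OF assms] unfolding elt_set_plus_def by force
  ultimately obtain b where "b \<in> B" "x = y + b" unfolding elt_set_plus_def by blast
  then show "x - y \<in> B" by simp
next
  assume xy: "x - y \<in> B"
  have yx: "y - x \<in> B" using fam_vs.subspace_diff[OF assms fam_vs.subspace_0[OF assms] xy] by simp
  show "x +o B = y +o B"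
  proof (intro equalityI subsetI)
    fix z assume "z \<in> x +o B"
    then obtain b where b: "b \<in> B" "z = x + b" unfolding elt_set_plus_def by blast
    have "z = y + ((x - y) + b)" using b by simp
    moreover have "(x - y) + b \<in> B" using fam_vs.subspace_add[OF assms xy b(1)] .
    ultimately show "z \<in> y +o B" unfolding elt_set_plus_def by blast
  next
    fix z assume "z \<in> y +o B"
    then obtain b where b: "b \<in> B" "z = y + b" unfolding elt_set_plus_def by blast
    have "z = x + ((y - x) + b)" using b by simp
    moreover have "(y - x) + b \<in> B" using fam_vs.subspace_add[OF assms yx b(1)] .
    ultimately show "z \<in> x +o B" unfolding elt_set_plus_def by blast
  qed
qed

lemma coset_add:
  assumes "fam_vs.subspace B"
  shows "(x +o B) + (y +o B) = (x + y) +o B"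
proof (intro equalityI subsetI)
  fix z assume "z \<in> (x +o B) + (y +o B)"
  then obtain a b where "a \<in> B" "b \<in> B" "z = (x + a) + (y + b)"
    unfolding set_plus_def elt_set_plus_def by blast
  then have "z = (x + y) + (a + b)" "a + b \<in> B" using fam_vs.subspace_add[OF assms] by (auto simp: algebra_simps)
  then show "z \<in> (x + y) +o B" unfolding elt_set_plus_def by blast
next
  fix z assume "z \<in> (x + y) +o B"
  then obtain b where "b \<in> B" "z = (x + b) + (y + 0)" unfolding elt_set_plus_def by (auto simp: algebra_simps)
  then show "z \<in> (x +o B) + (y +o B)"
    using fam_vs.subspace_0[OF assms] unfolding set_plus_def elt_set_plus_def by blast
qed

text \<open>Adding \<open>B\<close> matters for \<open>c = 0\<close>, where scaling alone shrinks
  the coset to a point.\<close>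

lemma coset_scale:
  assumes "fam_vs.subspace B"
  shows "family_scale c ` (x +o B) + B = family_scale c x +o B"
proof (intro equalityI subsetI)
  fix z assume "z \<in> family_scale c ` (x +o B) + B"
  then obtain a b where "a \<in> B" "b \<in> B" "z = family_scale c (x + a) + b"
    unfolding set_plus_def elt_set_plus_def by blast
  then have "z = family_scale c x + (family_scale c a + b)" "family_scale c a + b \<in> B"
    using fam_vs.subspace_add[OF assms] fam_vs.subspace_scale[OF assms]
    by (auto simp: fam_vs.scale_right_distrib add.assoc)
  then show "z \<in> family_scale c x +o B" unfolding elt_set_plus_def by blast
next
  fix z assume "z \<in> family_scale c x +o B"
  then obtain b where "b \<in> B" "z = family_scale c (x + 0) + b" unfolding elt_set_plus_def by auto
  then show "z \<in> family_scale c ` (x +o B) + B"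
    using fam_vs.subspace_0[OF assms] unfolding set_plus_def elt_set_plus_def by blast
qed

lemma quotient_zero:
  fixes B :: "('l, 'm, 'k::field) family set"
  assumes B: "fam_vs.subspace B"
  shows "quotient_space family_scale B B \<cong>\<^sub>k (zero_space :: ('k, 'k) kspace)"
proof -
  have "z +o B = 0 +o B" if "z \<in> B" for z using coset_eq_iff[OF B, of z 0] that by simp
  then have c: "(\<lambda>z. z +o B) ` B = {0 +o B}" using fam_vs.subspace_0[OF B] by blast
  show ?thesis
    unfolding kspace_iso_def quotient_space_def zero_space_def kspace.simps c
    by (rule exI[of _ "\<lambda>_. 0"]) (simp add: bij_betw_def)
qed

lemma quotient_line:
  fixes B :: "('l, 'm, 'k::field) family set"
  assumes B: "fam_vs.subspace B" and Z: "Z = {family_scale c z0 + b | c b. b \<in> B}" and z0: "z0 \<notin> B"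
  shows "quotient_space family_scale Z B \<cong>\<^sub>k (line_space :: ('k, 'k) kspace)"
proof -
  let ?t = "\<lambda>c. family_scale c z0 +o B"
  have car: "(\<lambda>z. z +o B) ` Z = range ?t"
  proof (intro equalityI subsetI)
    fix X assume "X \<in> (\<lambda>z. z +o B) ` Z"
    then obtain c b where "b \<in> B" "X = (family_scale c z0 + b) +o B" unfolding Z by blast
    then have "X = ?t c" using coset_eq_iff[OF B, of "family_scale c z0 + b" "family_scale c z0"] by simp
    then show "X \<in> range ?t" by blast
  next
    fix X assume "X \<in> range ?t"
    then obtain c where "X = ?t c" by blast
    moreover have "family_scale c z0 = family_scale c z0 + 0" by simp
    then have "family_scale c z0 \<in> Z" unfolding Z using fam_vs.subspace_0[OF B] by blast
    ultimately show "X \<in> (\<lambda>z. z +o B) ` Z" by blast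
  qed
  have inj: "inj ?t"
  proof (rule injI)
    fix c c' assume "?t c = ?t c'"
    then have "family_scale (c - c') z0 \<in> B"
      using coset_eq_iff[OF B] by (simp add: fam_vs.scale_left_diff_distrib)
    then have "c - c' \<noteq> 0 \<Longrightarrow> family_scale (inverse (c - c')) (family_scale (c - c') z0) \<in> B"
      using fam_vs.subspace_scale[OF B] by blast
    then show "c = c'" using z0 by (auto simp: fam_vs.scale_scale)
  qed
  have add: "?t c + ?t c' = ?t (c + c')" for c c'
    unfolding coset_add[OF B] by (simp add: fam_vs.scale_left_distrib)
  have scale: "family_scale a ` ?t c + B = ?t (a * c)" for a c
    unfolding coset_scale[OF B] by (simp add: fam_vs.scale_scale)
  show ?thesis
    unfolding kspace_iso_def quotient_space_def line_space_def kspace.simps car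
  proof (intro exI[of _ "inv ?t"] conjI ballI allI)
    show "bij_betw (inv ?t) (range ?t) UNIV" by (rule bij_betw_inv_into) (rule inj_on_imp_bij_betw[OF inj])
  next
    fix x y assume "x \<in> range ?t" "y \<in> range ?t"
    then obtain c c' where "x = ?t c" "y = ?t c'" by blast
    then show "inv ?t (x + y) = inv ?t x + inv ?t y" by (simp only: add inv_f_f[OF inj])
  next
    fix a x assume "x \<in> range ?t"
    then obtain c where "x = ?t c" by blast
    then show "inv ?t (family_scale a ` x + B) = a * inv ?t x" by (simp only: scale inv_f_f[OF inj])
  qed
qed

lemma subspace_coboundaries:
  assumes R: "injective_resolution e G (J, \<epsilon>, d)" and F: "strict_poly_functor e F"
  shows "fam_vs.subspace (coboundaries e F (J, \<epsilon>, d) q)"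
proof (cases q)
  case 0
  then show ?thesis using fam_vs.subspace_single_0 by simp
next
  case (Suc r)
  have J: "strict_poly_functor e (J q)" and d: "d q \<in> Hom e (J q) (J (Suc q))" for q
    using R injective_strict by auto
  note H = subspace_Hom[OF F J, of r]
  show ?thesis
    unfolding Suc coboundaries.simps fam_vs.subspace_def
  proof (intro conjI ballI allI)
    show "0 \<in> comp_family (d r) ` Hom e F (J r)"
      using comp_family_zero_right[OF J d, of r] fam_vs.subspace_0[OF H] by (metis imageI)
  next
    fix x y assume "x \<in> comp_family (d r) ` Hom e F (J r)" "y \<in> comp_family (d r) ` Hom e F (J r)"
    then obtain f f' where f: "f \<in> Hom e F (J r)" "f' \<in> Hom e F (J r)" "x = comp_family (d r) f" "y = comp_family (d r) f'" by blast
    have "x + y = comp_family (d r) (f + f')" unfolding f(3,4) comp_family_add_right[OF J f(1,2) d] ..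
    then show "x + y \<in> comp_family (d r) ` Hom e F (J r)" using fam_vs.subspace_add[OF H f(1,2)] by blast
  next
    fix c x assume "x \<in> comp_family (d r) ` Hom e F (J r)"
    then obtain f where f: "f \<in> Hom e F (J r)" "x = comp_family (d r) f" by blast
    have "family_scale c x = comp_family (d r) (family_scale c f)" unfolding f(2) comp_family_scale_right[OF J f(1) d] ..
    then show "family_scale c x \<in> comp_family (d r) ` Hom e F (J r)" using fam_vs.subspace_scale[OF H f(1)] by blast
  qed
qed

lemma coboundaries_subset_cocycles:
  assumes R: "injective_resolution e G (J, \<epsilon>, d)" and F: "strict_poly_functor e F"
  shows "coboundaries e F (J, \<epsilon>, d) q \<subseteq> cocycles e F (J, \<epsilon>, d) q"
proof
  have J: "strict_poly_functor e (J q)" and d: "d q \<in> Hom e (J q) (J (Suc q))"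
    and ex: "exact_at (J q) (d q) (J (Suc q)) (d (Suc q))" for q
    using R injective_strict by auto
  fix z assume z: "z \<in> coboundaries e F (J, \<epsilon>, d) q"
  show "z \<in> cocycles e F (J, \<epsilon>, d) q"
  proof (cases q)
    case 0
    then show ?thesis using z Hom_zero_family[OF F J] comp_family_zero_right[OF J d] by simp
  next
    case (Suc r)
    then obtain h where h: "h \<in> Hom e F (J r)" "z = comp_family (d r) h" using z by auto
    have "comp_family (d q) z = 0"
      unfolding h(2) Suc comp_family_def
      using exact_atD(1)[OF ex Hom_in_all[OF J h(1)]] by (intro ext) simp
    moreover have "z \<in> Hom e F (J q)" unfolding h(2) Suc by (rule Hom_comp[OF h(1) d J])
    ultimately show ?thesis by simp
  qed
qed

text \<open>\<open>Ext\<close> refers to a resolution chosen by \<open>SOME\<close>. The comparison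
  maps \<open>f\<close> and \<open>h\<close> between it and the given one are inverse up to
  homotopy. After \<open>Hom e F\<close>, all differentials of the given one are zero, so its Hom
  spaces are already the cohomology.\<close>

lemma Ext_by_resolution:
  fixes F G :: "('l, 'k::field) spf"
  assumes F: "strict_poly_functor e F" and G: "strict_poly_functor e G"
    and R: "injective_resolution e G (J, \<epsilon>, d)"
    and zd: "\<And>q f. f \<in> Hom e F (J q) \<Longrightarrow> comp_family (d q) f = 0"
  shows Ext_zero: "Hom e F (J q) = {0} \<Longrightarrow> Ext e q F G \<cong>\<^sub>k (zero_space :: ('k, 'k) kspace)"
    and Ext_line: "\<And>g. Hom e F (J q) = range (\<lambda>c. family_scale c g) \<Longrightarrow> g \<noteq> 0 \<Longrightarrow>
      Ext e q F G \<cong>\<^sub>k (line_space :: ('k, 'k) kspace)"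
proof -
  define R' where "R' = (SOME R. injective_resolution e G R)"
  have iR': "injective_resolution e G R'" unfolding R'_def using R by (rule someI)
  obtain J' \<epsilon>' d' where R'_eq: "R' = (J', \<epsilon>', d')" by (cases R') auto
  note R' = iR'[unfolded R'_eq]
  have J: "strict_poly_functor e (J q)" and d: "d q \<in> Hom e (J q) (J (Suc q))" for q
    using R injective_strict by auto
  have J': "strict_poly_functor e (J' q)" and d': "d' q \<in> Hom e (J' q) (J' (Suc q))" for q
    using R' injective_strict by auto
  obtain f where f: "\<And>q. f q \<in> Hom e (J' q) (J q)" "comp_family (f 0) \<epsilon>' = \<epsilon>"
    "\<And>q. comp_family (f (Suc q)) (d' q) = comp_family (d q) (f q)"
    using resolution_chain_map[OF G R' R] by metis
  obtain h where h: "\<And>q. h q \<in> Hom e (J q) (J' q)" "comp_family (h 0) \<epsilon> = \<epsilon>'"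
    "\<And>q. comp_family (h (Suc q)) (d q) = comp_family (d' q) (h q)"
    using resolution_chain_map[OF G R R'] by metis
  define Z B where "Z = cocycles e F R' q" and "B = coboundaries e F R' q"
  have Ext: "Ext e q F G = quotient_space family_scale Z B"
    by (simp add: Ext_def R'_def Z_def B_def Let_def)
  have B: "fam_vs.subspace B" unfolding B_def R'_eq by (rule subspace_coboundaries[OF R' F])
  have BZ: "B \<subseteq> Z" unfolding B_def Z_def R'_eq by (rule coboundaries_subset_cocycles[OF R' F])
  have hf: "comp_family (h q) (comp_family (f q) z) - z \<in> B" if "z \<in> Z" for z
    unfolding comp_family_assoc B_def R'_eq
  proof (rule resolution_homotopy[OF R' F])
    show "z \<in> cocycles e F (J', \<epsilon>', d') q" using that unfolding Z_def R'_eq .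
    show "comp_family (h q) (f q) \<in> Hom e (J' q) (J' q)" for q by (rule Hom_comp[OF f(1) h(1) J])
    show "comp_family (comp_family (h 0) (f 0)) \<epsilon>' = \<epsilon>'" unfolding comp_family_assoc[symmetric] f(2) h(2) ..
    show "comp_family (comp_family (h (Suc q)) (f (Suc q))) (d' q) = comp_family (d' q) (comp_family (h q) (f q))" for q
      unfolding comp_family_assoc[symmetric] f(3) unfolding comp_family_assoc h(3) ..
  qed
  have fZ: "comp_family (f q) z \<in> Hom e F (J q)" if "z \<in> Z" for z
    using that Hom_comp[OF _ f(1) J'] unfolding Z_def R'_eq by auto
  { assume H: "Hom e F (J q) = {0}"
    have "z \<in> B" if z: "z \<in> Z" for z
    proof -
      have "comp_family (f q) z = 0" using fZ[OF z] H by blast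
      from hf[OF z, unfolded this comp_family_zero_right[OF J h(1)]] have "0 - z \<in> B" .
      then show ?thesis using fam_vs.subspace_diff[OF B fam_vs.subspace_0[OF B]] by fastforce
    qed
    then have "Z = B" using BZ by blast
    then show "Ext e q F G \<cong>\<^sub>k (zero_space :: ('k, 'k) kspace)" unfolding Ext using quotient_zero[OF B] by simp }
  { fix g assume H: "Hom e F (J q) = range (\<lambda>c. family_scale c g)" and g0: "g \<noteq> 0"
    have "g = family_scale 1 g" by simp
    then have g: "g \<in> Hom e F (J q)" unfolding H by blast
    define z0 where "z0 = comp_family (h q) g"
    have z0Z: "z0 \<in> Z"
    proof -
      have "comp_family (d' q) z0 = comp_family (h (Suc q)) (comp_family (d q) g)"
        unfolding z0_def comp_family_assoc h(3) ..
      also have "\<dots> = 0" unfolding zd[OF g] by (rule comp_family_zero_right[OF J h(1)])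
      finally show ?thesis unfolding Z_def R'_eq using Hom_comp[OF g h(1) J] by (simp add: z0_def)
    qed
    \<comment> \<open>The given resolution has no nonzero coboundaries, so the identity up to
      homotopy becomes an equality.\<close>
    have fz0: "comp_family (f q) z0 = g"
    proof -
      have "comp_family (comp_family (f q) (h q)) g - g \<in> coboundaries e F (J, \<epsilon>, d) q"
      proof (rule resolution_homotopy[OF R F])
        show "g \<in> cocycles e F (J, \<epsilon>, d) q" using g zd by simp
        show "comp_family (f q) (h q) \<in> Hom e (J q) (J q)" for q by (rule Hom_comp[OF h(1) f(1) J'])
        show "comp_family (comp_family (f 0) (h 0)) \<epsilon> = \<epsilon>" unfolding comp_family_assoc[symmetric] f(2) h(2) ..
        show "comp_family (comp_family (f (Suc q)) (h (Suc q))) (d q) = comp_family (d q) (comp_family (f q) (h q))" for q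
          unfolding comp_family_assoc[symmetric] h(3) unfolding comp_family_assoc f(3) ..
      qed
      moreover have "coboundaries e F (J, \<epsilon>, d) q \<subseteq> {0}" using zd by (cases q) auto
      ultimately have "comp_family (comp_family (f q) (h q)) g - g = 0" by blast
      then show ?thesis unfolding z0_def comp_family_assoc by simp
    qed
    have "z0 \<notin> B"
    proof
      assume "z0 \<in> B"
      then have "comp_family (f q) z0 = 0"
      proof (cases q)
        case 0
        then show ?thesis using \<open>z0 \<in> B\<close> comp_family_zero_right[OF J' f(1)] unfolding B_def R'_eq by simp
      next
        case (Suc r)
        then obtain x where x: "x \<in> Hom e F (J' r)" "z0 = comp_family (d' r) x"
          using \<open>z0 \<in> B\<close> unfolding B_def R'_eq by auto
        have "comp_family (f q) z0 = comp_family (d r) (comp_family (f r) x)"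
          unfolding x(2) comp_family_assoc Suc f(3) ..
        then show ?thesis using zd[OF Hom_comp[OF x(1) f(1) J']] by simp
      qed
      then show False using fz0 g0 by simp
    qed
    moreover have "Z = {family_scale c z0 + b | c b. b \<in> B}"
    proof (intro equalityI subsetI)
      fix z assume z: "z \<in> Z"
      obtain c where c: "comp_family (f q) z = family_scale c g" using fZ[OF z] unfolding H by blast
      have b: "family_scale c z0 - z \<in> B"
        using hf[OF z] unfolding c comp_family_scale_right[OF J g h(1)] z0_def .
      have "0 - (family_scale c z0 - z) \<in> B" by (rule fam_vs.subspace_diff[OF B fam_vs.subspace_0[OF B] b])
      moreover have "z = family_scale c z0 + (0 - (family_scale c z0 - z))" by simp
      ultimately show "z \<in> {family_scale c z0 + b | c b. b \<in> B}" by blast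
    next
      fix z assume "z \<in> {family_scale c z0 + b | c b. b \<in> B}"
      then obtain c b where b: "b \<in> B" "z = family_scale c z0 + b" by blast
      have bZ: "b \<in> Hom e F (J' q)" "comp_family (d' q) b = 0" using b(1) BZ unfolding Z_def R'_eq by auto
      have zZ: "z0 \<in> Hom e F (J' q)" "comp_family (d' q) z0 = 0" using z0Z unfolding Z_def R'_eq by auto
      have sc: "family_scale c z0 \<in> Hom e F (J' q)" by (rule Hom_scale_family[OF F J' zZ(1)])
      have "comp_family (d' q) z = 0"
        unfolding b(2) comp_family_add_right[OF J' sc bZ(1) d'] comp_family_scale_right[OF J' zZ(1) d'] zZ(2) bZ(2)
        by (simp only: fam_vs.scale_zero_right add_0_left)
      moreover have "z \<in> Hom e F (J' q)" unfolding b(2) by (rule fam_vs.subspace_add[OF subspace_Hom[OF F J'] sc bZ(1)])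
      ultimately show "z \<in> Z" unfolding Z_def R'_eq by simp
    qed
    ultimately show "Ext e q F G \<cong>\<^sub>k (line_space :: ('k, 'k) kspace)"
      unfolding Ext using quotient_line[OF B] by blast }
qed

text \<open>As the one coefficient detects zero, \<open>f\<close> agrees with the multiple of
  \<open>g\<close> that has the same coefficient.\<close>

lemma Hom_eq_line:
  assumes F: "strict_poly_functor e F" and G: "strict_poly_functor e G" and g: "g \<in> Hom e F G"
    and val: "g n x L \<noteq> 0" and det: "\<And>f. f \<in> Hom e F G \<Longrightarrow> f n x L = 0 \<Longrightarrow> f = 0"
  shows "Hom e F G = range (\<lambda>c. family_scale c g)"
proof (intro equalityI subsetI)
  fix f assume f: "f \<in> Hom e F G"
  define c where "c = - (f n x L / g n x L)"
  have "f + family_scale c g = 0"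
    by (rule det[OF Hom_add_scale[OF G f g]]) (use val in \<open>simp add: family_scale_apply vscale_apply c_def\<close>)
  then have "f = family_scale (- c) g" by (simp add: eq_neg_iff_add_eq_0)
  then show "f \<in> range (\<lambda>c. family_scale c g)" by blast
next
  fix f assume "f \<in> range (\<lambda>c. family_scale c g)"
  then show "f \<in> Hom e F G" using Hom_scale_family[OF F G g] by blast
qed

section \<open>The Koszul resolution\<close>

definition koszul_map :: "nat \<Rightarrow> nat \<Rightarrow> (nat multiset list, nat multiset list, 'k::field) family" where
  "koszul_map b a = restrict_family (SL b (Suc a)) koszul"

definition hook_incl :: "nat \<Rightarrow> nat \<Rightarrow> (nat multiset list, nat multiset list, 'k::field) family" where
  "hook_incl c m = restrict_family (hookf c m) (\<lambda>v. v)"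

definition deRham_map :: "nat \<Rightarrow> nat \<Rightarrow> (nat multiset list, nat multiset list, 'k::field) family" where
  "deRham_map c m = restrict_family (hookf (Suc c) m) (deRham m)"

text \<open>Continues the Koszul resolution beyond its last nonzero term S^p. Taking the
  coefficients of \<open>SI p 0\<close> makes it a subfunctor.\<close>

definition zerof :: "nat \<Rightarrow> (nat multiset list, 'k::field) spf" where
  "zerof p = \<lparr>obj = \<lambda>n. {0}, coef = coef (SI p 0)\<rparr>"

lemma obj_zerof: "obj (zerof p) n = {0}"
  by (simp add: zerof_def)

lemma strict_poly_functor_zerof: "strict_poly_functor p (zerof p :: (nat multiset list, 'k::field) spf)"
proof -
  have "strict_poly_functor (p + 0) \<lparr>obj = \<lambda>n. {0}, coef = coef (SI p 0 :: (nat multiset list, 'k) spf)\<rparr>"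
  proof (rule strict_poly_subfunctor[OF strict_poly_functor_SI])
    fix n show "{0} \<subseteq> obj (SI p 0 :: (nat multiset list, 'k) spf) n"
      unfolding obj_SI using fun_vs.subspace_0[OF subspace_coord_space] by blast
  next
    fix m n \<alpha> v assume "v \<in> {0 :: nat multiset list \<Rightarrow> 'k}"
    then show "coef (SI p 0) m n \<alpha> v \<in> {0}" using fun_vsp.linear_0[OF lin_SI_coef] by blast
  qed (rule fun_vs.subspace_single_0)
  then show ?thesis by (simp add: zerof_def)
qed

lemma Hom_zerof: "Hom p F (zerof p) \<subseteq> {0}"
proof
  fix f assume f: "f \<in> Hom p F (zerof p)"
  have "f n v = 0" for n v using Hom_in[OF f, of v n] Hom_outside[OF f, of v n] unfolding obj_zerof by blast
  then have "f = 0" by (intro ext) simp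
  then show "f \<in> {0}" by simp
qed

lemma injective_zerof: "injective_spf p (zerof p :: (nat multiset list, 'k::field) spf)"
  unfolding injective_spf_def
proof (intro conjI allI impI strict_poly_functor_zerof)
  fix F G :: "(nat multiset list, 'k) spf" and i f
  assume a: "strict_poly_functor p F \<and> strict_poly_functor p G \<and> i \<in> Hom p F G \<and> monic F i \<and> f \<in> Hom p F (zerof p)"
  then have "f = 0" using Hom_zerof by blast
  moreover have "comp_family 0 i = 0" unfolding comp_family_def by (intro ext) simp
  moreover have "0 \<in> Hom p G (zerof p)" using a Hom_zero_family strict_poly_functor_zerof by blast
  ultimately show "\<exists>g\<in>Hom p G (zerof p). comp_family g i = f" by blast
qed

section \<open>The Koszul resolution in characteristic p\<close>

locale positive_char =
  fixes p :: nat and K :: "'k::field itself"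
  assumes char: "CHAR('k) = p" and pos: "p > 0"
begin

lemma fact_neq_0: "a < p \<Longrightarrow> of_nat (fact a) \<noteq> (0 :: 'k)"
proof (induction a)
  case (Suc a)
  have "of_nat (Suc a) \<noteq> (0 :: 'k)"
    unfolding of_nat_eq_0_iff_char_dvd char using Suc.prems by (auto dest: dvd_imp_le)
  moreover have "of_nat (fact a) \<noteq> (0 :: 'k)" using Suc by simp
  moreover have "fact (Suc a) = Suc a * (fact a :: nat)" by simp
  ultimately show ?case by (metis no_zero_divisors of_nat_mult)
qed simp

lemma koszul_map_Hom:
  assumes "b + Suc a = p" "0 < b"
  shows "koszul_map b a \<in> Hom p (SL b (Suc a)) (SL (Suc b) a :: (nat multiset list, 'k) spf)"
proof -
  have f: "of_nat (fact (Suc a)) \<noteq> (0 :: 'k)" "of_nat (fact a) \<noteq> (0 :: 'k)"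
    using assms by (intro fact_neq_0, simp)+
  have J: "strict_poly_functor p (SL b (Suc a) :: (nat multiset list, 'k) spf)"
    using strict_poly_functor_SL[of b "Suc a"] assms by simp
  show ?thesis
    unfolding koszul_map_def
  proof (rule restrict_family_Hom[OF J lin_koszul])
    fix n and v :: "nat multiset list \<Rightarrow> 'k" assume "v \<in> obj (SL b (Suc a)) n"
    then show "koszul v \<in> obj (SL (Suc b) a) n"
      unfolding SL_eq_alternating[OF f(1)] SL_eq_alternating[OF f(2)] by (rule koszul_alternating)
  next
    fix m n \<alpha> and v :: "nat multiset list \<Rightarrow> 'k" assume "v \<in> obj (SL b (Suc a)) n"
    then have "v \<in> coord_space (labels b (Suc a) n)" by (simp add: obj_SL)
    then show "koszul (coef (SL b (Suc a)) m n \<alpha> v) = coef (SL (Suc b) a) m n \<alpha> (koszul v)"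
      unfolding coef_SL by (rule koszul_natural)
  qed
qed

lemma strict_hookf: "Suc c + m = p \<Longrightarrow> strict_poly_functor p (hookf c m :: (nat multiset list, 'k) spf)"
  using strict_poly_functor_hookf[OF fact_neq_0, of m c] by simp

lemma obj_hookf_SL:
  assumes "Suc c + m = p"
  shows "obj (hookf c m) n = {v \<in> obj (SL (Suc c) m :: (nat multiset list, 'k) spf) n. m = 0 \<or> koszul v = 0}"
proof -
  have "of_nat (fact m) \<noteq> (0 :: 'k)" using assms by (intro fact_neq_0) simp
  from SL_eq_alternating[OF this] show ?thesis unfolding obj_hookf_eq by blast
qed

lemma hook_incl_Hom:
  assumes "Suc c + m = p"
  shows "hook_incl c m \<in> Hom p (hookf c m) (SL (Suc c) m :: (nat multiset list, 'k) spf)"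
  unfolding hook_incl_def
  by (rule restrict_family_Hom[OF strict_hookf[OF assms]]) (auto simp: lin_iff obj_hookf_SL[OF assms])

lemma hookf_coord: "Suc c + m = p \<Longrightarrow> v \<in> obj (hookf c m) n \<Longrightarrow> v \<in> (coord_space (labels (Suc c) m n) :: (_ \<Rightarrow> 'k) set)"
  unfolding obj_hookf_SL by (simp add: obj_SL)

lemma lin_deRham: "lin (deRham m)"
  unfolding deRham_def by (rule lin_compose[OF lin_comult lin_altern])

lemma deRham_map_Hom:
  assumes "Suc (Suc c) + m = p"
  shows "deRham_map c m \<in> Hom p (hookf (Suc c) m) (SL (Suc c) (Suc m) :: (nat multiset list, 'k) spf)"
  unfolding deRham_map_def
proof (rule restrict_family_Hom[OF strict_hookf[OF assms] lin_deRham])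
  fix n and v :: "nat multiset list \<Rightarrow> 'k" assume "v \<in> obj (hookf (Suc c) m) n"
  then show "deRham m v \<in> obj (SL (Suc c) (Suc m)) n"
    unfolding deRham_def by (rule altern_in_SL[OF comult_in[OF hookf_coord[OF assms]]])
next
  fix k n \<alpha> and v :: "nat multiset list \<Rightarrow> 'k" assume "v \<in> obj (hookf (Suc c) m) n"
  note v = hookf_coord[OF assms this]
  show "deRham m (coef (hookf (Suc c) m) k n \<alpha> v) = coef (SL (Suc c) (Suc m)) k n \<alpha> (deRham m v)"
    unfolding deRham_def coef_hookf coef_SL comult_natural[OF v] altern_natural[OF comult_in[OF v]] ..
qed

lemma wedge_hookf:
  assumes "label M w \<in> labels c (Suc m) n" "distinct w"
  shows "koszul (wedge M w) \<in> obj (hookf c m) n"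
  unfolding obj_hookf by (rule imageI, rule wedge_alternating[OF assms])

lemma Hom_hookf_same:
  assumes e: "Suc c + m = p"
  shows "Hom p (hookf c m) (SL (Suc c) m) = range (\<lambda>a. family_scale a (hook_incl c m :: (_, _, 'k) family))"
    and "hook_incl c m \<noteq> (0 :: (_, _, 'k) family)"
proof -
  let ?x = "koszul (wedge (replicate_mset c 0) [0..<Suc m]) :: _ \<Rightarrow> 'k" and ?L = "wlabel (Suc c) (std_word (Suc c) m)"
  have "?x \<in> obj (hookf c m) (m + 1)" by (rule wedge_hookf) auto
  then have val: "hook_incl c m (m + 1) ?x ?L = 1" unfolding hook_incl_def by (simp add: koszul_wedge_value del: One_nat_def)
  then show "hook_incl c m \<noteq> (0 :: (_, _, 'k) family)" by auto
  have m: "of_nat (fact m) \<noteq> (0 :: 'k)" using e by (intro fact_neq_0) simp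
  have J: "strict_poly_functor p (SL (Suc c) m :: (nat multiset list, 'k) spf)"
    using strict_poly_functor_SL[of "Suc c" m] e by simp
  show "Hom p (hookf c m) (SL (Suc c) m) = range (\<lambda>a. family_scale a (hook_incl c m :: (_, _, 'k) family))"
    by (rule Hom_eq_line[OF strict_hookf[OF e] J hook_incl_Hom[OF e], where n = "m + 1" and x = ?x and L = ?L])
      (use val Hom_hookf_eq_0_same[OF m] e in auto)
qed

lemma Hom_hookf_next:
  assumes e: "Suc (Suc c) + m = p"
  shows "Hom p (hookf (Suc c) m) (SL (Suc c) (Suc m)) = range (\<lambda>a. family_scale a (deRham_map c m :: (_, _, 'k) family))"
    and "deRham_map c m \<noteq> (0 :: (_, _, 'k) family)"
proof -
  let ?x = "koszul (wedge (add_mset (Suc m) (replicate_mset c 0)) [0..<Suc m]) :: _ \<Rightarrow> 'k"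
    and ?L = "wlabel (Suc c) (std_word (Suc c) (Suc m))"
  have f: "of_nat (fact m) \<noteq> (0 :: 'k)" "of_nat (fact (Suc m)) \<noteq> (0 :: 'k)"
    using e by (intro fact_neq_0, simp)+
  have "?x \<in> obj (hookf (Suc c) m) (Suc m + 1)" by (rule wedge_hookf) auto
  then have "deRham_map c m (Suc m + 1) ?x ?L = (- 1) ^ m * of_nat (fact m)"
    unfolding deRham_map_def by (simp only: restrict_family_in deRham_value_next)
  \<comment> \<open>As \<open>m < p\<close>, the factor m! is invertible.\<close>
  then have val: "deRham_map c m (Suc m + 1) ?x ?L \<noteq> 0" using f(1) by simp
  then show "deRham_map c m \<noteq> (0 :: (_, _, 'k) family)" by (metis zero_fun_apply)
  have J: "strict_poly_functor p (SL (Suc c) (Suc m) :: (nat multiset list, 'k) spf)"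
    using strict_poly_functor_SL[of "Suc c" "Suc m"] e by simp
  show "Hom p (hookf (Suc c) m) (SL (Suc c) (Suc m)) = range (\<lambda>a. family_scale a (deRham_map c m :: (_, _, 'k) family))"
  proof (rule Hom_eq_line[OF strict_hookf[OF e] J deRham_map_Hom[OF e], where n = "Suc m + 1" and x = ?x and L = ?L])
    show "deRham_map c m (Suc m + 1) ?x ?L \<noteq> 0" by (rule val)
    fix f :: "(_, _, 'k) family" assume "f \<in> Hom p (hookf (Suc c) m) (SL (Suc c) (Suc m))" "f (Suc m + 1) ?x ?L = 0"
    moreover have "Suc c + Suc m = p" using e by simp
    ultimately show "f = 0" using Hom_hookf_eq_0_next[OF f(2), of f c] by simp
  qed
qed

lemma koszul_map_hook_incl:
  assumes "Suc c + Suc a = p"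
  shows "comp_family (koszul_map (Suc c) a) (hook_incl c (Suc a)) = (0 :: (_, _, 'k) family)"
proof (intro ext)
  fix n v L
  show "comp_family (koszul_map (Suc c) a) (hook_incl c (Suc a)) n v L = (0 :: (_, _, 'k) family) n v L"
  proof (cases "v \<in> obj (hookf c (Suc a)) n")
    case True
    then have "v \<in> obj (SL (Suc c) (Suc a)) n" "koszul v = 0" using obj_hookf_SL[OF assms] by auto
    then show ?thesis using True unfolding comp_family_apply hook_incl_def koszul_map_def by simp
  next
    case False
    moreover have "koszul 0 = (0 :: nat multiset list \<Rightarrow> 'k)" by (rule fun_vsp.linear_0[OF lin_koszul])
    ultimately show ?thesis unfolding comp_family_apply hook_incl_def koszul_map_def restrict_family_def by simp
  qed
qed

text \<open>
  On \<open>hookf (Suc c) m\<close>, the composite of the two maps is multiplication by \<open>m!\<close> times the degree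
  \<open>p = 0\<close>; it suffices to check this on one vector.
\<close>

lemma koszul_map_deRham_map:
  assumes e: "Suc (Suc c) + m = p"
  shows "comp_family (koszul_map (Suc c) m) (deRham_map c m) = (0 :: (_, _, 'k) family)"
proof -
  let ?h = "comp_family (koszul_map (Suc c) m) (deRham_map c m) :: (_, _, 'k) family"
  let ?N = "replicate_mset (Suc c) (0 :: nat)"
  let ?x = "koszul (wedge ?N [0..<Suc m]) :: _ \<Rightarrow> 'k"
    and ?L = "wlabel (Suc (Suc c)) (std_word (Suc (Suc c)) m)"
  have e': "Suc c + Suc m = p" using e by simp
  have m: "of_nat (fact m) \<noteq> (0 :: 'k)" using e by (intro fact_neq_0) simp
  have J: "strict_poly_functor p (SL (Suc c) (Suc m) :: (nat multiset list, 'k) spf)"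
    using strict_poly_functor_SL[of "Suc c" "Suc m"] e by simp
  have h: "?h \<in> Hom p (hookf (Suc c) m) (SL (Suc (Suc c)) m)"
    by (rule Hom_comp[OF deRham_map_Hom[OF e] koszul_map_Hom[OF e'] J]) simp
  have x: "?x \<in> obj (hookf (Suc c) m) (m + 1)" by (rule wedge_hookf) auto
  have dx: "deRham_map c m (m + 1) ?x = deRham m ?x" unfolding deRham_map_def by (rule restrict_family_in[OF x])
  have "deRham m ?x \<in> obj (SL (Suc c) (Suc m)) (m + 1)" using Hom_in[OF deRham_map_Hom[OF e] x] unfolding dx .
  then have "?h (m + 1) ?x = koszul (deRham m ?x)"
    unfolding comp_family_apply dx koszul_map_def by (rule restrict_family_in)
  \<comment> \<open>The symmetric factor of \<open>?L\<close> is a power of 0, so only the letter 0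
    can be taken out of it; this leaves the coefficient of \<open>deRham_value_same\<close>.\<close>
  moreover have "koszul (deRham m ?x) ?L = deRham m ?x (label ?N (0 # [1..<m + 1]))"
    unfolding wlabel_std_word koszul_label by simp
  moreover have "0 # [1..<m + 1] = [0..<Suc m]" by (simp add: upt_conv_Cons)
  \<comment> \<open>The degree, a factor of that coefficient, is p.\<close>
  moreover have "of_nat (Suc (Suc c) + m) = (0 :: 'k)" unfolding e using of_nat_CHAR char by metis
  ultimately have "?h (m + 1) ?x ?L = 0" by (simp only: deRham_value_same mult_zero_right)
  then show ?thesis using Hom_hookf_eq_0_same[OF m, of ?h "Suc c"] h e by simp
qed

text \<open>The exterior degree \<open>n - q\<close> never exceeds \<open>n\<close>; for
  \<open>n < p\<close> this keeps every term injective.\<close>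

definition koszul_term :: "nat \<Rightarrow> nat \<Rightarrow> (nat multiset list, 'k) spf" where
  "koszul_term n q = (if q \<le> n then SL (p - (n - q)) (n - q) else zerof p)"

definition koszul_diff :: "nat \<Rightarrow> nat \<Rightarrow> (nat multiset list, nat multiset list, 'k) family" where
  "koszul_diff n q = (if q < n then koszul_map (p - (n - q)) (n - Suc q) else 0)"

lemma injective_koszul_term: "n < p \<Longrightarrow> injective_spf p (koszul_term n q)"
  unfolding koszul_term_def using injective_SL[OF fact_neq_0, of "n - q" "p - (n - q)"] injective_zerof by auto

lemma koszul_diff_Hom:
  assumes "n < p"
  shows "koszul_diff n q \<in> Hom p (koszul_term n q) (koszul_term n (Suc q))"
proof (cases "q < n")
  case True
  define a where "a = n - Suc q"
  have a: "n - q = Suc a" using True by (simp add: a_def)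
  moreover have "p - a = Suc (p - Suc a)" using a assms by simp
  ultimately have "koszul_term n q = SL (p - Suc a) (Suc a)" "koszul_term n (Suc q) = SL (Suc (p - Suc a)) a" "koszul_diff n q = koszul_map (p - Suc a) a"
    using True unfolding koszul_term_def koszul_diff_def by (simp_all add: a_def)
  then show ?thesis using koszul_map_Hom[of "p - Suc a" a] a assms by simp
next
  case False
  then show ?thesis unfolding koszul_diff_def
    using Hom_zero_family[OF injective_strict[OF injective_koszul_term] injective_strict[OF injective_koszul_term], OF assms assms] by simp
qed

text \<open>Up to the last nonzero term, the image of a differential and the kernel of the next one
  are both a functor \<open>hookf b a\<close>: the image by definition, the kernel by
  \<open>obj_hookf_SL\<close>.\<close>

lemma koszul_resolution:
  assumes n: "Suc c + n = p"
  shows "injective_resolution p (hookf c n) (koszul_term n, hook_incl c n, koszul_diff n)"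
proof -
  have np: "n < p" using n by simp
  have pn: "p - n = Suc c" using n by simp
  have std_word: "koszul_term n 0 = SL (Suc c) n" by (simp add: koszul_term_def pn)
  have "monic (hookf c n) (hook_incl c n :: (_, _, 'k) family)"
    unfolding monic_def hook_incl_def restrict_family_def by (auto simp: inj_on_def)
  moreover have "exact_at (hookf c n) (hook_incl c n) (koszul_term n 0) (koszul_diff n 0)"
    unfolding exact_at_def
  proof
    fix k
    have "hook_incl c n k ` obj (hookf c n) k = (obj (hookf c n) k :: (_ \<Rightarrow> 'k) set)"
      unfolding hook_incl_def by simp
    also have "\<dots> = {v \<in> obj (SL (Suc c) n) k. n = 0 \<or> koszul v = 0}" by (rule obj_hookf_SL[OF n])
    also have "\<dots> = {v \<in> obj (koszul_term n 0) k. koszul_diff n 0 k v = 0}"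
    proof (cases n)
      case (Suc a)
      then have "koszul_diff n 0 k v = koszul v" if "v \<in> obj (SL (Suc c) n) k" for v
        using that pn unfolding koszul_diff_def koszul_map_def by simp
      then show ?thesis unfolding std_word using Suc by auto
    qed (use std_word in \<open>simp add: koszul_diff_def\<close>)
    finally show "hook_incl c n k ` obj (hookf c n) k = {v \<in> obj (koszul_term n 0) k. koszul_diff n 0 k v = 0}" .
  qed
  moreover have "exact_at (koszul_term n q) (koszul_diff n q) (koszul_term n (Suc q)) (koszul_diff n (Suc q))" for q
    unfolding exact_at_def
  proof
    fix k
    show "koszul_diff n q k ` obj (koszul_term n q) k = {v \<in> obj (koszul_term n (Suc q)) k. koszul_diff n (Suc q) k v = 0}"
    proof (cases "q < n")
      case True
      define a where "a = n - Suc q"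
      define b where "b = p - Suc a"
      have a: "n - q = Suc a" "Suc q + a = n" using True by (simp_all add: a_def)
      then have b: "p - a = Suc b" "Suc b + a = p" using np by (simp_all add: b_def)
      have eq: "koszul_term n q = SL b (Suc a)" "koszul_term n (Suc q) = SL (Suc b) a" "koszul_diff n q = koszul_map b a"
        using True a b by (simp_all add: koszul_term_def koszul_diff_def a_def[symmetric] b_def[symmetric])
      have "of_nat (fact (Suc a)) \<noteq> (0 :: 'k)" using a np by (intro fact_neq_0) simp
      note A = SL_eq_alternating[OF this]
      have "koszul_diff n q k ` obj (koszul_term n q) k = koszul ` obj (SL b (Suc a)) k"
        unfolding eq koszul_map_def by simp
      also have "\<dots> = obj (hookf b a) k" unfolding A obj_hookf ..
      also have "\<dots> = {v \<in> obj (SL (Suc b) a) k. a = 0 \<or> koszul v = 0}" by (rule obj_hookf_SL[OF b(2)])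
      also have "\<dots> = {v \<in> obj (koszul_term n (Suc q)) k. koszul_diff n (Suc q) k v = 0}"
      proof (cases a)
        case 0
        then have "koszul_diff n (Suc q) = 0" using a by (simp add: koszul_diff_def)
        then show ?thesis unfolding eq using 0 by simp
      next
        case (Suc a')
        then have "koszul_diff n (Suc q) = koszul_map (Suc b) a'" using a b unfolding koszul_diff_def by (auto simp: a_def)
        then have "koszul_diff n (Suc q) k v = koszul v" if "v \<in> obj (SL (Suc b) a) k" for v
          using that Suc unfolding koszul_map_def by simp
        then show ?thesis unfolding eq using Suc by auto
      qed
      finally show ?thesis .
    next
      case False
      then have eq: "koszul_term n (Suc q) = zerof p" "koszul_diff n q = 0" "koszul_diff n (Suc q) = 0" by (simp_all add: koszul_term_def koszul_diff_def)
      have "0 \<in> obj (koszul_term n q) k"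
        using fun_vs.subspace_0[OF strict_subspace[OF injective_strict[OF injective_koszul_term[OF np]]]] .
      then show ?thesis unfolding eq obj_zerof by auto
    qed
  qed
  ultimately show ?thesis
    using injective_koszul_term[OF np] koszul_diff_Hom[OF np] hook_incl_Hom[OF n] std_word by simp
qed

section \<open>Morphisms into the terms of the resolution\<close>

lemma Hom_hookf_koszul_term_zero:
  assumes m: "Suc c + m = p" and n: "n < p" and q: "n < q \<or> (n - q \<noteq> m \<and> n - q \<noteq> Suc m)"
  shows "Hom p (hookf c m) (koszul_term n q) = {0}"
proof -
  have "0 \<in> Hom p (hookf c m) (koszul_term n q)"
    using Hom_zero_family[OF strict_hookf[OF m] injective_strict[OF injective_koszul_term[OF n]]] .
  moreover have "f = 0" if f: "f \<in> Hom p (hookf c m) (koszul_term n q)" for f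
  proof (cases "q \<le> n")
    case True
    have e: "Suc c + m = p - (n - q) + (n - q)" "p - (n - q) + (n - q) = p" "0 < p - (n - q)" using m n by simp_all
    have fs: "of_nat (fact m) \<noteq> (0 :: 'k)" "of_nat (fact (n - q)) \<noteq> (0 :: 'k)"
      using m n by (intro fact_neq_0, simp)+
    have "f \<in> Hom (p - (n - q) + (n - q)) (hookf c m) (SL (p - (n - q)) (n - q))"
      using f True unfolding koszul_term_def e(2) by simp
    then show ?thesis using Hom_hookf_vanish[OF e(1,3) fs] q True by auto
  next
    case False
    then show ?thesis using f Hom_zerof unfolding koszul_term_def by auto
  qed
  ultimately show ?thesis by blast
qed

lemma Hom_hookf_koszul_term_line:
  assumes m: "Suc c + m = p" and n: "n < p" and q: "q \<le> n" "n - q = m \<or> n - q = Suc m"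
  obtains g where "Hom p (hookf c m) (koszul_term n q) = range (\<lambda>a. family_scale a g)" "g \<noteq> 0" "comp_family (koszul_diff n q) g = 0"
proof (cases "n - q = m")
  case True
  have pm: "p - m = Suc c" using m by simp
  have K: "koszul_term n q = SL (Suc c) m" using q True by (simp add: koszul_term_def pm)
  have "comp_family (koszul_diff n q) (hook_incl c m) = 0"
  proof (cases m)
    case 0
    then show ?thesis using True q unfolding koszul_diff_def comp_family_def by (intro ext) simp
  next
    case (Suc a)
    then have "n - Suc q = a" "q < n" using True q by linarith+
    then have "koszul_diff n q = koszul_map (Suc c) a" using True pm by (simp add: koszul_diff_def)
    then show ?thesis using koszul_map_hook_incl[of c a] m Suc by simp
  qed
  then show thesis using that Hom_hookf_same[OF m] K by simp
next
  case False
  then have a: "n - q = Suc m" using q by simp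
  \<comment> \<open>\<open>c = 0\<close> would give \<open>Suc m = p\<close>, whereas
    \<open>Suc m = n - q < p\<close>.\<close>
  then obtain c' where c: "c = Suc c'" using m n by (cases c) auto
  have pm: "p - Suc m = Suc c'" using m c by simp
  have K: "koszul_term n q = SL (Suc c') (Suc m)" using q a by (simp add: koszul_term_def pm)
  have e: "Suc (Suc c') + m = p" using m c by simp
  have "n - Suc q = m" "q < n" using a by linarith+
  then have "koszul_diff n q = koszul_map (Suc c') m" using a pm by (simp add: koszul_diff_def)
  then have "comp_family (koszul_diff n q) (deRham_map c' m) = 0" using koszul_map_deRham_map[OF e] by simp
  then show thesis using that Hom_hookf_next[OF e] K c by simp
qed

lemma comp_koszul_diff_zero:
  assumes m: "Suc c + m = p" and n: "n < p" and f: "f \<in> Hom p (hookf c m) (koszul_term n q)"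
  shows "comp_family (koszul_diff n q) f = 0"
proof -
  note K = injective_strict[OF injective_koszul_term[OF n]]
  show ?thesis
  proof (cases "n < q \<or> (n - q \<noteq> m \<and> n - q \<noteq> Suc m)")
    case True
    then have "f = 0" using Hom_hookf_koszul_term_zero[OF m n] f by blast
    then show ?thesis using comp_family_zero_right[OF K koszul_diff_Hom[OF n]] by simp
  next
    case False
    then obtain g where g: "Hom p (hookf c m) (koszul_term n q) = range (\<lambda>a. family_scale a g)" "comp_family (koszul_diff n q) g = 0"
      using Hom_hookf_koszul_term_line[OF m n, of q] by (metis not_less)
    obtain a where a: "f = family_scale a g" using f unfolding g(1) by blast
    have "g = family_scale 1 g" by simp
    then have gH: "g \<in> Hom p (hookf c m) (koszul_term n q)" unfolding g(1) by blast
    show ?thesis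
      unfolding a comp_family_scale_right[OF K gH koszul_diff_Hom[OF n]] g(2) by (rule fam_vs.scale_zero_right)
  qed
qed

lemma Ext_hookf:
  assumes m: "Suc c + m = p" and n: "Suc d + n = p"
  shows "Ext p q (hookf c m :: (nat multiset list, 'k) spf) (hookf d n) \<cong>\<^sub>k
    (if q \<le> n \<and> (n - q = m \<or> n - q = Suc m) then line_space else zero_space)"
proof -
  have np: "n < p" using n by simp
  note E = Ext_by_resolution[OF strict_hookf[OF m] strict_hookf[OF n] koszul_resolution[OF n] comp_koszul_diff_zero[OF m np], of q]
  show ?thesis
  proof (cases "q \<le> n \<and> (n - q = m \<or> n - q = Suc m)")
    case True
    then obtain g where "Hom p (hookf c m) (koszul_term n q) = range (\<lambda>a. family_scale a g)" "g \<noteq> 0"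
      using Hom_hookf_koszul_term_line[OF m np, of q] by metis
    then show ?thesis using E(2) True by auto
  next
    case False
    then have "Hom p (hookf c m) (koszul_term n q) = {0}" by (intro Hom_hookf_koszul_term_zero[OF m np]) auto
    then show ?thesis using E(1) False by auto
  qed
qed

end

theorem proposition2p6:
  fixes p m n q :: nat
  assumes "CHAR('k::field) = p" and "p > 0"
    and "m \<le> p - 1" and "n \<le> p - 1"
  shows "Ext p q (hook_schur p m :: (nat multiset list, 'k) spf) (hook_schur p n) \<cong>\<^sub>k
    (if (n = m \<and> q = 0) \<or> (n > m \<and> (q = n - m - 1 \<or> q = n - m))
     then line_space else zero_space)"
proof -
  interpret positive_char p "TYPE('k)" by unfold_locales (fact assms)+
  have m: "Suc (p - m - 1) + m = p" and n: "Suc (p - n - 1) + n = p" using assms by simp_all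
  have h: "hook_schur p m = (hookf (p - m - 1) m :: (nat multiset list, 'k) spf)"
    "hook_schur p n = (hookf (p - n - 1) n :: (nat multiset list, 'k) spf)"
    by (rule hook_schur_eq, use m n in simp)+
  \<comment> \<open>The inclusion contributes at n - q = m and the de Rham map at n - q = m + 1; the
    condition \<open>q \<le> n\<close> guards against truncated subtraction.\<close>
  have "q \<le> n \<and> (n - q = m \<or> n - q = Suc m) \<longleftrightarrow>
    (n = m \<and> q = 0) \<or> (n > m \<and> (q = n - m - 1 \<or> q = n - m))" by auto
  then show ?thesis using Ext_hookf[OF m n, of q] unfolding h by simp
qed

end
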